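(* Let $d\ge 2$, $\alpha>\frac d2$, and let $(M,g)$ be the torus $\mathbb T^d=\mathbb R^d/(2\pi\mathbb Z)^d$ with the flat metric. Let $u:\mathbb R\times\mathbb T^d\to\mathbb R^d$ be a time-dependent divergence-free vector field belonging to $L^1_{\mathrm{loc}}(\mathbb R,\mathcal C^\alpha(\mathbb T^d))$. Let $\mu_\alpha$ be the centered Gaussian measure on $L^2(\mathbb T^d)$ with covariance operator $(1-\Delta)^{-\alpha}$. Then the following statements are equivalent: (i) $\mu_\alpha$ is quasi-invariant under the flow of $\partial_t\Omega+u\cdot\nabla\Omega=0$; (ii) $\mu_\alpha$ is invariant under the flow of $\partial_t\Omega+u\cdot\nabla\Omega=0$; (iii) $u$ is spatially constant, i.e. $u(t,x)=c(t)$ for almost every $t$, where $c$ is a given $L^1_{\mathrm{loc}}$ function.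
   Context: When $\alpha$ is not an integer, $\mathcal C^\alpha$ means the Hölder space $\mathcal C^{\lfloor\alpha\rfloor,\alpha-\lfloor\alpha\rfloor}$. It is a standing assumption that $u\in L^1_{\mathrm{loc}}(\mathbb R,\mathcal C^{1,\varepsilon})$ for some $\varepsilon>0$. For $x\in\mathbb T^d$ let $t\mapsto X_t(x)$ solve $\partial_tX_t(x)=u(t,X_t(x))$, $X_0(x)=x$; this is globally defined and $X_t$ is a diffeomorphism. The flow of the transport equation is $S(t)\Omega_0=\Omega_0\circ X_t^{-1}$, and $\mu_\alpha^t=S(t)_*\mu_\alpha$ (pushforward). "$\mu_\alpha$ is quasi-invariant under the flow" means that $\mu_\alpha^t$ and $\mu_\alpha$ are mutually absolutely continuous for every $t\in\mathbb R$; "invariant" means $\mu_\alpha^t=\mu_\alpha$ for every $t\in\mathbb R$. The measure $\mu_\alpha$ is characterized among centered Gaussian measures by $\int\langle f,\phi\rangle\langle\phi,h\rangle\,d\mu_\alpha(\phi)=\langle f,(1-\Delta)^{-\alpha}h\rangle_{L^2(\mathbb T^d)}$ for all test functions $f,h$; equivalently it is the law of $x\mapsto(2\pi)^{-d/2}\sum_{n\in\mathbb Z^d}(1+|n|^2)^{-\alpha/2}\tilde g_ne^{in\cdot x}$ with $(\tilde g_n)_n$ complex centered jointly Gaussian, $\tilde g_{-n}=\overline{\tilde g_n}$, $\mathbb E(\tilde g_m\tilde g_n)=\delta_{n+m}$ ($\delta_k=1$ if $k=0$ and $0$ otherwise). *)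

theory Defs
  imports "HOL-Probability.Probability"
begin

section \<open>Functions on the flat torus\<close>

text \<open>The torus of dimension \<open>d = CARD('n)\<close> is the quotient of \<^typ>\<open>real^'n\<close> by
  \<open>2 * pi * \<int>^d\<close>. Functions on it are functions on \<^typ>\<open>real^'n\<close> that are
  \<open>2 * pi\<close>-periodic in every coordinate, and integrals over it are integrals over a
  period cell (so that its total volume is \<open>(2 * pi)^d\<close>).\<close>

definition torus_periodic :: "(real^'n \<Rightarrow> 'b) \<Rightarrow> bool" where
  "torus_periodic f \<longleftrightarrow> (\<forall>x i. f (x + (2 * pi) *\<^sub>R axis i 1) = f x)"

definition torus_cell :: "(real^'n) measure" where
  "torus_cell = restrict_space lborel (cbox 0 (\<chi> i. 2 * pi))"


section \<open>Hoelder spaces\<close>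

definition partial_deriv ::
    "'n \<Rightarrow> (real^'n \<Rightarrow> 'b::real_normed_vector) \<Rightarrow> real^'n \<Rightarrow> 'b" where
  "partial_deriv i f x = frechet_derivative f (at x) (axis i 1)"

definition iterated_partial ::
    "'n list \<Rightarrow> (real^'n \<Rightarrow> 'b::real_normed_vector) \<Rightarrow> real^'n \<Rightarrow> 'b" where
  "iterated_partial js f = fold partial_deriv js f"

primrec cont_diff :: "nat \<Rightarrow> (real^'n \<Rightarrow> 'b::real_normed_vector) \<Rightarrow> bool" where
  "cont_diff 0 f \<longleftrightarrow> continuous_on UNIV f"
| "cont_diff (Suc k) f \<longleftrightarrow>
     (\<forall>x. f differentiable (at x)) \<and> (\<forall>i. cont_diff k (partial_deriv i f))"

text \<open>The norm of \<open>C\<^bsup>k,\<gamma>\<^esup>\<close>, with the convention that \<open>C\<^bsup>k,0\<^esup>\<close> is the classical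
  space \<open>C\<^bsup>k\<^esup>\<close>. In the second sum the term with \<open>x = y\<close> is \<open>0 / 0 = 0\<close>. For periodic
  functions the supremum over \<^typ>\<open>real^'n\<close> is the same as the one over the torus with its
  quotient distance.\<close>

definition holder_norm ::
    "nat \<Rightarrow> real \<Rightarrow> (real^'n \<Rightarrow> 'b::real_normed_vector) \<Rightarrow> ennreal" where
  "holder_norm k \<gamma> f =
     (\<Sum>js | length js \<le> k. SUP x. ennreal (norm (iterated_partial js f x))) +
     (if \<gamma> = 0 then 0 else
       (\<Sum>js | length js = k. SUP (x, y).
          ennreal (norm (iterated_partial js f x - iterated_partial js f y) / dist x y powr \<gamma>)))"

definition holder_space ::
    "nat \<Rightarrow> real \<Rightarrow> (real^'n \<Rightarrow> 'b::real_normed_vector) set" where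
  "holder_space k \<gamma> = {f. torus_periodic f \<and> cont_diff k f \<and> holder_norm k \<gamma> f < \<infinity>}"

text \<open>The Bochner space \<open>L\<^sup>1\<^sub>l\<^sub>o\<^sub>c(\<real>, C\<^bsup>k,\<gamma>\<^esup>)\<close>: strongly measurable functions (limits almost
  everywhere, in the norm of \<open>C\<^bsup>k,\<gamma>\<^esup>\<close>, of simple functions) whose norm is locally
  integrable. No requirement is made on an exceptional null set of times.\<close>

definition L1_loc_holder ::
    "nat \<Rightarrow> real \<Rightarrow> (real \<Rightarrow> real^'n \<Rightarrow> 'b::real_normed_vector) set" where
  "L1_loc_holder k \<gamma> = {u.
     (AE t in lebesgue. u t \<in> holder_space k \<gamma>) \<and>
     (\<exists>s :: nat \<Rightarrow> real \<Rightarrow> real^'n \<Rightarrow> 'b.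
        (\<forall>m. simple_function lebesgue (s m) \<and> range (s m) \<subseteq> holder_space k \<gamma>) \<and>
        (AE t in lebesgue. (\<lambda>m. holder_norm k \<gamma> (\<lambda>x. s m t x - u t x)) \<longlonglongrightarrow> 0)) \<and>
     (\<forall>T. (\<integral>\<^sup>+t\<in>{-T..T}. holder_norm k \<gamma> (u t) \<partial>lebesgue) < \<infinity>)}"

abbreviation L1_loc_C :: "real \<Rightarrow> (real \<Rightarrow> real^'n \<Rightarrow> 'b::real_normed_vector) set" where
  "L1_loc_C \<alpha> \<equiv> L1_loc_holder (nat \<lfloor>\<alpha>\<rfloor>) (frac \<alpha>)"

definition divergence :: "(real^'n \<Rightarrow> real^'n) \<Rightarrow> real^'n \<Rightarrow> real" where
  "divergence v x = (\<Sum>i\<in>UNIV. partial_deriv i v x $ i)"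


section \<open>The real Hilbert space of square integrable functions on the torus\<close>

definition torus_square_integrable :: "(real^'n \<Rightarrow> real) \<Rightarrow> bool" where
  "torus_square_integrable f \<longleftrightarrow>
     torus_periodic f \<and> f \<in> borel_measurable borel \<and> integrable torus_cell (\<lambda>x. (f x)\<^sup>2)"

definition torus_L2_rel :: "(real^'n \<Rightarrow> real) \<Rightarrow> (real^'n \<Rightarrow> real) \<Rightarrow> bool" where
  "torus_L2_rel f g \<longleftrightarrow> torus_square_integrable f \<and> torus_square_integrable g \<and>
     (AE x in torus_cell. f x = g x)"

lemma torus_square_integrable_zero: "torus_square_integrable (\<lambda>_. 0)"
  by (simp add: torus_square_integrable_def torus_periodic_def)

lemma borel_measurable_torus_cell:
  "f \<in> borel_measurable borel \<Longrightarrow> f \<in> borel_measurable torus_cell"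
  unfolding torus_cell_def by (rule measurable_restrict_space1) simp

lemma torus_square_integrable_mult:
  assumes "torus_square_integrable f" "torus_square_integrable g"
  shows "integrable torus_cell (\<lambda>x. f x * g x)"
proof (rule Bochner_Integration.integrable_bound)
  show "integrable torus_cell (\<lambda>x. (f x)\<^sup>2 + (g x)\<^sup>2)"
    using assms by (auto simp: torus_square_integrable_def)
  have "f \<in> borel_measurable torus_cell" "g \<in> borel_measurable torus_cell"
    using assms by (auto simp: torus_square_integrable_def intro: borel_measurable_torus_cell)
  then show "(\<lambda>x. f x * g x) \<in> borel_measurable torus_cell"
    by (rule borel_measurable_times)
  have "norm (a * b) \<le> norm (a\<^sup>2 + b\<^sup>2)" for a b :: real
  proof -
    have "2 * \<bar>a * b\<bar> \<le> a\<^sup>2 + b\<^sup>2"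
      using sum_squares_bound[of "\<bar>a\<bar>" "\<bar>b\<bar>"] by (simp add: abs_mult)
    then show ?thesis by simp
  qed
  then show "AE x in torus_cell. norm (f x * g x) \<le> norm ((f x)\<^sup>2 + (g x)\<^sup>2)"
    by simp
qed

lemma torus_square_integrable_add:
  assumes "torus_square_integrable f" "torus_square_integrable g"
  shows "torus_square_integrable (\<lambda>x. f x + g x)"
proof -
  have "integrable torus_cell (\<lambda>x. (f x)\<^sup>2 + (g x)\<^sup>2 + 2 * (f x * g x))"
    using assms torus_square_integrable_mult[OF assms] by (auto simp: torus_square_integrable_def)
  also have "(\<lambda>x. (f x)\<^sup>2 + (g x)\<^sup>2 + 2 * (f x * g x)) = (\<lambda>x. (f x + g x)\<^sup>2)"
    by (auto simp: power2_sum)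
  finally show ?thesis
    using assms by (auto simp: torus_square_integrable_def torus_periodic_def)
qed

lemma torus_square_integrable_scale:
  assumes "torus_square_integrable f"
  shows "torus_square_integrable (\<lambda>x. c * f x)"
  using assms by (auto simp: torus_square_integrable_def torus_periodic_def power_mult_distrib)

quotient_type (overloaded) 'n torus_L2 = "real^('n::finite) \<Rightarrow> real" / partial: torus_L2_rel
proof (rule part_equivpI)
  show "\<exists>f :: real^'n \<Rightarrow> real. torus_L2_rel f f"
    using torus_square_integrable_zero by (auto simp: torus_L2_rel_def)
  show "symp (torus_L2_rel :: (real^'n \<Rightarrow> real) \<Rightarrow> _)"
    by (auto simp: symp_def torus_L2_rel_def)
  show "transp (torus_L2_rel :: (real^'n \<Rightarrow> real) \<Rightarrow> _)"
    by (auto simp: transp_def torus_L2_rel_def)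
qed

instantiation torus_L2 :: (finite) ab_group_add
begin

lift_definition zero_torus_L2 :: "'a torus_L2" is "\<lambda>_. 0"
  by (simp add: torus_L2_rel_def torus_square_integrable_zero)

lift_definition plus_torus_L2 :: "'a torus_L2 \<Rightarrow> 'a torus_L2 \<Rightarrow> 'a torus_L2"
  is "\<lambda>f g x. f x + g x"
  by (auto simp: torus_L2_rel_def intro: torus_square_integrable_add)

lift_definition uminus_torus_L2 :: "'a torus_L2 \<Rightarrow> 'a torus_L2" is "\<lambda>f x. - f x"
  using torus_square_integrable_scale[of _ "-1"] by (auto simp: torus_L2_rel_def)

definition minus_torus_L2 :: "'a torus_L2 \<Rightarrow> 'a torus_L2 \<Rightarrow> 'a torus_L2" where
  "minus_torus_L2 f g = f + - g"

instance
proof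
  fix a b c :: "'a torus_L2"
  show "a + b + c = a + (b + c)"
    by transfer (auto simp: torus_L2_rel_def add.assoc intro: torus_square_integrable_add)
  show "a + b = b + a"
    by transfer (auto simp: torus_L2_rel_def add.commute intro: torus_square_integrable_add)
  show "0 + a = a"
    by transfer (auto simp: torus_L2_rel_def)
  show "- a + a = 0"
    by transfer (auto simp: torus_L2_rel_def torus_square_integrable_zero)
  show "a - b = a + - b"
    by (simp add: minus_torus_L2_def)
qed

end

instantiation torus_L2 :: (finite) real_vector
begin

lift_definition scaleR_torus_L2 :: "real \<Rightarrow> 'a torus_L2 \<Rightarrow> 'a torus_L2" is "\<lambda>c f x. c * f x"
  by (auto simp: torus_L2_rel_def intro: torus_square_integrable_scale)

instance
proof
  fix a b :: real and x y :: "'a torus_L2"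
  show "a *\<^sub>R (x + y) = a *\<^sub>R x + a *\<^sub>R y"
    by transfer (auto simp: torus_L2_rel_def distrib_left
        intro!: torus_square_integrable_add torus_square_integrable_scale)
  show "(a + b) *\<^sub>R x = a *\<^sub>R x + b *\<^sub>R x"
    by transfer (auto simp: torus_L2_rel_def distrib_right
        intro!: torus_square_integrable_add torus_square_integrable_scale)
  show "a *\<^sub>R b *\<^sub>R x = (a * b) *\<^sub>R x"
    by transfer (auto simp: torus_L2_rel_def mult.assoc
        intro!: torus_square_integrable_scale)
  show "1 *\<^sub>R x = x"
    by transfer (auto simp: torus_L2_rel_def)
qed

end

instantiation torus_L2 :: (finite) real_inner
begin

lift_definition inner_torus_L2 :: "'a torus_L2 \<Rightarrow> 'a torus_L2 \<Rightarrow> real"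
  is "\<lambda>f g. LINT x|torus_cell. f x * g x"
  by (rule integral_cong_AE)
    (auto simp: torus_L2_rel_def torus_square_integrable_def
      intro!: borel_measurable_times borel_measurable_torus_cell)

definition norm_torus_L2 :: "'a torus_L2 \<Rightarrow> real" where
  "norm_torus_L2 f = sqrt (f \<bullet> f)"

definition sgn_torus_L2 :: "'a torus_L2 \<Rightarrow> 'a torus_L2" where
  "sgn_torus_L2 f = inverse (norm f) *\<^sub>R f"

definition dist_torus_L2 :: "'a torus_L2 \<Rightarrow> 'a torus_L2 \<Rightarrow> real" where
  "dist_torus_L2 f g = norm (f - g)"

definition uniformity_torus_L2 :: "('a torus_L2 \<times> 'a torus_L2) filter" where
  "uniformity_torus_L2 = (INF e\<in>{0<..}. principal {(f, g). dist f g < e})"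

definition open_torus_L2 :: "'a torus_L2 set \<Rightarrow> bool" where
  "open_torus_L2 U \<longleftrightarrow> (\<forall>x\<in>U. \<forall>\<^sub>F (x', y) in uniformity. x' = x \<longrightarrow> y \<in> U)"

instance
proof
  fix x y z :: "'a torus_L2" and r :: real and U :: "'a torus_L2 set"
  show "dist x y = norm (x - y)" by (rule dist_torus_L2_def)
  show "sgn x = x /\<^sub>R norm x" by (rule sgn_torus_L2_def)
  show "(uniformity :: ('a torus_L2 \<times> 'a torus_L2) filter) =
      (INF e\<in>{0<..}. principal {(x, y). dist x y < e})"
    by (rule uniformity_torus_L2_def)
  show "open U = (\<forall>x\<in>U. \<forall>\<^sub>F (x', y) in uniformity. x' = x \<longrightarrow> y \<in> U)"
    by (rule open_torus_L2_def)
  show "norm x = sqrt (x \<bullet> x)" by (rule norm_torus_L2_def)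
  show "x \<bullet> y = y \<bullet> x"
    by transfer (simp add: mult.commute)
  show "(x + y) \<bullet> z = x \<bullet> z + y \<bullet> z"
    by transfer (simp add: torus_L2_rel_def distrib_right torus_square_integrable_mult)
  show "(r *\<^sub>R x) \<bullet> y = r * (x \<bullet> y)"
    by transfer (simp add: mult.assoc)
  show "0 \<le> x \<bullet> x"
    by transfer simp
  show "x \<bullet> x = 0 \<longleftrightarrow> x = 0"
  proof transfer
    fix f :: "real^'a \<Rightarrow> real"
    assume "torus_L2_rel f f"
    then have f: "torus_square_integrable f" by (simp add: torus_L2_rel_def)
    have "(LINT x|torus_cell. f x * f x) = 0 \<longleftrightarrow> (AE x in torus_cell. f x * f x = 0)"
      by (rule integral_nonneg_eq_0_iff_AE) (auto intro: torus_square_integrable_mult f)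
    then show "(LINT x|torus_cell. f x * f x) = 0 \<longleftrightarrow> torus_L2_rel f (\<lambda>_. 0)"
      by (simp add: torus_L2_rel_def f torus_square_integrable_zero)
  qed
qed

end


section \<open>The Gaussian measure\<close>

definition centered_gaussian :: "('a::real_inner) measure \<Rightarrow> bool" where
  "centered_gaussian \<mu> \<longleftrightarrow> prob_space \<mu> \<and> sets \<mu> = sets borel \<and>
     (\<forall>h. \<exists>\<sigma>\<ge>0. distr \<mu> borel (\<lambda>\<phi>. h \<bullet> \<phi>) =
        (if \<sigma> = 0 then return borel 0 else density lborel (normal_density 0 \<sigma>)))"

definition has_covariance_operator :: "('a::real_inner) measure \<Rightarrow> ('a \<Rightarrow> 'a) \<Rightarrow> bool" where
  "has_covariance_operator \<mu> C \<longleftrightarrow>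
     (\<forall>f h. integrable \<mu> (\<lambda>\<phi>. (f \<bullet> \<phi>) * (\<phi> \<bullet> h)) \<and>
            (LINT \<phi>|\<mu>. (f \<bullet> \<phi>) * (\<phi> \<bullet> h)) = f \<bullet> C h)"

lift_definition fourier_coeff :: "('n::finite) torus_L2 \<Rightarrow> int^'n \<Rightarrow> complex"
  is "\<lambda>f n. complex_of_real ((2 * pi) powr (- real CARD('n) / 2)) *
        (LINT x|torus_cell. complex_of_real (f x) * cis (- (\<Sum>i\<in>UNIV. of_int (n $ i) * x $ i)))"
proof -
  fix f g :: "real^'n \<Rightarrow> real"
  assume fg: "torus_L2_rel f g"
  have "(LINT x|torus_cell. complex_of_real (f x) * cis (- (\<Sum>i\<in>UNIV. of_int (n $ i) * x $ i))) =
        (LINT x|torus_cell. complex_of_real (g x) * cis (- (\<Sum>i\<in>UNIV. of_int (n $ i) * x $ i)))"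
    for n :: "int^'n"
  proof (rule integral_cong_AE)
    have e: "(\<lambda>x::real^'n. cis (- (\<Sum>i\<in>UNIV. of_int (n $ i) * x $ i))) \<in> borel_measurable borel"
      unfolding cis_conv_exp by (intro borel_measurable_continuous_onI continuous_intros)
    have "(\<lambda>x. complex_of_real (h x) * cis (- (\<Sum>i\<in>UNIV. of_int (n $ i) * x $ i)))
        \<in> borel_measurable torus_cell" if "h \<in> borel_measurable borel" for h :: "real^'n \<Rightarrow> real"
      using that e by (intro borel_measurable_torus_cell borel_measurable_times) simp_all
    then show "(\<lambda>x. complex_of_real (f x) * cis (- (\<Sum>i\<in>UNIV. of_int (n $ i) * x $ i)))
        \<in> borel_measurable torus_cell"
      and "(\<lambda>x. complex_of_real (g x) * cis (- (\<Sum>i\<in>UNIV. of_int (n $ i) * x $ i)))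
        \<in> borel_measurable torus_cell"
      using fg by (simp_all add: torus_L2_rel_def torus_square_integrable_def)
    have "AE x in torus_cell. f x = g x"
      using fg by (simp add: torus_L2_rel_def)
    then show "AE x in torus_cell.
        complex_of_real (f x) * cis (- (\<Sum>i\<in>UNIV. of_int (n $ i) * x $ i)) =
        complex_of_real (g x) * cis (- (\<Sum>i\<in>UNIV. of_int (n $ i) * x $ i))"
      by eventually_elim simp
  qed
  then show "(\<lambda>n. complex_of_real ((2 * pi) powr (- real CARD('n) / 2)) *
        (LINT x|torus_cell. complex_of_real (f x) * cis (- (\<Sum>i\<in>UNIV. of_int (n $ i) * x $ i)))) =
      (\<lambda>n. complex_of_real ((2 * pi) powr (- real CARD('n) / 2)) *
        (LINT x|torus_cell. complex_of_real (g x) * cis (- (\<Sum>i\<in>UNIV. of_int (n $ i) * x $ i))))"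
    by (intro ext arg_cong2[where f = "(*)"] refl)
qed

text \<open>The operator \<open>(1 - \<Delta>)\<^bsup>-\<alpha>\<^esup>\<close>, i.e. the Fourier multiplier with symbol
  \<open>(1 + |n|\<^sup>2)\<^bsup>-\<alpha>\<^esup>\<close>.\<close>

definition bessel_potential :: "real \<Rightarrow> ('n::finite) torus_L2 \<Rightarrow> 'n torus_L2" where
  "bessel_potential \<alpha> h = (THE g. \<forall>n. fourier_coeff g n =
     complex_of_real ((1 + (\<Sum>i\<in>UNIV. (of_int (n $ i))\<^sup>2)) powr (- \<alpha>)) * fourier_coeff h n)"


section \<open>The transport flow\<close>

text \<open>\<open>X t x\<close> is the solution at time \<open>t\<close> of \<open>\<partial>\<^sub>t X\<^sub>t(x) = u(t, X\<^sub>t(x))\<close>, \<open>X\<^sub>0(x) = x\<close>, lifted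
  from the torus to \<^typ>\<open>real^'n\<close>. As \<open>u\<close> is only integrable in time, the equation
  holds in the sense of Caratheodory, i.e. in integrated form.\<close>

definition is_flow_of ::
    "(real \<Rightarrow> real^'n \<Rightarrow> real^'n) \<Rightarrow> (real \<Rightarrow> real^'n \<Rightarrow> real^'n) \<Rightarrow> bool" where
  "is_flow_of u X \<longleftrightarrow>
     (\<forall>x. X 0 x = x \<and>
       (\<forall>a b. a \<le> b \<longrightarrow> (\<lambda>s. u s (X s x)) absolutely_integrable_on {a..b} \<and>
          X b x - X a x = integral {a..b} (\<lambda>s. u s (X s x))))"

text \<open>\<open>S(t) \<Omega> = \<Omega> \<circ> X\<^sub>t\<^sup>-\<^sup>1\<close>, computed with an arbitrary representative of \<open>\<Omega>\<close>. The class of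
  the result does not depend on it, because the flow of a divergence-free field preserves
  volume.\<close>

definition transport ::
    "(real \<Rightarrow> real^'n \<Rightarrow> real^'n) \<Rightarrow> real \<Rightarrow> ('n::finite) torus_L2 \<Rightarrow> 'n torus_L2" where
  "transport X t \<Omega> = abs_torus_L2 (rep_torus_L2 \<Omega> \<circ> inv (X t))"

definition transported_measure ::
    "(real \<Rightarrow> real^'n \<Rightarrow> real^'n) \<Rightarrow> ('n::finite) torus_L2 measure \<Rightarrow> real \<Rightarrow> 'n torus_L2 measure"
  where "transported_measure X \<mu> t = distr \<mu> borel (transport X t)"

definition quasi_invariant_under_transport ::
    "(real \<Rightarrow> real^'n \<Rightarrow> real^'n) \<Rightarrow> ('n::finite) torus_L2 measure \<Rightarrow> bool" where
  "quasi_invariant_under_transport X \<mu> \<longleftrightarrow>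
     (\<forall>t. absolutely_continuous \<mu> (transported_measure X \<mu> t) \<and>
          absolutely_continuous (transported_measure X \<mu> t) \<mu>)"

definition invariant_under_transport ::
    "(real \<Rightarrow> real^'n \<Rightarrow> real^'n) \<Rightarrow> ('n::finite) torus_L2 measure \<Rightarrow> bool" where
  "invariant_under_transport X \<mu> \<longleftrightarrow> (\<forall>t. transported_measure X \<mu> t = \<mu>)"

definition spatially_constant :: "(real \<Rightarrow> real^'n \<Rightarrow> real^'n) \<Rightarrow> bool" where
  "spatially_constant u \<longleftrightarrow>
     (\<exists>c :: real \<Rightarrow> real^'n. (\<forall>T. c absolutely_integrable_on {-T..T}) \<and>
        (AE t in lebesgue. \<forall>x. u t x = c t))"

end

theory Submission
  imports Defs
begin

text \<open>
  If \<open>u\<close> is spatially constant, then the flow consists of translations, which preserve the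
  covariance and hence the measure.

  Conversely, let \<open>S\<close> be the pullback by \<open>F = X\<^sub>t\<^sup>-\<^sup>1\<close>, an \<open>L\<^sup>2\<close>-isometry as \<open>u\<close> is divergence-free,
  and suppose that \<open>S\<^sub>*\<mu> \<lless> \<mu>\<close>. Averages of \<open>cos \<langle>f\<^sub>k, \<phi>\<rangle>\<close> along \<open>\<mu>\<close>-independent functionals \<open>f\<^sub>k\<close> show that,
  for every \<open>\<epsilon> > 0\<close> and apart from a finite-dimensional subspace, \<open>S\<close> increases the
  \<open>H\<^sup>\<alpha>\<close>-norm by at most a factor \<open>1 + \<epsilon>\<close>. Since \<open>S\<close> is an isometry of \<open>L\<^sup>2\<close> and \<open>\<alpha> > 1\<close>, Jensen's
  inequality for the distribution of \<open>S e\<^sub>n\<close> over the frequencies turns this into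
  \<open>\<parallel>S e\<^sub>n\<parallel>\<^sup>2 \<le> (1 + \<epsilon>) \<parallel>e\<^sub>n\<parallel>\<^sup>2\<close> in \<open>H\<^sup>1\<close> for all trigonometric
  basis functions \<open>e\<^sub>n\<close> of high frequency. Inserting \<open>n = k \<delta>\<^sub>i\<close> and letting \<open>k \<longlongrightarrow> \<infinity>\<close> bounds
  the mean of \<open>|\<nabla>F\<^sub>i|\<^sup>2\<close> over the torus by \<open>1\<close>. But \<open>F\<^sub>i - x\<^sub>i\<close> is periodic, so that mean is \<open>1\<close> plus
  the mean of \<open>|\<nabla>(F\<^sub>i - x\<^sub>i)|\<^sup>2\<close>. Hence \<open>F\<close> is a translation for every \<open>t\<close>, and
  \<open>u\<close> is spatially constant.
\<close>

section \<open>Periodicity and measure-preserving maps of the torus\<close>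

text \<open>Two obstacles shape the proof. First, \<open>u\<close> is merely integrable in time, so
  nothing can be differentiated in \<open>t\<close>, neither the flow nor its Jacobian. Time is
  measured instead by the integral of a spatial bound of first order on \<open>u\<close>. Estimates
  are stated for increments of this clock, and a quantity whose increments are quadratic in it is
  constant; this is how preservation of volume is obtained. Second, absolute continuity gives
  information of order \<alpha>, but compositions with \<open>F\<close> can be computed only to
  first order, where differences under translation determine the energy. Hence the descent to the
  exponent 1. The frequencies excluded by the finite-dimensional subspace carry at most a fixed
  amount of energy, which is negligible only relative to that of a high frequency. At high frequency
  the composition oscillates, and its energy reveals the gradient of \<open>F\<close> only through
  translations much shorter than the wavelength; so the translation step is chosen after the
  frequency. No derivative of \<open>F\<close> occurs anywhere: its gradient is represented by these
  mean square differences.\<close>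

definition lattice_vector :: "int^'n \<Rightarrow> real^'n" where
  "lattice_vector k = (\<chi> i. 2 * pi * of_int (k $ i))"

lemma torus_periodic_lattice:
  fixes f :: "real^'n \<Rightarrow> 'b"
  assumes "torus_periodic f"
  shows "f (x + lattice_vector k) = f x"
proof -
  have nat: "f (x + (2 * pi * real m) *\<^sub>R axis i 1) = f x" for x i m
  proof (induction m)
    case (Suc m)
    have "x + (2 * pi * real (Suc m)) *\<^sub>R axis i 1
        = (x + (2 * pi * real m) *\<^sub>R axis i 1) + (2 * pi) *\<^sub>R axis i (1::real)"
      by (simp add: algebra_simps flip: scaleR_add_left)
    then show ?case using assms Suc by (simp only: torus_periodic_def)
  qed simp
  have int: "f (x + (2 * pi * of_int m) *\<^sub>R axis i 1) = f x" for x i and m :: int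
  proof (cases "m \<ge> 0")
    case True then show ?thesis using nat[of x "nat m" i] by simp
  next
    case False
    then show ?thesis
      using nat[of "x + (2 * pi * of_int m) *\<^sub>R axis i 1" "nat (-m)" i] by simp
  qed
  have "f (x + (\<Sum>i\<in>A. (2 * pi * of_int (k $ i)) *\<^sub>R axis i 1)) = f x" if "finite A" for A
    using that
  proof (induction A)
    case (insert i A)
    then show ?case
      using int[of "x + (\<Sum>i\<in>A. (2 * pi * of_int (k $ i)) *\<^sub>R axis i 1)" "k $ i" i]
      by (simp add: add_ac)
  qed simp
  from this[of UNIV] have "f (x + (\<Sum>i\<in>UNIV. (2 * pi * of_int (k $ i)) *\<^sub>R axis i 1)) = f x"
    by simp
  moreover have "(\<Sum>i\<in>UNIV. (2 * pi * of_int (k $ i)) *\<^sub>R axis i (1::real)) = lattice_vector k"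
    by (simp add: lattice_vector_def vec_eq_iff axis_def if_distrib if_distribR cong: if_cong)
  ultimately show ?thesis by simp
qed

text \<open>The lattice translates of this cell partition the space, which fails for the closed cube
  of \<open>torus_cell\<close>; the two differ by a null set.\<close>

definition half_open_cell :: "(real^'n) set" where
  "half_open_cell = {x. \<forall>i. 0 \<le> x $ i \<and> x $ i < 2 * pi}"

lemma half_open_cell_borel [measurable]: "(half_open_cell :: (real^'n) set) \<in> sets borel"
proof -
  have "(half_open_cell :: (real^'n) set) = (\<Inter>i\<in>UNIV. {x. 0 \<le> x $ i} \<inter> {x. x $ i < 2 * pi})"
    by (auto simp: half_open_cell_def)
  also have "\<dots> \<in> sets borel"
    by (intro sets.finite_INT sets.Int borel_closed borel_open closed_Collect_le open_Collect_less
        continuous_intros) auto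
  finally show ?thesis .
qed

lemma AE_half_open_cell:
  "AE x in lborel. indicator (cbox 0 (\<chi> i. 2 * pi)) x = (indicator half_open_cell (x::real^'n) :: ennreal)"
proof -
  have "cbox (0::real^'n) (\<chi> i. 2 * pi) - box 0 (\<chi> i. 2 * pi) \<in> null_sets lborel"
    using negligible_frontier_interval[of "0::real^'n" "\<chi> i. 2 * pi"]
    by (auto simp: negligible_iff_null_sets null_sets_def)
  then have "AE x in lborel. x \<notin> cbox (0::real^'n) (\<chi> i. 2 * pi) - box 0 (\<chi> i. 2 * pi)"
    by (rule AE_not_in)
  then show ?thesis
    by eventually_elim
      (auto simp: indicator_def half_open_cell_def mem_box_cart less_eq_vec_def dest: order_less_imp_le)
qed

lemma nn_integral_torus_cell:
  fixes f :: "real^'n \<Rightarrow> ennreal"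
  assumes [measurable]: "f \<in> borel_measurable borel"
  shows "(\<integral>\<^sup>+x. f x \<partial>torus_cell) = (\<integral>\<^sup>+x. f x * indicator half_open_cell x \<partial>lborel)"
proof -
  have "(\<integral>\<^sup>+x. f x \<partial>torus_cell) = (\<integral>\<^sup>+x. f x * indicator (cbox 0 (\<chi> i. 2 * pi)) x \<partial>lborel)"
    unfolding torus_cell_def by (subst nn_integral_restrict_space) auto
  also have "\<dots> = (\<integral>\<^sup>+x. f x * indicator half_open_cell x \<partial>lborel)"
    by (rule nn_integral_cong_AE) (use AE_half_open_cell in \<open>eventually_elim, simp\<close>)
  finally show ?thesis .
qed

text \<open>Exactly one lattice translate of \<open>y\<close> lies in the cell. The count is written
  as an integral over a counting measure so that Fubini applies to it.\<close>

lemma nn_integral_cell_translates: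
  "(\<integral>\<^sup>+k. indicator half_open_cell (y + lattice_vector k) \<partial>count_space UNIV) = 1"
  for y :: "real^'n"
proof -
  define k0 :: "int^'n" where "k0 = (\<chi> i. - \<lfloor>y $ i / (2 * pi)\<rfloor>)"
  have "y + lattice_vector k \<in> half_open_cell \<longleftrightarrow> k = k0" for k
  proof -
    have "(0 \<le> y $ i + 2 * pi * of_int (k $ i) \<and> y $ i + 2 * pi * of_int (k $ i) < 2 * pi) \<longleftrightarrow>
        k $ i = - \<lfloor>y $ i / (2 * pi)\<rfloor>" for i
    proof -
      have "k $ i = - \<lfloor>y $ i / (2 * pi)\<rfloor> \<longleftrightarrow> \<lfloor>y $ i / (2 * pi)\<rfloor> = - (k $ i)" by auto
      also have "\<dots> \<longleftrightarrow> - of_int (k $ i) \<le> y $ i / (2 * pi) \<and> y $ i / (2 * pi) < - of_int (k $ i) + 1"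
        by (simp add: floor_eq_iff)
      also have "\<dots> \<longleftrightarrow> (0 \<le> y $ i + 2 * pi * of_int (k $ i) \<and>
          y $ i + 2 * pi * of_int (k $ i) < 2 * pi)"
        by (simp add: field_simps) (auto simp: algebra_simps)
      finally show ?thesis by simp
    qed
    then show ?thesis
      by (auto simp: half_open_cell_def lattice_vector_def k0_def vec_eq_iff)
  qed
  then have "(\<lambda>k. indicator half_open_cell (y + lattice_vector k) :: ennreal) = indicator {k0}"
    by (auto simp: indicator_def fun_eq_iff)
  then show ?thesis by (simp del: nn_integral_indicator_singleton)
qed

text \<open>Lifts to \<^typ>\<open>real^'n\<close> of volume-preserving maps of the torus that are homotopic to the
  identity.\<close>

definition torus_map :: "(real^'n \<Rightarrow> real^'n) \<Rightarrow> bool" where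
  "torus_map \<phi> \<longleftrightarrow> \<phi> \<in> borel_measurable borel \<and> distr lborel borel \<phi> = lborel \<and>
     torus_periodic (\<lambda>x. \<phi> x - x)"

lemma torus_map_borel: "torus_map \<phi> \<Longrightarrow> \<phi> \<in> borel_measurable borel"
  by (simp add: torus_map_def)

lemma torus_map_lattice: "torus_map \<phi> \<Longrightarrow> \<phi> (x + lattice_vector k) = \<phi> x + lattice_vector k"
  using torus_periodic_lattice[of "\<lambda>x. \<phi> x - x" x k]
  by (simp add: torus_map_def algebra_simps)

lemma torus_map_axis: "torus_map \<phi> \<Longrightarrow> \<phi> (x + (2 * pi) *\<^sub>R axis i 1) = \<phi> x + (2 * pi) *\<^sub>R axis i 1"
proof -
  assume "torus_map \<phi>"
  then have "\<phi> (x + (2 * pi) *\<^sub>R axis i 1) - (x + (2 * pi) *\<^sub>R axis i 1) = \<phi> x - x"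
    by (simp add: torus_map_def torus_periodic_def)
  then show ?thesis by (simp add: algebra_simps)
qed

lemma torus_periodic_comp: "torus_map \<phi> \<Longrightarrow> torus_periodic f \<Longrightarrow> torus_periodic (f \<circ> \<phi>)"
  by (simp add: torus_map_axis torus_periodic_def)

lemma torus_map_translation: "torus_map (\<lambda>x. x + a)"
proof -
  have "distr lborel borel (\<lambda>x. x + a) = lborel"
    using lborel_distr_plus[of a] by (simp add: add.commute[of a] fun_eq_iff cong: distr_cong)
  then show ?thesis by (simp add: torus_map_def torus_periodic_def)
qed

lemma count_space_lattice_sigma_finite: "sigma_finite_measure (count_space (UNIV :: (int^'n) set))"
  by (rule sigma_finite_measure_count_space)

text \<open>Unfolding: 1 is written as the number of translates of \<open>\<phi> x\<close> in the
  cell, a shift of \<open>x\<close> moves the translation from \<open>\<phi> x\<close> to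
  \<open>x\<close>, and the sum over the lattice then removes the cutoff in \<open>x\<close>. What
  is left is an integral over the whole space, where \<open>\<phi>\<close> preserves the
  measure.\<close>

lemma nn_integral_torus_map:
  fixes G :: "real^'n \<Rightarrow> ennreal"
  assumes \<phi>: "torus_map \<phi>" and G: "torus_periodic G" and [measurable]: "G \<in> borel_measurable borel"
  shows "(\<integral>\<^sup>+x. G (\<phi> x) \<partial>torus_cell) = (\<integral>\<^sup>+x. G x \<partial>torus_cell)"
proof -
  have [measurable]: "\<phi> \<in> borel_measurable borel" using \<phi> by (simp add: torus_map_def)
  let ?H = "half_open_cell :: (real^'n) set"
  interpret pair_sigma_finite "count_space (UNIV :: (int^'n) set)" "lborel :: (real^'n) measure"
    by (intro pair_sigma_finite.intro count_space_lattice_sigma_finite lborel.sigma_finite_measure_axioms)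
  have "(\<integral>\<^sup>+x. G (\<phi> x) \<partial>torus_cell) = (\<integral>\<^sup>+x. G (\<phi> x) * indicator ?H x *
      (\<integral>\<^sup>+k. indicator ?H (\<phi> x + lattice_vector k) \<partial>count_space UNIV) \<partial>lborel)"
    by (simp add: nn_integral_torus_cell nn_integral_cell_translates)
  also have "\<dots> = (\<integral>\<^sup>+x. (\<integral>\<^sup>+k. G (\<phi> x) * indicator ?H x *
      indicator ?H (\<phi> x + lattice_vector k) \<partial>count_space UNIV) \<partial>lborel)"
    by (simp add: nn_integral_cmult)
  also have "\<dots> = (\<integral>\<^sup>+k. (\<integral>\<^sup>+x. G (\<phi> x) * indicator ?H x *
      indicator ?H (\<phi> x + lattice_vector k) \<partial>lborel) \<partial>count_space UNIV)"
    by (rule Fubini')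
       (auto intro!: measurable_pair_measure_countable1 simp: split_beta')
  \<comment> \<open>Substitution of \<open>x + lattice_vector k\<close> in the right-hand side;
    \<open>\<phi>\<close> commutes with lattice translations and \<open>G\<close> ignores
    them.\<close>
  also have "\<dots> = (\<integral>\<^sup>+k. (\<integral>\<^sup>+x. indicator ?H (x + lattice_vector (-k)) *
      (G (\<phi> x) * indicator ?H (\<phi> x)) \<partial>lborel) \<partial>count_space UNIV)"
  proof (rule nn_integral_cong)
    fix k :: "int^'n"
    have m: "- lattice_vector k = lattice_vector (-k)" by (simp add: lattice_vector_def vec_eq_iff)
    have "(\<integral>\<^sup>+x. indicator ?H (x + lattice_vector (-k)) * (G (\<phi> x) * indicator ?H (\<phi> x)) \<partial>lborel)
      = (\<integral>\<^sup>+x. indicator ?H (x + lattice_vector (-k)) * (G (\<phi> x) * indicator ?H (\<phi> x))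
           \<partial>distr lborel borel ((+) (lattice_vector k)))"
      by (simp only: lborel_distr_plus)
    also have "\<dots> = (\<integral>\<^sup>+x. indicator ?H x *
       (G (\<phi> (x + lattice_vector k)) * indicator ?H (\<phi> (x + lattice_vector k))) \<partial>lborel)"
      by (subst nn_integral_distr) (auto simp: add.commute simp flip: m)
    also have "\<dots> = (\<integral>\<^sup>+x. G (\<phi> x) * indicator ?H x * indicator ?H (\<phi> x + lattice_vector k) \<partial>lborel)"
      by (simp only: torus_map_lattice[OF \<phi>] torus_periodic_lattice[OF G]) (simp only: ac_simps)
    finally show "(\<integral>\<^sup>+x. G (\<phi> x) * indicator ?H x * indicator ?H (\<phi> x + lattice_vector k) \<partial>lborel) =
      (\<integral>\<^sup>+x. indicator ?H (x + lattice_vector (-k)) * (G (\<phi> x) * indicator ?H (\<phi> x)) \<partial>lborel)" ..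
  qed
  also have "\<dots> = (\<integral>\<^sup>+x. (\<integral>\<^sup>+k. indicator ?H (x + lattice_vector (-k)) *
      (G (\<phi> x) * indicator ?H (\<phi> x)) \<partial>count_space UNIV) \<partial>lborel)"
    by (rule Fubini'[symmetric])
       (auto intro!: measurable_pair_measure_countable1 simp: split_beta')
  also have "\<dots> = (\<integral>\<^sup>+x. (\<integral>\<^sup>+k. indicator ?H (x + lattice_vector (-k)) \<partial>count_space UNIV) *
      (G (\<phi> x) * indicator ?H (\<phi> x)) \<partial>lborel)"
    by (simp add: nn_integral_multc)
  also have "\<dots> = (\<integral>\<^sup>+x. G (\<phi> x) * indicator ?H (\<phi> x) \<partial>lborel)"
  proof -
    have "(\<integral>\<^sup>+k. indicator ?H (x + lattice_vector (-k)) \<partial>count_space UNIV) = (1::ennreal)" for x :: "real^'n"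
    proof -
      have "(\<integral>\<^sup>+k. indicator ?H (x + lattice_vector (-k)) \<partial>count_space UNIV)
         = (\<integral>\<^sup>+k. indicator ?H (x + lattice_vector k) \<partial>count_space UNIV)"
        by (rule nn_integral_bij_count_space[where g = "\<lambda>k. - k"])
           (auto intro!: bij_betwI[where g = "\<lambda>k. - k"])
      then show ?thesis by (simp add: nn_integral_cell_translates)
    qed
    then show ?thesis by simp
  qed
  also have "\<dots> = (\<integral>\<^sup>+x. G x * indicator ?H x \<partial>distr lborel borel \<phi>)"
    by (subst nn_integral_distr) auto
  also have "\<dots> = (\<integral>\<^sup>+x. G x \<partial>torus_cell)"
    using \<phi> by (simp add: torus_map_def nn_integral_torus_cell)
  finally show ?thesis .
qed

lemma torus_map_integral:
  fixes G :: "real^'n \<Rightarrow> real"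
  assumes \<phi>: "torus_map \<phi>" and G: "torus_periodic G" and int: "integrable torus_cell G"
    and [measurable]: "G \<in> borel_measurable borel"
  shows "integrable torus_cell (\<lambda>x. G (\<phi> x))"
    and "(LINT x|torus_cell. G (\<phi> x)) = (LINT x|torus_cell. G x)"
proof -
  have [measurable]: "\<phi> \<in> borel_measurable borel" using \<phi> by (simp add: torus_map_def)
  have inv: "(\<integral>\<^sup>+x. ennreal (h (G (\<phi> x))) \<partial>torus_cell) = (\<integral>\<^sup>+x. ennreal (h (G x)) \<partial>torus_cell)"
    if [measurable]: "h \<in> borel_measurable borel" for h :: "real \<Rightarrow> real"
    using G by (intro nn_integral_torus_map[OF \<phi>, of "\<lambda>x. ennreal (h (G x))"])
      (simp_all add: torus_periodic_def)
  have m: "(\<lambda>x. G (\<phi> x)) \<in> borel_measurable torus_cell"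
    by (rule borel_measurable_torus_cell) simp
  have inv': "(\<integral>\<^sup>+x. ennreal (- G (\<phi> x)) \<partial>torus_cell) = (\<integral>\<^sup>+x. ennreal (- G x) \<partial>torus_cell)"
    using inv[of uminus] by simp
  have inv'': "(\<integral>\<^sup>+x. ennreal (G (\<phi> x)) \<partial>torus_cell) = (\<integral>\<^sup>+x. ennreal (G x) \<partial>torus_cell)"
    using inv[of "\<lambda>x. x"] by simp
  show i: "integrable torus_cell (\<lambda>x. G (\<phi> x))"
    using int m unfolding real_integrable_def by (simp add: inv' inv'')
  show "(LINT x|torus_cell. G (\<phi> x)) = (LINT x|torus_cell. G x)"
    using i int by (simp add: real_lebesgue_integral_def inv' inv'')
qed

text \<open>The set of disagreement is periodic, so \<open>nn_integral_torus_map\<close> applies to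
  its indicator. This makes composition well defined on classes.\<close>

lemma torus_map_AE_eq:
  fixes f g :: "real^'n \<Rightarrow> real"
  assumes \<phi>: "torus_map \<phi>" and f: "torus_periodic f" "f \<in> borel_measurable borel"
    and g: "torus_periodic g" "g \<in> borel_measurable borel"
    and eq: "AE x in torus_cell. f x = g x"
  shows "AE x in torus_cell. f (\<phi> x) = g (\<phi> x)"
proof -
  note [measurable] = f(2) g(2) torus_map_borel[OF \<phi>]
  define G :: "real^'n \<Rightarrow> ennreal" where "G x = (if f x = g x then 0 else 1)" for x
  have [measurable]: "G \<in> borel_measurable borel" unfolding G_def by measurable
  have "torus_periodic G" using f(1) g(1) by (simp add: torus_periodic_def G_def)
  then have "(\<integral>\<^sup>+x. G (\<phi> x) \<partial>torus_cell) = (\<integral>\<^sup>+x. G x \<partial>torus_cell)"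
    by (intro nn_integral_torus_map[OF \<phi>]) simp_all
  also have "\<dots> = 0"
    using eq by (subst nn_integral_0_iff_AE)
      (auto simp: G_def borel_measurable_torus_cell elim: eventually_mono)
  finally have "AE x in torus_cell. G (\<phi> x) = 0"
    by (subst (asm) nn_integral_0_iff_AE) (auto intro: borel_measurable_torus_cell)
  then show ?thesis by eventually_elim (simp add: G_def split: if_splits)
qed

lemma torus_square_integrable_comp:
  "torus_map \<phi> \<Longrightarrow> torus_square_integrable f \<Longrightarrow> torus_square_integrable (f \<circ> \<phi>)"
  using torus_map_integral(1)[of \<phi> "\<lambda>x. (f x)\<^sup>2"] torus_periodic_comp[of \<phi> f]
  by (auto simp: torus_square_integrable_def torus_periodic_def
      intro: measurable_comp torus_map_borel)

lemma torus_L2_rel_comp: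
  "torus_map \<phi> \<Longrightarrow> torus_L2_rel f g \<Longrightarrow> torus_L2_rel (f \<circ> \<phi>) (g \<circ> \<phi>)"
  using torus_map_AE_eq[of \<phi> f g]
  by (auto simp: torus_L2_rel_def torus_square_integrable_comp)
    (auto simp: torus_square_integrable_def)

section \<open>Composition operators on the Hilbert space of the torus\<close>

lemma torus_L2_rel_refl [simp]: "torus_L2_rel f f \<longleftrightarrow> torus_square_integrable f"
  by (simp add: torus_L2_rel_def)

lemma torus_square_integrable_rep: "torus_square_integrable (rep_torus_L2 \<Omega>)"
  using Quotient3_rep_reflp[OF Quotient3_torus_L2, of \<Omega>] by simp

lemma abs_rep_torus_L2 [simp]: "abs_torus_L2 (rep_torus_L2 \<Omega>) = \<Omega>"
  using Quotient3_torus_L2 by (rule Quotient3_abs_rep)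

lemma abs_torus_L2_eqI: "torus_L2_rel f g \<Longrightarrow> abs_torus_L2 f = abs_torus_L2 g"
  using Quotient3_torus_L2 by (rule Quotient3_rel_abs)

lemma abs_torus_L2_cases:
  obtains f where "torus_square_integrable f" "\<Omega> = abs_torus_L2 f"
  using torus_square_integrable_rep[of \<Omega>] abs_rep_torus_L2[of \<Omega>] by metis

lemma inner_abs_torus_L2:
  "torus_square_integrable f \<Longrightarrow> torus_square_integrable g \<Longrightarrow>
    abs_torus_L2 f \<bullet> abs_torus_L2 g = (LINT x|torus_cell. f x * g x)"
  by (rule inner_torus_L2.abs_eq) simp_all

lemma plus_abs_torus_L2:
  "torus_square_integrable f \<Longrightarrow> torus_square_integrable g \<Longrightarrow>
    abs_torus_L2 f + abs_torus_L2 g = abs_torus_L2 (\<lambda>x. f x + g x)"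
  by (rule plus_torus_L2.abs_eq) simp_all

lemma scaleR_abs_torus_L2:
  "torus_square_integrable f \<Longrightarrow> c *\<^sub>R abs_torus_L2 f = abs_torus_L2 (\<lambda>x. c * f x)"
  by (rule scaleR_torus_L2.abs_eq) simp_all

lemma torus_square_integrable_diff:
  "torus_square_integrable f \<Longrightarrow> torus_square_integrable g \<Longrightarrow>
    torus_square_integrable (\<lambda>x. f x - g x)"
  using torus_square_integrable_add[OF _ torus_square_integrable_scale[of g "-1"], of f] by simp

lemma minus_abs_torus_L2:
  assumes "torus_square_integrable f" "torus_square_integrable g"
  shows "abs_torus_L2 f - abs_torus_L2 g = abs_torus_L2 (\<lambda>x. f x - g x)"
  using plus_abs_torus_L2[OF assms(1) torus_square_integrable_scale[OF assms(2), of "-1"]]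
    scaleR_abs_torus_L2[OF assms(2), of "-1"]
  by (simp add: diff_conv_add_uminus del: add_uminus_conv_diff)

lemma norm_abs_torus_L2:
  "torus_square_integrable f \<Longrightarrow> (norm (abs_torus_L2 f))\<^sup>2 = (LINT x|torus_cell. (f x)\<^sup>2)"
  by (simp add: inner_abs_torus_L2 power2_norm_eq_inner) (simp add: power2_eq_square)

text \<open>\<open>transport\<close> for a general map in place of \<open>inv (X t)\<close>, so that
  translations are covered by the same facts.\<close>

definition pullback :: "(real^'n \<Rightarrow> real^'n) \<Rightarrow> ('n::finite) torus_L2 \<Rightarrow> 'n torus_L2" where
  "pullback \<phi> \<Omega> = abs_torus_L2 (rep_torus_L2 \<Omega> \<circ> \<phi>)"

lemma transport_eq_pullback: "transport X t = pullback (inv (X t))"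
  by (simp add: fun_eq_iff transport_def pullback_def)

lemma pullback_abs:
  assumes "torus_map \<phi>" "torus_square_integrable f"
  shows "pullback \<phi> (abs_torus_L2 f) = abs_torus_L2 (f \<circ> \<phi>)"
proof -
  have "torus_L2_rel (rep_torus_L2 (abs_torus_L2 f)) f"
    by (rule rep_abs_rsp_left[OF Quotient3_torus_L2]) (use assms in simp)
  then show ?thesis
    unfolding pullback_def by (intro abs_torus_L2_eqI torus_L2_rel_comp assms)
qed

context
  fixes \<phi> :: "real^'n \<Rightarrow> real^'n"
  assumes \<phi>: "torus_map \<phi>"
begin

lemma inner_pullback [simp]: "pullback \<phi> f \<bullet> pullback \<phi> g = f \<bullet> g"
proof -
  obtain f' g' where f': "torus_square_integrable f'" "f = abs_torus_L2 f'"
    and g': "torus_square_integrable g'" "g = abs_torus_L2 g'"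
    by (metis abs_torus_L2_cases)
  then show ?thesis
    using torus_map_integral(2)[OF \<phi>, of "\<lambda>x. f' x * g' x"] torus_square_integrable_mult[of f' g']
    by (auto simp: pullback_abs[OF \<phi>] inner_abs_torus_L2 torus_square_integrable_comp[OF \<phi>])
      (auto simp: torus_square_integrable_def torus_periodic_def)
qed

lemma pullback_add: "pullback \<phi> (f + g) = pullback \<phi> f + pullback \<phi> g"
proof -
  obtain f' g' where "torus_square_integrable f'" "f = abs_torus_L2 f'"
    and "torus_square_integrable g'" "g = abs_torus_L2 g'"
    by (metis abs_torus_L2_cases)
  then show ?thesis
    by (simp add: pullback_abs[OF \<phi>] plus_abs_torus_L2 torus_square_integrable_comp[OF \<phi>]
        torus_square_integrable_add comp_def torus_square_integrable_comp[OF \<phi>, unfolded comp_def])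
qed

lemma pullback_scaleR: "pullback \<phi> (c *\<^sub>R f) = c *\<^sub>R pullback \<phi> f"
proof -
  obtain f' where "torus_square_integrable f'" "f = abs_torus_L2 f'"
    by (metis abs_torus_L2_cases)
  then show ?thesis
    by (simp add: pullback_abs[OF \<phi>] scaleR_abs_torus_L2 torus_square_integrable_scale
        comp_def torus_square_integrable_comp[OF \<phi>, unfolded comp_def])
qed

lemma bounded_linear_pullback: "bounded_linear (pullback \<phi>)"
  by (rule bounded_linear_intro[where K = 1])
    (simp_all add: pullback_add pullback_scaleR norm_eq_sqrt_inner)

lemma pullback_borel [measurable]: "pullback \<phi> \<in> borel_measurable borel"
  by (intro borel_measurable_continuous_onI linear_continuous_on bounded_linear_pullback)

end

text \<open>\<open>pullback \<psi>\<close> undoes \<open>pullback \<phi>\<close> and preserves the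
  inner product; apply it to both arguments.\<close>

lemma inner_pullback_adjoint:
  assumes \<phi>: "torus_map \<phi>" and \<psi>: "torus_map \<psi>" and id: "\<And>x. \<phi> (\<psi> x) = x"
  shows "pullback \<phi> f \<bullet> g = f \<bullet> pullback \<psi> g"
proof -
  obtain f' where f': "torus_square_integrable f'" "f = abs_torus_L2 f'"
    by (metis abs_torus_L2_cases)
  have "pullback \<psi> (pullback \<phi> f) = f"
    using f' by (simp add: pullback_abs[OF \<phi>] pullback_abs[OF \<psi>] torus_square_integrable_comp[OF \<phi>]
        comp_def id torus_square_integrable_comp[OF \<phi>, unfolded comp_def])
  then show ?thesis using inner_pullback[OF \<psi>, of "pullback \<phi> f" g] by simp
qed

section \<open>The Hartley basis\<close>

definition phase :: "int^'n \<Rightarrow> real^'n \<Rightarrow> real" where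
  "phase n x = (\<Sum>i\<in>UNIV. of_int (n $ i) * x $ i)"

text \<open>The kernel of the Hartley transform. The Hilbert space is real, and the functions
  \<open>cas (phase n x)\<close> with \<open>n\<close> running through all of \<open>int^'n\<close>
  replace the complex exponentials, without choosing one frequency from each pair \<open>n\<close>,
  \<open>- n\<close> for cosines and the other for sines.\<close>

definition cas :: "real \<Rightarrow> real" where
  "cas \<theta> = cos \<theta> + sin \<theta>"

lemma phase_plus: "phase n (x + y) = phase n x + phase n y"
  by (simp add: phase_def distrib_left sum.distrib)

lemma phase_add_left: "phase (n + m) x = phase n x + phase m x"
  by (simp add: phase_def distrib_right sum.distrib)

lemma phase_diff_left: "phase (n - m) x = phase n x - phase m x"
  by (simp add: phase_def left_diff_distrib sum_subtractf)

lemma phase_minus_left: "phase (- n) x = - phase n x"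
  by (simp add: phase_def sum_negf)

lemma phase_scaleR: "phase n (c *\<^sub>R x) = c * phase n x"
  by (simp add: phase_def sum_distrib_left mult_ac)

lemma phase_axis: "phase n (axis i 1) = of_int (n $ i)"
  by (simp add: phase_def axis_def if_distrib cong: if_cong)

lemma phase_zero_left [simp]: "phase 0 x = 0"
  by (simp add: phase_def)

lemma continuous_on_phase [continuous_intros]: "continuous_on S (phase n)"
  unfolding phase_def by (intro continuous_intros)

lemma continuous_on_cas [continuous_intros]:
  fixes f :: "'a::t2_space \<Rightarrow> real"
  shows "continuous_on S f \<Longrightarrow> continuous_on S (\<lambda>x. cas (f x))"
  unfolding cas_def by (intro continuous_on_add continuous_on_cos continuous_on_sin)

lemma cas_add_period: "cas (\<theta> + 2 * pi * of_int k) = cas \<theta>"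
  using sin_int_2pin[of k] cos_int_2pin[of k] by (simp add: cas_def sin_add cos_add)

lemma abs_cas_le: "\<bar>cas \<theta>\<bar> \<le> 2"
  unfolding cas_def using abs_cos_le_one[of \<theta>] abs_sin_le_one[of \<theta>] by linarith

lemma cas_add: "cas (\<theta> + \<beta>) = cos \<beta> * cas \<theta> + sin \<beta> * cas (- \<theta>)"
  by (simp add: cas_def sin_add cos_add algebra_simps)

lemma cas_mult: "cas \<theta> * cas \<beta> = cos (\<theta> - \<beta>) + sin (\<theta> + \<beta>)"
  by (simp add: cas_def sin_add cos_diff algebra_simps)

lemma cos_eq_cas: "cos \<theta> = (cas \<theta> + cas (- \<theta>)) / 2"
  and sin_eq_cas: "sin \<theta> = (cas \<theta> - cas (- \<theta>)) / 2"
  by (simp_all add: cas_def)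

lemma torus_periodic_phase:
  assumes "\<And>\<theta> k. h (\<theta> + 2 * pi * of_int k) = h \<theta>"
  shows "torus_periodic (\<lambda>x. h (phase n x))"
  using assms by (simp add: torus_periodic_def phase_plus phase_scaleR phase_axis)

lemma emeasure_torus_cell:
  "emeasure torus_cell (space (torus_cell :: (real^'n) measure)) = ennreal ((2 * pi) ^ CARD('n))"
proof -
  have "emeasure torus_cell (space (torus_cell :: (real^'n) measure)) =
      emeasure lborel (cbox (0::real^'n) (\<chi> i. 2 * pi))"
    unfolding torus_cell_def by (subst emeasure_restrict_space) (auto simp: space_restrict_space)
  also have "\<dots> = ennreal (measure lborel (cbox (0::real^'n) (\<chi> i. 2 * pi)))"
    by (intro emeasure_eq_ennreal_measure) (use emeasure_lborel_cbox_finite[of "0::real^'n" "\<chi> i. 2 * pi"] in \<open>simp add: less_top\<close>)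
  also have "measure lborel (cbox (0::real^'n) (\<chi> i. 2 * pi)) = (2 * pi) ^ CARD('n)"
    by (subst content_cbox_cart) (auto simp: interval_eq_empty_cart not_less)
  finally show ?thesis .
qed

lemma finite_measure_torus_cell: "finite_measure (torus_cell :: (real^'n) measure)"
  by (rule finite_measureI) (simp add: emeasure_torus_cell)

lemma measure_torus_cell:
  "measure torus_cell (space (torus_cell :: (real^'n) measure)) = (2 * pi) ^ CARD('n)"
  by (simp add: measure_def emeasure_torus_cell)

lemma integrable_torus_cell_bounded:
  fixes f :: "real^'n \<Rightarrow> real"
  assumes "f \<in> borel_measurable borel" "\<And>x. \<bar>f x\<bar> \<le> B"
  shows "integrable torus_cell f"
proof -
  interpret finite_measure "torus_cell :: (real^'n) measure" by (rule finite_measure_torus_cell)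
  show ?thesis
    by (rule integrable_const_bound[of _ B]) (use assms in \<open>auto intro: borel_measurable_torus_cell\<close>)
qed

lemma torus_square_integrable_bounded:
  assumes "torus_periodic f" "f \<in> borel_measurable borel" "\<And>x. \<bar>f x\<bar> \<le> B"
  shows "torus_square_integrable f"
proof -
  have "\<bar>(f x)\<^sup>2\<bar> \<le> B\<^sup>2" for x
    using power_mono[OF assms(3), of x 2] by simp
  then show ?thesis using assms
    by (auto simp: torus_square_integrable_def intro!: integrable_torus_cell_bounded[of _ "B\<^sup>2"])
qed

text \<open>Translation by a vector \<open>a\<close> with \<open>phase n a = pi\<close> changes the
  sign of the integrand but not its integral.\<close>

lemma integral_phase:
  fixes n :: "int^'n" and h :: "real \<Rightarrow> real"
  assumes per: "\<And>\<theta> k. h (\<theta> + 2 * pi * of_int k) = h \<theta>"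
    and cont: "continuous_on UNIV h" and bd: "\<And>\<theta>. \<bar>h \<theta>\<bar> \<le> B"
    and odd: "\<And>\<theta>. h (\<theta> + pi) = - h \<theta>" and "n \<noteq> 0"
  shows "(LINT x|torus_cell. h (phase n x)) = 0"
proof -
  obtain i where i: "n $ i \<noteq> 0" using \<open>n \<noteq> 0\<close> by (auto simp: vec_eq_iff)
  define a :: "real^'n" where "a = (pi / of_int (n $ i)) *\<^sub>R axis i 1"
  have a: "phase n a = pi" using i by (simp add: a_def phase_scaleR phase_axis)
  have m: "(\<lambda>x. h (phase n x)) \<in> borel_measurable borel"
    by (intro borel_measurable_continuous_onI continuous_on_compose2[OF cont] continuous_intros) auto
  have "(LINT x|torus_cell. h (phase n (x + a))) = (LINT x|torus_cell. h (phase n x))"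
    using m bd by (intro torus_map_integral(2)[OF torus_map_translation] torus_periodic_phase per
        integrable_torus_cell_bounded)
  moreover have "h (phase n (x + a)) = - h (phase n x)" for x
    by (simp add: phase_plus a odd)
  ultimately show ?thesis by simp
qed

lemma integral_cos_phase:
  "(LINT x|torus_cell. cos (phase n x)) = (if n = 0 then (2 * pi) ^ CARD('n) else 0)"
  for n :: "int^'n"
proof (cases "n = 0")
  case True then show ?thesis by (simp add: measure_torus_cell)
next
  case False
  have "(LINT x|torus_cell. cos (phase n x)) = 0"
    using cos_int_2pin sin_int_2pin False
    by (intro integral_phase[of cos 1]) (auto simp: cos_add intro: continuous_intros)
  then show ?thesis using False by simp
qed

lemma integral_sin_phase: "(LINT x|torus_cell. sin (phase n x)) = 0"
proof (cases "n = 0")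
  case False
  then show ?thesis using cos_int_2pin sin_int_2pin
    by (intro integral_phase[of sin 1]) (auto simp: sin_add intro: continuous_intros)
qed simp

definition hartley_const :: "'n itself \<Rightarrow> real" where
  "hartley_const _ = (2 * pi) powr (- real CARD('n) / 2)"

lemma hartley_const_pos: "hartley_const TYPE('n) > 0"
  by (simp add: hartley_const_def)

lemma hartley_const_square: "(hartley_const TYPE('n))\<^sup>2 * (2 * pi) ^ CARD('n) = 1"
proof -
  have "(hartley_const TYPE('n))\<^sup>2 = (2 * pi) powr (- real CARD('n))"
    by (simp add: hartley_const_def power2_eq_square flip: powr_add)
  then show ?thesis
    by (simp add: powr_minus powr_realpow field_simps)
qed

definition hartley :: "int^('n::finite) \<Rightarrow> 'n torus_L2" where
  "hartley n = abs_torus_L2 (\<lambda>x. hartley_const TYPE('n) * cas (phase n x))"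

lemma torus_square_integrable_continuous_phase:
  assumes "\<And>\<theta> k. h (\<theta> + 2 * pi * of_int k) = h \<theta>" "continuous_on UNIV h" "\<And>\<theta>. \<bar>h \<theta>\<bar> \<le> B"
  shows "torus_square_integrable (\<lambda>x. h (phase n x))"
  by (intro torus_square_integrable_bounded[of _ B] torus_periodic_phase borel_measurable_continuous_onI
      continuous_on_compose2[OF assms(2)] continuous_intros) (use assms in auto)

lemma torus_square_integrable_cas: "torus_square_integrable (\<lambda>x. cas (phase n x))"
  by (rule torus_square_integrable_continuous_phase[of cas 2])
    (auto simp: cas_add_period abs_cas_le intro: continuous_intros)

lemma integrable_cos_phase: "integrable torus_cell (\<lambda>x. cos (phase n x))"
  by (intro integrable_torus_cell_bounded[of _ 1] borel_measurable_continuous_onI continuous_intros) auto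

lemma integrable_sin_phase: "integrable torus_cell (\<lambda>x. sin (phase n x))"
  by (intro integrable_torus_cell_bounded[of _ 1] borel_measurable_continuous_onI continuous_intros) auto

lemma inner_hartley: "hartley n \<bullet> hartley m = (if n = m then 1 else 0)"
  for n m :: "int^'n"
proof -
  let ?c = "hartley_const TYPE('n)"
  have "hartley n \<bullet> hartley m = (LINT x|torus_cell. ?c * cas (phase n x) * (?c * cas (phase m x)))"
    unfolding hartley_def by (intro inner_abs_torus_L2 torus_square_integrable_scale
        torus_square_integrable_cas)
  also have "\<dots> = (LINT x|torus_cell. ?c\<^sup>2 * (cas (phase n x) * cas (phase m x)))"
    by (simp add: power2_eq_square mult_ac)
  also have "\<dots> = (LINT x|torus_cell. ?c\<^sup>2 * (cos (phase (n - m) x) + sin (phase (n + m) x)))"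
    by (simp add: cas_mult phase_add_left phase_diff_left)
  also have "\<dots> = ?c\<^sup>2 * (if n - m = 0 then (2 * pi) ^ CARD('n) else 0)"
    by (simp add: integral_cos_phase integral_sin_phase integrable_cos_phase integrable_sin_phase)
  finally show ?thesis using hartley_const_square[where 'n = 'n] by simp
qed

text \<open>An inductive predicate instead of explicit finite sums: closure under products and
  membership in the span of the basis become rule inductions.\<close>

inductive trig_poly :: "(real^'n \<Rightarrow> real) \<Rightarrow> bool" where
  cas: "trig_poly (\<lambda>x. cas (phase n x))"
| scale: "trig_poly f \<Longrightarrow> trig_poly (\<lambda>x. c * f x)"
| add: "trig_poly f \<Longrightarrow> trig_poly g \<Longrightarrow> trig_poly (\<lambda>x. f x + g x)"

lemma trig_poly_cos: "trig_poly (\<lambda>x. cos (phase n x))"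
proof -
  have "trig_poly (\<lambda>x. 1/2 * (cas (phase n x) + cas (phase (-n) x)))" by (intro trig_poly.intros)
  then show ?thesis by (simp add: cos_eq_cas phase_minus_left)
qed

lemma trig_poly_sin: "trig_poly (\<lambda>x. sin (phase n x))"
proof -
  have "trig_poly (\<lambda>x. 1/2 * (cas (phase n x) + (-1) * cas (phase (-n) x)))" by (intro trig_poly.intros)
  then show ?thesis by (simp add: sin_eq_cas phase_minus_left)
qed

lemma trig_poly_const: "trig_poly (\<lambda>x. c)"
  using trig_poly.scale[OF trig_poly_cos[of 0], of c] by simp

lemma trig_poly_mult:
  assumes "trig_poly f" "trig_poly g" shows "trig_poly (\<lambda>x. f x * g x)"
  using assms(1)
proof induction
  case (cas n)
  show ?case using assms(2)
  proof induction
    case (cas m)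
    have "trig_poly (\<lambda>x. cos (phase (n - m) x) + sin (phase (n + m) x))"
      by (intro trig_poly.add trig_poly_cos trig_poly_sin)
    then show ?case by (simp add: cas_mult phase_add_left phase_diff_left)
  next
    case (scale f c)
    from trig_poly.scale[OF scale.IH, of c] show ?case by (simp add: mult_ac)
  next
    case (add f g)
    from trig_poly.add[OF add.IH] show ?case by (simp add: distrib_left)
  qed
next
  case (scale f c)
  from trig_poly.scale[OF scale.IH, of c] show ?case by (simp add: mult_ac)
next
  case (add f g)
  from trig_poly.add[OF add.IH] show ?case by (simp add: distrib_right)
qed

lemma trig_poly_sum: "finite A \<Longrightarrow> (\<And>a. a \<in> A \<Longrightarrow> trig_poly (f a)) \<Longrightarrow> trig_poly (\<lambda>x. \<Sum>a\<in>A. f a x)"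
  by (induction A rule: finite_induct) (auto intro: trig_poly.intros trig_poly_const)

lemma trig_poly_L2:
  "trig_poly f \<Longrightarrow> torus_square_integrable f \<and> abs_torus_L2 f \<in> span (range hartley)"
proof (induction rule: trig_poly.induct)
  case (cas n)
  have "abs_torus_L2 (\<lambda>x. cas (phase n x)) = (1 / hartley_const TYPE('a)) *\<^sub>R hartley n"
    using hartley_const_pos[where 'n = 'a] by (simp add: hartley_def scaleR_abs_torus_L2
        torus_square_integrable_scale torus_square_integrable_cas)
  then show ?case by (simp add: torus_square_integrable_cas span_scale span_base)
next
  case (scale f c)
  then show ?case
    using scaleR_abs_torus_L2[of f c] span_scale[of "abs_torus_L2 f" "range hartley" c]
    by (simp add: torus_square_integrable_scale)
next
  case (add f g)
  then show ?case
    using plus_abs_torus_L2[of f g] span_add[of "abs_torus_L2 f" "range hartley" "abs_torus_L2 g"]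
    by (simp add: torus_square_integrable_add)
qed

section \<open>Totality of the Hartley basis\<close>

lemma subspace_closure:
  fixes V :: "'a::real_normed_vector set"
  assumes "subspace V" shows "subspace (closure V)"
proof (rule subspaceI)
  show "0 \<in> closure V" using subspace_0[OF assms] closure_subset by blast
next
  fix x y assume "x \<in> closure V" "y \<in> closure V"
  then obtain f g where "\<And>n::nat. f n \<in> V" "f \<longlonglongrightarrow> x" "\<And>n::nat. g n \<in> V" "g \<longlonglongrightarrow> y"
    by (auto simp: closure_sequential)
  then show "x + y \<in> closure V" unfolding closure_sequential
    by (intro exI[of _ "\<lambda>n. f n + g n"]) (auto intro: tendsto_add simp: subspace_add assms)
next
  fix c x assume "x \<in> closure V"
  then obtain f where "\<And>n::nat. f n \<in> V" "f \<longlonglongrightarrow> x"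
    by (auto simp: closure_sequential)
  then show "c *\<^sub>R x \<in> closure V" unfolding closure_sequential
    by (intro exI[of _ "\<lambda>n. c *\<^sub>R f n"]) (auto intro!: tendsto_intros simp: subspace_scale assms)
qed

abbreviation hartley_space :: "('n::finite) torus_L2 set" where
  "hartley_space \<equiv> closure (span (range hartley))"

text \<open>Dominated convergence turns pointwise limits below a square integrable function into
  limits in the norm.\<close>

lemma hartley_space_limit:
  fixes f g :: "real^'n \<Rightarrow> real"
  assumes s: "\<And>k. torus_square_integrable (s k)" "\<And>k. abs_torus_L2 (s k) \<in> hartley_space"
    and f: "torus_square_integrable f" and g: "torus_square_integrable g"
    and lim: "\<And>x. (\<lambda>k. s k x) \<longlonglongrightarrow> f x"
    and bd: "\<And>k x. \<bar>s k x\<bar> \<le> \<bar>g x\<bar>"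
  shows "abs_torus_L2 f \<in> hartley_space"
proof -
  have m: "h \<in> borel_measurable torus_cell" if "torus_square_integrable h" for h :: "real^'n \<Rightarrow> real"
    using that by (auto simp: torus_square_integrable_def intro: borel_measurable_torus_cell)
  have fg: "\<bar>f x\<bar> \<le> \<bar>g x\<bar>" for x
    by (rule LIMSEQ_le_const2[OF tendsto_rabs[OF lim]]) (use bd in auto)
  have "(\<lambda>k. LINT x|torus_cell. (s k x - f x)\<^sup>2) \<longlonglongrightarrow> (LINT x|(torus_cell :: (real^'n) measure). (0::real))"
  proof (rule integral_dominated_convergence[where w = "\<lambda>x. 4 * (g x)\<^sup>2"])
    show "integrable torus_cell (\<lambda>x. 4 * (g x)\<^sup>2)"
      using g by (simp add: torus_square_integrable_def)
    show "(\<lambda>x. (s k x - f x)\<^sup>2) \<in> borel_measurable torus_cell" for k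
      using m[OF s(1)] m[OF f] by simp
    show "AE x in torus_cell. (\<lambda>k. (s k x - f x)\<^sup>2) \<longlonglongrightarrow> 0"
    proof (rule AE_I2)
      fix x
      have "(\<lambda>k. (s k x - f x)\<^sup>2) \<longlonglongrightarrow> (f x - f x)\<^sup>2" by (intro tendsto_intros lim)
      then show "(\<lambda>k. (s k x - f x)\<^sup>2) \<longlonglongrightarrow> 0" by simp
    qed
    show "AE x in torus_cell. norm ((s k x - f x)\<^sup>2) \<le> 4 * (g x)\<^sup>2" for k
    proof (rule AE_I2)
      fix x
      have "\<bar>s k x - f x\<bar> \<le> 2 * \<bar>g x\<bar>" using bd[of k x] fg[of x] by linarith
      from power_mono[OF this, of 2] show "norm ((s k x - f x)\<^sup>2) \<le> 4 * (g x)\<^sup>2"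
        by (simp add: power_mult_distrib)
    qed
  qed simp
  then have "(\<lambda>k. (norm (abs_torus_L2 (s k) - abs_torus_L2 f))\<^sup>2) \<longlonglongrightarrow> 0"
    by (simp add: minus_abs_torus_L2 s f norm_abs_torus_L2 torus_square_integrable_diff)
  from tendsto_real_sqrt[OF this] have "(\<lambda>k. abs_torus_L2 (s k)) \<longlonglongrightarrow> abs_torus_L2 f"
    by (simp add: tendsto_norm_zero_iff LIM_zero_iff)
  then show ?thesis
    by (rule closed_sequentially[rotated 2]) (use s in auto)
qed

text \<open>The torus as a product of unit circles. Polynomials on \<open>complex^'n\<close>
  restrict to trigonometric polynomials, and any function of \<open>torus_embed x\<close> is
  periodic in \<open>x\<close>, so that approximation can take place on an ordinary Euclidean
  space.\<close>

definition torus_embed :: "real^'n \<Rightarrow> complex^'n" where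
  "torus_embed x = (\<chi> i. cis (x $ i))"

lemma continuous_on_torus_embed: "continuous_on S torus_embed"
  unfolding torus_embed_def cis_conv_exp by (intro continuous_intros)

lemma torus_embed_borel [measurable]: "torus_embed \<in> borel_measurable borel"
  by (intro borel_measurable_continuous_onI continuous_on_torus_embed)

lemma torus_periodic_embed: "torus_periodic (\<lambda>x. g (torus_embed x))"
  unfolding torus_periodic_def
proof (intro allI arg_cong[where f = g])
  fix x i
  have "cis (x $ j + 2 * pi * (if j = i then 1 else 0)) = cis (x $ j)" for j
    by (simp add: cis_mult[symmetric])
  then show "torus_embed (x + (2 * pi) *\<^sub>R axis i 1) = torus_embed x"
    by (simp add: torus_embed_def vec_eq_iff axis_def)
qed

lemma trig_poly_embed:
  fixes p :: "complex^'n \<Rightarrow> real"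
  shows "real_polynomial_function p \<Longrightarrow> trig_poly (\<lambda>x. p (torus_embed x))"
proof (induction rule: real_polynomial_function.induct)
  case (linear f)
  interpret bounded_linear f by fact
  have ph: "phase (axis i 1) x = x $ i" for i :: 'n and x
    by (simp add: phase_def axis_def if_distrib if_distribR cong: if_cong)
  have "f (torus_embed x) = (\<Sum>i\<in>UNIV. f (axis i 1) * cos (phase (axis i 1) x) +
      f (axis i \<i>) * sin (phase (axis i 1) x))" for x
  proof -
    have "torus_embed x = (\<Sum>i\<in>UNIV. cos (x $ i) *\<^sub>R axis i 1 + sin (x $ i) *\<^sub>R axis i \<i>)"
      by (simp add: torus_embed_def vec_eq_iff axis_def if_distrib if_distribR complex_eq_iff
          sum.distrib cong: if_cong)
    then show ?thesis by (simp add: sum add scaleR ph mult.commute)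
  qed
  then show ?case
    by (auto intro!: trig_poly_sum trig_poly.add trig_poly.scale trig_poly_cos trig_poly_sin)
next
  case (const c)
  show ?case by (rule trig_poly_const)
qed (auto intro: trig_poly.add trig_poly_mult)

lemma norm_abs_torus_L2_le:
  fixes f :: "real^'n \<Rightarrow> real"
  assumes f: "torus_square_integrable f" and le: "\<And>x. \<bar>f x\<bar> \<le> e" "e \<ge> 0"
  shows "norm (abs_torus_L2 f) \<le> e * sqrt ((2 * pi) ^ CARD('n))"
proof -
  interpret finite_measure "torus_cell :: (real^'n) measure" by (rule finite_measure_torus_cell)
  have "(norm (abs_torus_L2 f))\<^sup>2 \<le> (LINT x|(torus_cell :: (real^'n) measure). (e\<^sup>2 :: real))"
    unfolding norm_abs_torus_L2[OF f]
    by (intro integral_mono) (use f le power_mono[OF le(1), of _ 2] in \<open>auto simp: torus_square_integrable_def\<close>)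
  also have "\<dots> = e\<^sup>2 * (2 * pi) ^ CARD('n)"
    by (simp add: measure_torus_cell del: power_mult_distrib)
  finally have "sqrt ((norm (abs_torus_L2 f))\<^sup>2) \<le> sqrt (e\<^sup>2 * (2 * pi) ^ CARD('n))"
    by (rule real_sqrt_le_mono)
  then show ?thesis using le by (simp add: real_sqrt_mult del: power_mult_distrib)
qed

text \<open>Stone-Weierstrass on a ball containing the image of the torus; uniform approximation
  implies approximation in the mean because the volume is finite.\<close>

lemma hartley_space_continuous:
  fixes g :: "complex^'n \<Rightarrow> real"
  assumes g: "continuous_on UNIV g" and bd: "\<And>z. \<bar>g z\<bar> \<le> B"
  shows "abs_torus_L2 (\<lambda>x. g (torus_embed x)) \<in> hartley_space"
  unfolding closure_approachable
proof safe
  fix e :: real assume "e > 0"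
  \<comment> \<open>The norm of the constant function 1, which converts uniform into mean square
    errors; the tolerance \<open>e / (2 * r)\<close> thus gives \<open>e / 2\<close>.\<close>
  define r where "r = sqrt ((2 * pi) ^ CARD('n))"
  have r: "r > 0" unfolding r_def by (intro real_sqrt_gt_zero zero_less_power) simp
  define S :: "(complex^'n) set" where "S = cball 0 (real CARD('n))"
  have S: "torus_embed x \<in> S" for x :: "real^'n"
  proof -
    have "norm (torus_embed x) \<le> (\<Sum>i\<in>UNIV. norm (torus_embed x $ i))" 
      unfolding norm_vec_def by (rule L2_set_le_sum) simp
    then show ?thesis by (simp add: S_def torus_embed_def)
  qed
  obtain p where p: "real_polynomial_function p" "\<And>z. z \<in> S \<Longrightarrow> \<bar>g z - p z\<bar> < e / (2 * r)"
    using Stone_Weierstrass_real_polynomial_function[of S g "e / (2 * r)"] \<open>e > 0\<close> r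
      continuous_on_subset[OF g subset_UNIV] by (auto simp: S_def)
  have t: "torus_square_integrable (\<lambda>x. p (torus_embed x))"
    "abs_torus_L2 (\<lambda>x. p (torus_embed x)) \<in> span (range hartley)"
    using trig_poly_L2[OF trig_poly_embed[OF p(1)]] by auto
  have s: "torus_square_integrable (\<lambda>x. g (torus_embed x))"
    by (rule torus_square_integrable_bounded[of _ B])
      (use bd in \<open>auto intro!: torus_periodic_embed borel_measurable_continuous_onI
        continuous_on_compose2[OF g] continuous_on_torus_embed\<close>)
  have "norm (abs_torus_L2 (\<lambda>x. p (torus_embed x)) - abs_torus_L2 (\<lambda>x. g (torus_embed x))) \<le> e / (2 * r) * r"
    unfolding minus_abs_torus_L2[OF t(1) s] r_def
    by (rule norm_abs_torus_L2_le[OF torus_square_integrable_diff[OF t(1) s]])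
       (use p(2)[OF S] \<open>e > 0\<close> r in \<open>auto simp: abs_minus_commute r_def intro: less_imp_le\<close>)
  also have "\<dots> < e" using r \<open>e > 0\<close> by simp
  finally show "\<exists>y\<in>span (range hartley). dist y (abs_torus_L2 (\<lambda>x. g (torus_embed x))) < e"
    using t(2) by (auto simp: dist_norm)
qed

lemma torus_square_integrable_embed_indicator:
  "A \<in> sets borel \<Longrightarrow> torus_square_integrable (\<lambda>x. indicator A (torus_embed x))"
  by (rule torus_square_integrable_bounded[of _ 1]) (auto intro: torus_periodic_embed split: split_indicator)

text \<open>Dynkin's theorem with the open sets as generator. Closedness of
  \<open>hartley_space\<close> gives the disjoint countable unions, via their finite partial
  unions.\<close>

lemma hartley_space_indicator:
  fixes A :: "(complex^'n) set"
  assumes "A \<in> sets borel"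
  shows "abs_torus_L2 (\<lambda>x. indicator A (torus_embed x)) \<in> hartley_space"
proof -
  have V: "subspace (hartley_space :: 'n torus_L2 set)" by (intro subspace_closure subspace_span)
  note sqi = torus_square_integrable_embed_indicator
  have one: "abs_torus_L2 (\<lambda>x. indicator UNIV (torus_embed x :: complex^'n)) \<in> hartley_space"
    using hartley_space_continuous[of "\<lambda>_. 1" 1] by simp
  have "A \<in> sigma_sets UNIV {S. open S}" using assms by (simp add: borel_def)
  moreover have "Int_stable {S :: (complex^'n) set. open S}" by (auto simp: Int_stable_def)
  ultimately have "Int_stable {S :: (complex^'n) set. open S}" "{S :: (complex^'n) set. open S} \<subseteq> Pow UNIV"
    "A \<in> sigma_sets UNIV {S. open S}" by auto
  then show ?thesis
  proof (induction rule: sigma_sets_induct_disjoint)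
    case (basic A)
    then have "open A" by simp
    show ?case
    \<comment> \<open>For \<open>A = UNIV\<close> the distance to the empty complement has the
      default value 0, and the approximations \<open>g k\<close> would vanish.\<close>
    proof (cases "A = UNIV")
      case True then show ?thesis using one by simp
    next
      case False
      define g where "g k z = min 1 (real k * infdist z (- A))" for k :: nat and z
      have gc: "continuous_on UNIV (g k)" for k unfolding g_def by (intro continuous_intros)
      have g01: "0 \<le> g k z" "g k z \<le> 1" for k z by (auto simp: g_def infdist_nonneg)
      have gb: "g k \<in> borel_measurable borel" for k by (intro borel_measurable_continuous_onI gc)
      show ?thesis
      proof (rule hartley_space_limit[where s = "\<lambda>k x. g k (torus_embed x)" and g = "\<lambda>_. 1"])
        show "torus_square_integrable (\<lambda>x. g k (torus_embed x))" for k
          by (rule torus_square_integrable_bounded[of _ 1])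
            (use g01 gb in \<open>auto intro: torus_periodic_embed\<close>)
        show "abs_torus_L2 (\<lambda>x. g k (torus_embed x)) \<in> hartley_space" for k
          by (rule hartley_space_continuous[OF gc, of _ 1]) (use g01 in auto)
        show "torus_square_integrable (\<lambda>x. indicat_real A (torus_embed x))"
          using basic by (intro sqi) auto
        show "torus_square_integrable (\<lambda>_. 1)" using sqi[of UNIV] by simp
        show "\<bar>g k (torus_embed x)\<bar> \<le> \<bar>1\<bar>" for k x using g01 by auto
        show "(\<lambda>k. g k (torus_embed x)) \<longlonglongrightarrow> indicat_real A (torus_embed x)" for x :: "real^'n"
        proof (cases "torus_embed x \<in> A")
          case True
          define d where "d = infdist (torus_embed x) (- A)"
          have "d > 0" unfolding d_def
            by (rule infdist_pos_not_in_closed) (use \<open>open A\<close> False True in auto)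
          then obtain k0 :: nat where "1 / d < k0" using reals_Archimedean2 by blast
          then have "1 \<le> real k0 * d" using \<open>d > 0\<close> by (simp add: field_simps)
          then have "1 \<le> real k * d" if "k \<ge> k0" for k
            using that \<open>d > 0\<close> mult_right_mono[of "real k0" "real k" d] by linarith
          then have "\<forall>\<^sub>F k in sequentially. g k (torus_embed x) = 1"
            unfolding eventually_sequentially g_def d_def[symmetric] by (intro exI[of _ k0]) auto
          then show ?thesis using True by (simp add: tendsto_eventually)
        next
          case False then show ?thesis by (simp add: g_def)
        qed
      qed
    qed
  next
    case empty
    show ?case using subspace_0[OF V] sqi[of UNIV] zero_torus_L2_def by (simp add: zero_torus_L2_def)
  next
    case (compl A)
    then have b: "A \<in> sets borel" by (simp add: borel_def)
    have bU: "(UNIV :: (complex^'n) set) \<in> sets borel" by simp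
    have "abs_torus_L2 (\<lambda>x. indicator UNIV (torus_embed x)) - abs_torus_L2 (\<lambda>x. indicator A (torus_embed x))
        \<in> hartley_space"
      by (intro subspace_diff[OF V] one compl)
    also have "abs_torus_L2 (\<lambda>x. indicator UNIV (torus_embed x)) - abs_torus_L2 (\<lambda>x. indicator A (torus_embed x))
       = abs_torus_L2 (\<lambda>x. indicator (UNIV - A) (torus_embed x))"
      unfolding minus_abs_torus_L2[OF sqi[OF bU] sqi[OF b]]
      by (auto intro!: arg_cong[where f = abs_torus_L2] simp: indicator_def fun_eq_iff)
    finally show ?case .
  next
    case (union A)
    then have b: "A i \<in> sets borel" for i by (auto simp: borel_def)
    define B where "B k = (\<Union>i<k. A i)" for k
    have Bb: "B k \<in> sets borel" for k unfolding B_def using b by auto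
    have B: "abs_torus_L2 (\<lambda>x. indicator (B k) (torus_embed x)) \<in> hartley_space" for k
    proof (induction k)
      case 0
      show ?case using subspace_0[OF V] by (simp add: zero_torus_L2_def B_def)
    next
      case (Suc k)
      have "A i \<inter> A k = {}" if "i < k" for i
        using disjoint_family_onD[OF union(1), of i k] that by simp
      then have "B k \<inter> A k = {}" unfolding B_def by blast
      then have "abs_torus_L2 (\<lambda>x. indicator (B (Suc k)) (torus_embed x)) =
        abs_torus_L2 (\<lambda>x. indicator (B k) (torus_embed x)) + abs_torus_L2 (\<lambda>x. indicator (A k) (torus_embed x))"
        unfolding plus_abs_torus_L2[OF sqi[OF Bb] sqi[OF b]]
        by (intro arg_cong[where f = abs_torus_L2] ext)
          (auto simp: B_def lessThan_Suc disjoint_iff split: split_indicator)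
      then show ?case using subspace_add[OF V Suc union(3)[of k]] by simp
    qed
    show ?case
    proof (rule hartley_space_limit[where s = "\<lambda>k x. indicator (B k) (torus_embed x)" and g = "\<lambda>_. 1"])
      show "torus_square_integrable (\<lambda>_. 1)" using sqi[of UNIV] by simp
      show "torus_square_integrable (\<lambda>x. indicat_real (\<Union> (range A)) (torus_embed x))"
        using b by (intro sqi) auto
      show "(\<lambda>k. indicat_real (B k) (torus_embed x)) \<longlonglongrightarrow> indicat_real (\<Union> (range A)) (torus_embed x)" for x :: "real^'n"
        unfolding B_def by (rule LIMSEQ_indicator_UN)
    qed (auto intro!: sqi Bb B)
  qed
qed

lemma Arg2pi_borel [measurable]: "Arg2pi \<in> borel_measurable borel"
  by (rule borel_measurableI_le) (simp add: closed_Arg2pi2pi_le)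

lemma Arg2pi_cis: "0 \<le> \<theta> \<Longrightarrow> \<theta> < 2 * pi \<Longrightarrow> Arg2pi (cis \<theta>) = \<theta>"
  by (rule Arg2pi_unique[of 1]) (simp_all add: cis_conv_exp)

lemma AE_torus_cell_half_open: "AE x in torus_cell. x \<in> half_open_cell"
  using AE_half_open_cell unfolding torus_cell_def
  by (subst AE_restrict_space_iff) (auto elim!: eventually_mono split: split_indicator_asm)

lemma hartley_space_simple:
  fixes A :: "real \<Rightarrow> (complex^'n) set"
  assumes "finite Y" "\<And>y. y \<in> Y \<Longrightarrow> A y \<in> sets borel"
  shows "torus_square_integrable (\<lambda>x. \<Sum>y\<in>Y. y * indicator (A y) (torus_embed x)) \<and>
    abs_torus_L2 (\<lambda>x. \<Sum>y\<in>Y. y * indicator (A y) (torus_embed x)) \<in> hartley_space"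
  using assms
proof (induction Y rule: finite_induct)
  case empty
  have "(0 :: 'n torus_L2) \<in> hartley_space" by (intro subspace_0 subspace_closure subspace_span)
  then show ?case by (simp add: torus_square_integrable_zero zero_torus_L2_def)
next
  case (insert y Y)
  have V: "subspace (hartley_space :: 'n torus_L2 set)" by (intro subspace_closure subspace_span)
  have b: "torus_square_integrable (\<lambda>x. indicator (A y) (torus_embed x))"
    by (intro torus_square_integrable_embed_indicator insert) auto
  let ?g = "\<lambda>x. \<Sum>y\<in>Y. y * indicator (A y) (torus_embed x)"
  have IH: "torus_square_integrable ?g" "abs_torus_L2 ?g \<in> hartley_space"
    using insert by blast+
  have "y *\<^sub>R abs_torus_L2 (\<lambda>x. indicator (A y) (torus_embed x)) + abs_torus_L2 ?g \<in> hartley_space"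
    by (intro subspace_add[OF V] subspace_scale[OF V] hartley_space_indicator IH)
       (use insert in auto)
  then show ?case using torus_square_integrable_add[OF torus_square_integrable_scale[OF b] IH(1)]
    by (simp only: sum.insert[OF insert.hyps] scaleR_abs_torus_L2[OF b]
        plus_abs_torus_L2[OF torus_square_integrable_scale[OF b] IH(1)] simp_thms)
qed

text \<open>On the half-open cell, \<open>Arg2pi\<close> recovers the coordinates from
  \<open>torus_embed x\<close>. Hence every class has a representative that is a Borel function of
  \<open>torus_embed x\<close>, and simple functions reduce it to
  \<open>hartley_space_indicator\<close>.\<close>

lemma hartley_space_eq_UNIV: "(hartley_space :: ('n::finite) torus_L2 set) = UNIV"
proof (rule UNIV_eq_I[symmetric])
  fix \<Omega> :: "'n torus_L2"
  obtain f where f: "torus_square_integrable f" "\<Omega> = abs_torus_L2 f" by (rule abs_torus_L2_cases)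
  define g :: "complex^'n \<Rightarrow> real" where "g z = f (\<chi> i. Arg2pi (z $ i))" for z
  have fb: "f \<in> borel_measurable borel" using f by (simp add: torus_square_integrable_def)
  have "(\<lambda>z::complex^'n. (\<chi> i. Arg2pi (z $ i))) \<in> borel_measurable borel"
  proof (subst borel_measurable_euclidean_space, rule ballI)
    fix b :: "real^'n" assume "b \<in> Basis"
    then obtain i where b: "b = axis i 1" unfolding Basis_vec_def by auto
    have "(\<lambda>z::complex^'n. z $ i) \<in> borel_measurable borel"
      by (intro borel_measurable_continuous_onI continuous_intros)
    from measurable_compose[OF this Arg2pi_borel]
    show "(\<lambda>z::complex^'n. (\<chi> i. Arg2pi (z $ i)) \<bullet> b) \<in> borel_measurable borel"
      unfolding b by (simp add: inner_axis)
  qed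
  then have gb [measurable]: "g \<in> borel_measurable borel"
    unfolding g_def by (rule measurable_compose) (rule fb)
  have ae: "AE x in torus_cell. f x = g (torus_embed x)"
    using AE_torus_cell_half_open
    by eventually_elim (simp add: g_def torus_embed_def half_open_cell_def Arg2pi_cis)
  have gsq: "torus_square_integrable (\<lambda>x. g (torus_embed x))"
  proof -
    have "integrable torus_cell (\<lambda>x. (g (torus_embed x))\<^sup>2) \<longleftrightarrow> integrable torus_cell (\<lambda>x. (f x)\<^sup>2)"
      by (rule integrable_cong_AE)
         (use ae fb in \<open>auto intro!: borel_measurable_torus_cell elim!: eventually_mono\<close>)
    then show ?thesis using f
      by (auto simp: torus_square_integrable_def torus_periodic_embed intro: measurable_compose[OF torus_embed_borel gb])
  qed
  obtain F where F': "(\<forall>i. simple_function borel (F i)) \<and> (\<forall>z\<in>space borel. (\<lambda>i. F i z) \<longlonglongrightarrow> g z) \<and>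
      (\<forall>i. \<forall>z\<in>space borel. dist (F i z) 0 \<le> 2 * dist (g z) 0)"
    using borel_measurable_implies_sequence_metric[OF gb, of 0] by blast
  have F: "simple_function borel (F i)" "(\<lambda>i. F i z) \<longlonglongrightarrow> g z"
      "dist (F i z) 0 \<le> 2 * dist (g z) 0" for i z
    using F' by simp_all
  have F_eq: "F k z = (\<Sum>y\<in>range (F k). y * indicator (F k -` {y}) z)" for k z
    using simple_function_indicator_representation_banach[OF F(1), of z k, unfolded space_borel, OF UNIV_I]
    by (simp only: Int_UNIV_right real_scaleR_def mult.commute)
  have "finite (range (F k))" for k using simple_functionD(1)[OF F(1)[of k]] by simp
  moreover have "F k -` {y} \<in> sets borel" for k y
    using simple_functionD(2)[OF F(1)[of k], of "{y}"] by simp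
  ultimately have S: "torus_square_integrable (\<lambda>x. F k (torus_embed x)) \<and>
     abs_torus_L2 (\<lambda>x. F k (torus_embed x)) \<in> hartley_space" for k
    using hartley_space_simple[of "range (F k)" "\<lambda>y. F k -` {y}"] by (simp only: F_eq[symmetric] simp_thms)
  have "abs_torus_L2 (\<lambda>x. g (torus_embed x)) \<in> hartley_space"
    by (rule hartley_space_limit[where s = "\<lambda>k x. F k (torus_embed x)" and g = "\<lambda>x. 2 * g (torus_embed x)"])
       (use S gsq F(2,3) in \<open>auto simp: abs_mult intro: torus_square_integrable_scale\<close>)
  moreover have "\<Omega> = abs_torus_L2 (\<lambda>x. g (torus_embed x))"
    unfolding f(2) by (rule abs_torus_L2_eqI) (use f gsq ae in \<open>simp add: torus_L2_rel_def\<close>)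
  ultimately show "\<Omega> \<in> hartley_space" by simp
qed

section \<open>Orthonormal bases and Parseval's identity\<close>

locale orthonormal_basis =
  fixes e :: "'i \<Rightarrow> 'a::real_inner"
  assumes orthonormal: "e i \<bullet> e j = (if i = j then 1 else 0)"
    and total: "closure (span (range e)) = UNIV"
begin

definition proj :: "'i set \<Rightarrow> 'a \<Rightarrow> 'a" where
  "proj I f = (\<Sum>i\<in>I. (f \<bullet> e i) *\<^sub>R e i)"

lemma inner_proj: "finite I \<Longrightarrow> proj I f \<bullet> g = (\<Sum>i\<in>I. (f \<bullet> e i) * (g \<bullet> e i))"
  by (simp add: proj_def inner_sum_left) (simp add: inner_commute)

lemma norm_diff_proj: "finite I \<Longrightarrow> (norm (f - proj I f))\<^sup>2 = (norm f)\<^sup>2 - (\<Sum>i\<in>I. (f \<bullet> e i)\<^sup>2)"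
proof -
  assume I: "finite I"
  have "proj I f \<bullet> e j = (if j \<in> I then f \<bullet> e j else 0)" for j
    using I by (simp add: inner_proj orthonormal if_distrib cong: if_cong)
  then have "proj I f \<bullet> proj I f = (\<Sum>i\<in>I. (f \<bullet> e i)\<^sup>2)"
    using I by (simp add: inner_proj power2_eq_square)
  moreover have "(norm (f - proj I f))\<^sup>2 = (norm f)\<^sup>2 - 2 * (proj I f \<bullet> f) + proj I f \<bullet> proj I f"
    unfolding power2_norm_eq_inner by (simp add: inner_diff_left inner_diff_right inner_commute)
  ultimately show ?thesis using inner_proj[OF I, of f f] by (simp add: power2_eq_square)
qed

lemma bessel_inequality: "finite I \<Longrightarrow> (\<Sum>i\<in>I. (f \<bullet> e i)\<^sup>2) \<le> (norm f)\<^sup>2"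
  using norm_diff_proj[of I f] zero_le_power2[of "norm (f - proj I f)"] by linarith

lemma span_proj:
  assumes "p \<in> span (range e)"
  obtains I where "finite I" "\<And>J. finite J \<Longrightarrow> I \<subseteq> J \<Longrightarrow> proj J p = p"
proof -
  have "\<exists>I. finite I \<and> (\<forall>J. finite J \<longrightarrow> I \<subseteq> J \<longrightarrow> proj J p = p)"
    using assms
  proof (induction rule: span_induct_alt)
    case base
    show ?case by (rule exI[of _ "{}"]) (simp add: proj_def)
  next
    case (step c x y)
    then obtain i I where x: "x = e i" and I: "finite I" "\<And>J. finite J \<Longrightarrow> I \<subseteq> J \<Longrightarrow> proj J y = y"
      by auto
    have "proj J (c *\<^sub>R e i + y) = c *\<^sub>R e i + y" if "finite J" "insert i I \<subseteq> J" for J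
    proof -
      have "proj J (c *\<^sub>R e i + y) = c *\<^sub>R (\<Sum>j\<in>J. (e i \<bullet> e j) *\<^sub>R e j) + proj J y"
        by (simp add: proj_def inner_add_left scaleR_add_left sum.distrib scaleR_sum_right)
      also have "(\<Sum>j\<in>J. (e i \<bullet> e j) *\<^sub>R e j) = (\<Sum>j\<in>J. if i = j then e j else 0)"
        by (intro sum.cong) (auto simp: orthonormal)
      also have "\<dots> = e i" using that by simp
      finally show ?thesis using that I by simp
    qed
    then show ?case using I x by (intro exI[of _ "insert i I"]) auto
  qed
  then show ?thesis using that by blast
qed

text \<open>A nearby \<open>p\<close> in the span is fixed by all large projections, so the error of
  \<open>f\<close> is the error of \<open>f - p\<close>, which is at most its norm.\<close>

lemma proj_close:
  assumes "\<epsilon> > 0"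
  obtains I where "finite I" "\<And>J. finite J \<Longrightarrow> I \<subseteq> J \<Longrightarrow> norm (f - proj J f) < \<epsilon>"
proof -
  have "f \<in> closure (span (range e))" by (simp add: total)
  then obtain p where p: "p \<in> span (range e)" "dist p f < \<epsilon>"
    using assms by (auto simp: closure_approachable)
  obtain I where I: "finite I" "\<And>J. finite J \<Longrightarrow> I \<subseteq> J \<Longrightarrow> proj J p = p"
    using span_proj[OF p(1)] by blast
  have "norm (f - proj J f) < \<epsilon>" if J: "finite J" "I \<subseteq> J" for J
  proof -
    have "proj J (f - p) = proj J f - proj J p"
      by (simp add: proj_def inner_diff_left scaleR_diff_left sum_subtractf)
    then have "f - proj J f = (f - p) - proj J (f - p)" using I(2)[OF J] by simp
    then have "(norm (f - proj J f))\<^sup>2 = (norm (f - p))\<^sup>2 - (\<Sum>i\<in>J. ((f - p) \<bullet> e i)\<^sup>2)"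
      by (simp only: norm_diff_proj[OF J(1)])
    moreover have "0 \<le> (\<Sum>i\<in>J. ((f - p) \<bullet> e i)\<^sup>2)" by (simp add: sum_nonneg)
    ultimately have "(norm (f - proj J f))\<^sup>2 \<le> (norm (f - p))\<^sup>2" by linarith
    then have "norm (f - proj J f) \<le> norm (f - p)" by (rule power2_le_imp_le) simp
    then show ?thesis using p by (simp add: dist_norm norm_minus_commute)
  qed
  then show ?thesis using that I(1) by blast
qed

lemma proj_tendsto: "((\<lambda>J. proj J f) \<longlongrightarrow> f) (finite_subsets_at_top UNIV)"
proof (rule tendstoI)
  fix \<epsilon> :: real assume "\<epsilon> > 0"
  from proj_close[OF this, of f] obtain I where "finite I"
    "\<And>J. finite J \<Longrightarrow> I \<subseteq> J \<Longrightarrow> norm (f - proj J f) < \<epsilon>" by blast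
  then show "\<forall>\<^sub>F J in finite_subsets_at_top UNIV. dist (proj J f) f < \<epsilon>"
    unfolding eventually_finite_subsets_at_top by (auto simp: dist_norm norm_minus_commute)
qed

lemma parseval: "((\<lambda>i. (f \<bullet> e i)\<^sup>2) has_sum (norm f)\<^sup>2) UNIV"
proof -
  have "((\<lambda>J. proj J f \<bullet> f) \<longlongrightarrow> f \<bullet> f) (finite_subsets_at_top UNIV)"
    by (intro tendsto_inner proj_tendsto tendsto_const)
  then have "((\<lambda>J. \<Sum>i\<in>J. (f \<bullet> e i)\<^sup>2) \<longlongrightarrow> (norm f)\<^sup>2) (finite_subsets_at_top UNIV)"
    unfolding power2_norm_eq_inner
    by (rule Lim_transform_eventually)
       (auto simp: eventually_finite_subsets_at_top inner_proj power2_eq_square)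
  then show ?thesis by (simp add: has_sum_def)
qed

lemma basis_eqI: "(\<And>i. f \<bullet> e i = g \<bullet> e i) \<Longrightarrow> f = g"
  using parseval[of "f - g"] has_sum_unique[of "\<lambda>_. 0::real" UNIV 0 "(norm (f - g))\<^sup>2"]
  by (simp add: inner_diff_left)

end

interpretation hartley: orthonormal_basis "hartley :: int^('n::finite) \<Rightarrow> 'n torus_L2"
  by standard (simp_all add: inner_hartley hartley_space_eq_UNIV)

subsection \<open>Bessel potentials\<close>

text \<open>Up to sign, cosine and sine coefficients of \<open>f\<close> are the even and odd parts
  of its Hartley coefficients as a function of \<open>n\<close>. This connects
  \<open>bessel_potential\<close>, defined by complex coefficients, with the real basis.\<close>

lemma fourier_coeff_eq:
  fixes f :: "('n::finite) torus_L2"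
  shows "fourier_coeff f n =
    Complex ((f \<bullet> hartley n + f \<bullet> hartley (- n)) / 2) ((f \<bullet> hartley (- n) - f \<bullet> hartley n) / 2)"
proof -
  obtain g where g: "torus_square_integrable g" "f = abs_torus_L2 g" by (rule abs_torus_L2_cases)
  let ?c = "hartley_const TYPE('n)"
  have sc: "torus_square_integrable (\<lambda>x. cos (phase m x))" "torus_square_integrable (\<lambda>x. sin (phase m x))" for m :: "int^'n"
    using trig_poly_L2[OF trig_poly_cos] trig_poly_L2[OF trig_poly_sin] by auto
  note ic = torus_square_integrable_mult[OF g(1) sc(1)] and i_s = torus_square_integrable_mult[OF g(1) sc(2)]
  define C where "C = (LINT x|torus_cell. g x * cos (phase n x))"
  define S where "S = (LINT x|torus_cell. g x * sin (phase n x))"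
  have h: "f \<bullet> hartley m = ?c * ((LINT x|torus_cell. g x * cos (phase m x)) + (LINT x|torus_cell. g x * sin (phase m x)))" for m
  proof -
    have "f \<bullet> hartley m = (LINT x|torus_cell. g x * (?c * cas (phase m x)))"
      unfolding g(2) hartley_def
      by (intro inner_abs_torus_L2 g torus_square_integrable_scale torus_square_integrable_cas)
    also have "\<dots> = (LINT x|torus_cell. ?c * (g x * cos (phase m x) + g x * sin (phase m x)))"
      by (simp add: cas_def algebra_simps)
    also have "\<dots> = ?c * ((LINT x|torus_cell. g x * cos (phase m x)) + (LINT x|torus_cell. g x * sin (phase m x)))"
      using ic i_s by simp
    finally show ?thesis .
  qed
  have h1: "f \<bullet> hartley n = ?c * (C + S)" by (simp add: h C_def S_def)
  have h2: "f \<bullet> hartley (- n) = ?c * (C - S)" by (simp add: h C_def S_def phase_minus_left)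
  have "fourier_coeff f n = complex_of_real ?c *
      (LINT x|torus_cell. complex_of_real (g x) * cis (- phase n x))"
    unfolding g(2) by (subst fourier_coeff.abs_eq) (use g in \<open>simp_all add: hartley_const_def phase_def\<close>)
  also have "(\<lambda>x. complex_of_real (g x) * cis (- phase n x)) =
      (\<lambda>x. complex_of_real (g x * cos (phase n x)) - \<i> * complex_of_real (g x * sin (phase n x)))"
    by (auto simp: complex_eq_iff)
  also have "(LINT x|torus_cell. complex_of_real (g x * cos (phase n x)) - \<i> * complex_of_real (g x * sin (phase n x)))
     = complex_of_real C - \<i> * complex_of_real S"
    unfolding C_def S_def using ic i_s
    by (subst Bochner_Integration.integral_diff) (auto simp del: of_real_mult simp: integral_complex_of_real)
  finally show ?thesis by (simp add: h1 h2 complex_eq_iff algebra_simps)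
qed

definition japanese_bracket :: "int^'n \<Rightarrow> real" where
  "japanese_bracket n = sqrt (1 + (\<Sum>i\<in>UNIV. (of_int (n $ i))\<^sup>2))"

lemma japanese_bracket_square: "(japanese_bracket n)\<^sup>2 = 1 + (\<Sum>i\<in>UNIV. (of_int (n $ i))\<^sup>2)"
  unfolding japanese_bracket_def by (rule real_sqrt_pow2) (simp add: add_nonneg_nonneg sum_nonneg)

lemma japanese_bracket_ge_1: "japanese_bracket n \<ge> 1"
  unfolding japanese_bracket_def by (simp add: sum_nonneg)

lemma japanese_bracket_minus [simp]: "japanese_bracket (- n) = japanese_bracket n"
  by (simp add: japanese_bracket_def)

text \<open>The symbol takes the same value at \<open>m\<close> and \<open>- m\<close>, the only
  frequencies of \<open>hartley m\<close>. The description operator is resolved by uniqueness: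
  Fourier coefficients determine the Hartley coefficients, and these the function.\<close>

lemma bessel_potential_hartley:
  "bessel_potential \<alpha> (hartley m) = ((japanese_bracket m)\<^sup>2 powr (- \<alpha>)) *\<^sub>R hartley m"
proof -
  have eq: "fourier_coeff (((japanese_bracket m)\<^sup>2 powr (- \<alpha>)) *\<^sub>R hartley m) n =
     complex_of_real ((1 + (\<Sum>i\<in>UNIV. (of_int (n $ i))\<^sup>2)) powr (- \<alpha>)) * fourier_coeff (hartley m) n" for n
  proof (cases "n = m \<or> n = - m")
    case True
    then have "japanese_bracket n = japanese_bracket m" by auto
    then show ?thesis unfolding japanese_bracket_square[symmetric]
      by (simp add: fourier_coeff_eq complex_eq_iff algebra_simps)
  next
    case False
    then have "hartley m \<bullet> hartley n = 0" "hartley m \<bullet> hartley (- n) = 0"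
      by (auto simp: inner_hartley)
    then show ?thesis by (simp add: fourier_coeff_eq complex_eq_iff)
  qed
  show ?thesis unfolding bessel_potential_def
  proof (rule the_equality)
    fix g assume g: "\<forall>n. fourier_coeff g n = complex_of_real ((1 + (\<Sum>i\<in>UNIV. (of_int (n $ i))\<^sup>2)) powr (- \<alpha>)) * fourier_coeff (hartley m) n"
    show "g = ((japanese_bracket m)\<^sup>2 powr (- \<alpha>)) *\<^sub>R hartley m"
    proof (rule hartley.basis_eqI)
      fix n
      have "fourier_coeff g n = fourier_coeff (((japanese_bracket m)\<^sup>2 powr (- \<alpha>)) *\<^sub>R hartley m) n"
        using g eq by simp
      then show "g \<bullet> hartley n = ((japanese_bracket m)\<^sup>2 powr (- \<alpha>)) *\<^sub>R hartley m \<bullet> hartley n"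
        by (simp add: fourier_coeff_eq complex_eq_iff del: inner_scaleR_left)
    qed
  qed (use eq in blast)
qed

section \<open>Gaussian measures on inner product spaces\<close>

lemma normal_distribution_scale:
  assumes "\<sigma> > 0"
  shows "distr std_normal_distribution borel (\<lambda>x. \<sigma> * x) = density lborel (normal_density 0 \<sigma>)"
proof -
  interpret prob_space std_normal_distribution by (rule prob_space_normal_density) simp
  have "distributed std_normal_distribution lborel (\<lambda>x. x) (normal_density 0 1)"
  proof -
    have "distr std_normal_distribution lborel (\<lambda>x. x) = std_normal_distribution"
      by (rule distr_id2) simp
    then show ?thesis by (simp add: distributed_def)
  qed
  from normal_density_affine[OF this, of \<sigma> 0]
  have "distr std_normal_distribution lborel (\<lambda>x. \<sigma> * x) = density lborel (normal_density 0 \<sigma>)"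
    using assms by (simp add: distributed_def)
  then show ?thesis by (simp cong: distr_cong)
qed

lemma normal_distribution_cos_sin:
  assumes "\<sigma> > 0"
  shows "(LINT x|density lborel (normal_density 0 \<sigma>). cos x) = exp (- \<sigma>\<^sup>2 / 2)"
    and "(LINT x|density lborel (normal_density 0 \<sigma>). sin x) = 0"
proof -
  interpret prob_space std_normal_distribution by (rule prob_space_normal_density) simp
  have int: "integrable std_normal_distribution (\<lambda>x. iexp (\<sigma> * x))"
    by (rule integrable_const_bound[of _ 1]) auto
  have "(LINT x|std_normal_distribution. Re (iexp (\<sigma> * x))) = Re (char std_normal_distribution \<sigma>)"
    "(LINT x|std_normal_distribution. Im (iexp (\<sigma> * x))) = Im (char std_normal_distribution \<sigma>)"
    unfolding char_def using int by simp_all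
  then have "(LINT x|std_normal_distribution. cos (\<sigma> * x)) = exp (- \<sigma>\<^sup>2 / 2)"
    "(LINT x|std_normal_distribution. sin (\<sigma> * x)) = 0"
    by (simp_all add: char_std_normal_distribution Re_exp Im_exp exp_of_real)
  then show "(LINT x|density lborel (normal_density 0 \<sigma>). cos x) = exp (- \<sigma>\<^sup>2 / 2)"
    "(LINT x|density lborel (normal_density 0 \<sigma>). sin x) = 0"
    unfolding normal_distribution_scale[OF assms, symmetric] by (simp_all add: integral_distr)
qed

lemma centered_gaussian_inner_measurable [measurable]:
  assumes "sets \<mu> = sets borel"
  shows "(\<lambda>\<phi>::'a::real_inner. h \<bullet> \<phi>) \<in> borel_measurable \<mu>"
proof -
  have "(\<lambda>\<phi>::'a. h \<bullet> \<phi>) \<in> borel_measurable borel"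
    by (intro borel_measurable_continuous_onI continuous_intros)
  then show ?thesis by (simp cong: measurable_cong_sets add: assms)
qed

lemma centered_gaussian_char:
  assumes "centered_gaussian \<mu>"
  shows "integrable \<mu> (\<lambda>\<phi>. (h \<bullet> \<phi>)\<^sup>2)"
    and "(LINT \<phi>|\<mu>. cos (h \<bullet> \<phi>)) = exp (- (LINT \<phi>|\<mu>. (h \<bullet> \<phi>)\<^sup>2) / 2)"
    and "(LINT \<phi>|\<mu>. sin (h \<bullet> \<phi>)) = 0"
proof -
  interpret prob_space \<mu> using assms by (simp add: centered_gaussian_def)
  have [measurable_cong]: "sets \<mu> = sets borel" using assms by (simp add: centered_gaussian_def)
  note [measurable] = centered_gaussian_inner_measurable[OF this]
  obtain \<sigma> where \<sigma>: "\<sigma> \<ge> 0" "distr \<mu> borel (\<lambda>\<phi>. h \<bullet> \<phi>) =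
      (if \<sigma> = 0 then return borel 0 else density lborel (normal_density 0 \<sigma>))"
    using assms unfolding centered_gaussian_def by blast
  have tr: "(LINT \<phi>|\<mu>. g (h \<bullet> \<phi>)) = (LINT x|distr \<mu> borel (\<lambda>\<phi>. h \<bullet> \<phi>). g x)"
    and tri: "integrable \<mu> (\<lambda>\<phi>. g (h \<bullet> \<phi>)) \<longleftrightarrow> integrable (distr \<mu> borel (\<lambda>\<phi>. h \<bullet> \<phi>)) g"
    if "g \<in> borel_measurable borel" for g :: "real \<Rightarrow> real"
    using that by (simp_all add: integral_distr integrable_distr_eq)
  have sq: "(\<lambda>x::real. x\<^sup>2) \<in> borel_measurable borel" "cos \<in> borel_measurable (borel :: real measure)"
    "sin \<in> borel_measurable (borel :: real measure)"
    by (auto intro!: borel_measurable_continuous_onI continuous_intros)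
  have "integrable \<mu> (\<lambda>\<phi>. (h \<bullet> \<phi>)\<^sup>2) \<and>
    (LINT \<phi>|\<mu>. cos (h \<bullet> \<phi>)) = exp (- (LINT \<phi>|\<mu>. (h \<bullet> \<phi>)\<^sup>2) / 2) \<and> (LINT \<phi>|\<mu>. sin (h \<bullet> \<phi>)) = 0"
  proof (cases "\<sigma> = 0")
    case True
    interpret R: prob_space "return borel (0::real)" by (rule prob_space_return) simp
    have "integrable (return borel (0::real)) (\<lambda>x. x\<^sup>2)"
      using sq(1) by (subst integrable_iff_bounded) (simp add: nn_integral_return)
    then show ?thesis unfolding tr[OF sq(1)] tr[OF sq(2)] tr[OF sq(3)] tri[OF sq(1)] \<sigma>(2) using True
      by (simp add: integral_return)
  next
    case False
    then have s: "\<sigma> > 0" using \<sigma> by simp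
    have d: "distributed \<mu> lborel (\<lambda>\<phi>. h \<bullet> \<phi>) (normal_density 0 \<sigma>)"
      using \<sigma> False by (auto simp: distributed_def cong: distr_cong)
    have e: "expectation (\<lambda>\<phi>. h \<bullet> \<phi>) = 0" using normal_distributed_expectation[OF s d] .
    have v: "(LINT \<phi>|\<mu>. (h \<bullet> \<phi>)\<^sup>2) = \<sigma>\<^sup>2"
      using normal_distributed_variance[OF s d] by (simp add: e)
    \<comment> \<open>Otherwise the integral of the square would have the default value 0, whereas
      \<open>v\<close> computes it to be \<open>\<sigma>\<^sup>2\<close>, which is positive.\<close>
    have i: "integrable \<mu> (\<lambda>\<phi>. (h \<bullet> \<phi>)\<^sup>2)"
    proof (rule ccontr)
      assume "\<not> integrable \<mu> (\<lambda>\<phi>. (h \<bullet> \<phi>)\<^sup>2)"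
      then show False using not_integrable_integral_eq[of \<mu> "\<lambda>\<phi>. (h \<bullet> \<phi>)\<^sup>2"] v s by simp
    qed
    show ?thesis
      using i v normal_distribution_cos_sin[OF s] False
      by (simp add: tr[OF sq(2)] tr[OF sq(3)] \<sigma>(2))
  qed
  then show "integrable \<mu> (\<lambda>\<phi>. (h \<bullet> \<phi>)\<^sup>2)"
    and "(LINT \<phi>|\<mu>. cos (h \<bullet> \<phi>)) = exp (- (LINT \<phi>|\<mu>. (h \<bullet> \<phi>)\<^sup>2) / 2)"
    and "(LINT \<phi>|\<mu>. sin (h \<bullet> \<phi>)) = 0" by blast+
qed

section \<open>Covariance form of a Gaussian measure and failure of absolute continuity\<close>

locale gaussian_measure =
  fixes \<mu> :: "('a::real_inner) measure"
  assumes gaussian: "centered_gaussian \<mu>"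
begin

sublocale prob_space \<mu> using gaussian by (simp add: centered_gaussian_def)

lemma sets_gaussian [measurable_cong]: "sets \<mu> = sets borel"
  using gaussian by (simp add: centered_gaussian_def)

lemma inner_borel [measurable]: "(\<lambda>\<phi>. h \<bullet> \<phi>) \<in> borel_measurable \<mu>"
  by (rule centered_gaussian_inner_measurable[OF sets_gaussian])

text \<open>For the measure in question this is the inner product of the Sobolev space of order
  \<open>- \<alpha>\<close>, so that bounds on \<open>cov\<close> are dual to bounds of order
  \<alpha>.\<close>

definition cov :: "'a \<Rightarrow> 'a \<Rightarrow> real" where
  "cov f g = (LINT \<phi>|\<mu>. (f \<bullet> \<phi>) * (g \<bullet> \<phi>))"

lemma integrable_square: "integrable \<mu> (\<lambda>\<phi>. (h \<bullet> \<phi>)\<^sup>2)"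
  using centered_gaussian_char(1)[OF gaussian] .

lemma integrable_mult: "integrable \<mu> (\<lambda>\<phi>. (f \<bullet> \<phi>) * (g \<bullet> \<phi>))"
proof -
  have "integrable \<mu> (\<lambda>\<phi>. (((f + g) \<bullet> \<phi>)\<^sup>2 - (f \<bullet> \<phi>)\<^sup>2 - (g \<bullet> \<phi>)\<^sup>2) / 2)"
    by (intro Bochner_Integration.integrable_diff integrable_divide integrable_square)
  then show ?thesis by (simp add: inner_add_left power2_sum)
qed

lemma expectation_cos: "(LINT \<phi>|\<mu>. cos (h \<bullet> \<phi>)) = exp (- cov h h / 2)"
  using centered_gaussian_char(2)[OF gaussian, of h] by (simp add: cov_def power2_eq_square)

lemma expectation_sin: "(LINT \<phi>|\<mu>. sin (h \<bullet> \<phi>)) = 0"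
  using centered_gaussian_char(3)[OF gaussian] .

lemma integrable_cos: "integrable \<mu> (\<lambda>\<phi>. cos (h \<bullet> \<phi>))"
  by (rule integrable_const_bound[of _ 1]) auto

lemma cov_commute: "cov f g = cov g f"
  by (simp add: cov_def mult.commute)

lemma cov_add_left: "cov (f + f') g = cov f g + cov f' g"
  by (simp add: cov_def inner_add_left distrib_right integrable_mult)

lemma cov_scaleR_left: "cov (c *\<^sub>R f) g = c * cov f g"
  by (simp add: cov_def mult.assoc)

lemma cov_add_right: "cov g (f + f') = cov g f + cov g f'"
  by (simp add: cov_commute[of g] cov_add_left)

lemma cov_scaleR_right: "cov g (c *\<^sub>R f) = c * cov g f"
  by (simp add: cov_commute[of g] cov_scaleR_left)

lemma cov_zero [simp]: "cov 0 g = 0" "cov g 0 = 0"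
  by (simp_all add: cov_def)

lemma cov_sum_left: "cov (\<Sum>i\<in>I. f i) g = (\<Sum>i\<in>I. cov (f i) g)"
  by (induction I rule: infinite_finite_induct) (simp_all add: cov_add_left)

lemma cov_nonneg: "cov f f \<ge> 0"
  by (simp add: cov_def)

lemma cov_minus: "cov (f - g) (f - g) = cov f f - 2 * cov f g + cov g g"
proof -
  have "f - g = f + (- 1) *\<^sub>R g" by simp
  then show ?thesis
    by (simp only: cov_add_left cov_add_right cov_scaleR_left cov_scaleR_right cov_commute[of g f]) simp
qed

lemma cov_Cauchy_Schwarz: "(cov f g)\<^sup>2 \<le> cov f f * cov g g"
proof -
  have q: "0 \<le> cov f f + 2 * t * cov f g + t\<^sup>2 * cov g g" for t
    using cov_nonneg[of "f + t *\<^sub>R g"]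
    by (simp add: cov_add_left cov_add_right cov_scaleR_left cov_scaleR_right cov_commute[of g f]
        power2_eq_square algebra_simps)
  show ?thesis
  proof (cases "cov g g = 0")
    case True
    have "cov f g = 0"
    proof (rule ccontr)
      assume "cov f g \<noteq> 0"
      \<comment> \<open>With \<open>cov g g = 0\<close> the quadratic polynomial is affine in
        \<open>t\<close>; this \<open>t\<close> makes it equal to - 1.\<close>
      then show False
        using q[of "- (cov f f + 1) / (2 * cov f g)"] True by (simp add: field_simps)
    qed
    then show ?thesis using True by simp
  next
    case False
    then have "cov g g > 0" using cov_nonneg[of g] by simp
    then show ?thesis
      using q[of "- cov f g / cov g g"] by (simp add: field_simps power2_eq_square)
  qed
qed

text \<open>The variables \<open>cos (f k \<bullet> \<phi>) - exp (- 1 / 2)\<close> are orthogonal, so their averages tend to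
  \<open>0\<close> almost everywhere along a subsequence, also with respect to \<open>\<nu>\<close>.\<close>

lemma not_absolutely_continuousI:
  fixes f :: "nat \<Rightarrow> 'a"
  assumes orth: "\<And>j k. cov (f j) (f k) = (if j = k then 1 else 0)"
    and \<nu>: "prob_space \<nu>" "sets \<nu> = sets borel"
    and c: "c < exp (- 1 / 2)" "\<And>k. (LINT \<phi>|\<nu>. cos (f k \<bullet> \<phi>)) \<le> c"
  shows "\<not> absolutely_continuous \<mu> \<nu>"
proof
  assume ac: "absolutely_continuous \<mu> \<nu>"
  interpret N: prob_space \<nu> by fact
  note [measurable_cong] = \<nu>(2)
  note [measurable] = centered_gaussian_inner_measurable[OF \<nu>(2)]
  \<comment> \<open>The expectation of \<open>cos (f k \<bullet> \<phi>)\<close> under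
    \<open>\<mu>\<close>, as each \<open>f k\<close> has unit variance.\<close>
  define b where "b = exp (- 1 / 2 :: real)"
  define Z where "Z k \<phi> = cos (f k \<bullet> \<phi>) - b" for k \<phi>
  define A where "A K \<phi> = (\<Sum>k<K. Z k \<phi>) / real K" for K \<phi>
  have b: "0 < b" "b < 1" by (simp_all add: b_def)
  have Zb: "\<bar>Z k \<phi>\<bar> \<le> 2" for k \<phi>
    using b cos_le_one[of "f k \<bullet> \<phi>"] cos_ge_minus_one[of "f k \<bullet> \<phi>"] unfolding Z_def by linarith
  have Ab: "\<bar>A K \<phi>\<bar> \<le> 2" for K \<phi>
  proof (cases "K = 0")
    case False
    have "\<bar>\<Sum>k<K. Z k \<phi>\<bar> \<le> (\<Sum>k<K. 2)" by (rule order_trans[OF sum_abs sum_mono]) (rule Zb)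
    then show ?thesis using False by (simp add: A_def field_simps)
  qed (simp add: A_def)
  have [measurable]: "Z k \<in> borel_measurable \<mu>" "A k \<in> borel_measurable \<mu>" for k
    unfolding Z_def A_def by measurable
  have [measurable]: "Z k \<in> borel_measurable \<nu>" "A k \<in> borel_measurable \<nu>" for k
    unfolding Z_def A_def by measurable
  have ZZb: "\<bar>Z j \<phi> * Z k \<phi>\<bar> \<le> 4" for j k \<phi>
    using mult_mono[OF Zb Zb, of j \<phi> k \<phi>] by (simp add: abs_mult mult.commute)
  have ZZi: "integrable \<mu> (\<lambda>\<phi>. Z j \<phi> * Z k \<phi>)" for j k
    by (rule integrable_const_bound[of _ 4])
       (use ZZb in auto)
  have ZZ: "(LINT \<phi>|\<mu>. Z j \<phi> * Z k \<phi>) \<le> (if j = k then 4 else 0)" for j k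
  proof (cases "j = k")
    case True
    have "(LINT \<phi>|\<mu>. Z j \<phi> * Z k \<phi>) \<le> (LINT \<phi>|\<mu>. 4)"
    proof (rule integral_mono)
      fix \<phi>
      show "Z j \<phi> * Z k \<phi> \<le> 4"
        by (rule order_trans[OF abs_ge_self ZZb])
    qed (use ZZi in auto)
    then show ?thesis using True by (simp add: prob_space)
  next
    case False
    \<comment> \<open>By orthogonality, \<open>f j + f k\<close> and \<open>f j - f k\<close> both
      have variance 2, so the product formula gives the covariance
      \<open>exp (- 1) - b\<^sup>2 = 0\<close>.\<close>
    have cc: "cos x * cos y = (cos (x + y) + cos (x - y)) / 2" for x y :: real
      by (simp add: cos_add cos_diff)
    have 1: "(LINT \<phi>|\<mu>. cos ((f j + f k) \<bullet> \<phi>)) = exp (- 1)"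
      "(LINT \<phi>|\<mu>. cos ((f j - f k) \<bullet> \<phi>)) = exp (- 1)"
      "(LINT \<phi>|\<mu>. cos (f j \<bullet> \<phi>)) = b" "(LINT \<phi>|\<mu>. cos (f k \<bullet> \<phi>)) = b"
      unfolding expectation_cos cov_minus using False
      by (simp_all add: cov_add_left cov_add_right orth b_def)
    have "(LINT \<phi>|\<mu>. Z j \<phi> * Z k \<phi>) = (LINT \<phi>|\<mu>. cos ((f j + f k) \<bullet> \<phi>) / 2 + cos ((f j - f k) \<bullet> \<phi>) / 2
        - b * cos (f j \<bullet> \<phi>) - b * cos (f k \<bullet> \<phi>) + b\<^sup>2)"
      by (intro Bochner_Integration.integral_cong refl)
        (simp add: Z_def algebra_simps cc power2_eq_square inner_add_left inner_diff_left add_divide_distrib)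
    also have "\<dots> = exp (- 1) / 2 + exp (- 1) / 2 - b * b - b * b + b\<^sup>2"
      by (simp add: integrable_cos 1 prob_space)
    also have "\<dots> = 0" by (simp add: b_def power2_eq_square flip: exp_add)
    finally show ?thesis using False by simp
  qed
  have A2: "(LINT \<phi>|\<mu>. norm ((A K \<phi>)\<^sup>2)) \<le> 4 / real K" for K
  proof -
    have "(LINT \<phi>|\<mu>. norm ((A K \<phi>)\<^sup>2)) = (LINT \<phi>|\<mu>. (\<Sum>j<K. \<Sum>k<K. Z j \<phi> * Z k \<phi>) / (real K)\<^sup>2)"
    proof (intro Bochner_Integration.integral_cong refl)
      fix \<phi>
      have "(A K \<phi>)\<^sup>2 = (\<Sum>j<K. \<Sum>k<K. Z j \<phi> * Z k \<phi>) / (real K)\<^sup>2"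
        by (simp add: A_def power_divide power2_eq_square sum_product)
      then show "norm ((A K \<phi>)\<^sup>2) = (\<Sum>j<K. \<Sum>k<K. Z j \<phi> * Z k \<phi>) / (real K)\<^sup>2"
        by (metis abs_power2 real_norm_def)
    qed
    also have "\<dots> = (\<Sum>j<K. \<Sum>k<K. (LINT \<phi>|\<mu>. Z j \<phi> * Z k \<phi>)) / (real K)\<^sup>2"
      by (simp add: ZZi)
    also have "\<dots> \<le> (\<Sum>j<K. \<Sum>k<K. (if j = k then 4 else 0)) / (real K)\<^sup>2"
      by (intro divide_right_mono sum_mono ZZ) simp
    also have "\<dots> = 4 / real K" by (simp add: power2_eq_square)
    finally show ?thesis .
  qed
  have "(\<lambda>K. LINT \<phi>|\<mu>. norm ((A K \<phi>)\<^sup>2)) \<longlonglongrightarrow> 0"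
  proof (rule tendsto_sandwich[OF _ _ tendsto_const])
    show "(\<lambda>K. 4 / real K) \<longlonglongrightarrow> 0"
      using tendsto_mult_right_zero[OF lim_inverse_n, of 4] by (simp add: divide_inverse)
  qed (use A2 in auto)
  moreover have "integrable \<mu> (\<lambda>\<phi>. (A K \<phi>)\<^sup>2)" for K
    by (rule integrable_const_bound[of _ 4]) (use power_mono[OF Ab, of _ _ 2] in auto)
  ultimately obtain r where r: "strict_mono (r :: nat \<Rightarrow> nat)" "AE \<phi> in \<mu>. (\<lambda>n. (A (r n) \<phi>)\<^sup>2) \<longlonglongrightarrow> 0"
    using tendsto_L1_AE_subseq[of \<mu> "\<lambda>K \<phi>. (A K \<phi>)\<^sup>2"] by blast
  \<comment> \<open>Convergence in the mean does not pass from \<open>\<mu>\<close> to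
    \<open>\<nu>\<close>, but convergence almost everywhere along a subsequence does.\<close>
  have "AE \<phi> in \<nu>. (\<lambda>n. (A (r n) \<phi>)\<^sup>2) \<longlonglongrightarrow> 0"
    by (rule absolutely_continuous_AE[OF _ ac r(2)]) (simp add: \<nu>(2) sets_gaussian)
  then have "AE \<phi> in \<nu>. (\<lambda>n. A (r n) \<phi>) \<longlonglongrightarrow> 0"
  proof eventually_elim
    case (elim \<phi>)
    from tendsto_real_sqrt[OF elim] show ?case by (simp add: tendsto_rabs_zero_iff)
  qed
  then have "(\<lambda>n. LINT \<phi>|\<nu>. A (r n) \<phi>) \<longlonglongrightarrow> (LINT \<phi>|\<nu>. 0)"
    by (intro integral_dominated_convergence[where w = "\<lambda>_. 2"]) (auto simp: Ab)
  moreover have "(LINT \<phi>|\<nu>. A K \<phi>) \<le> c - b" if "K > 0" for K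
  proof -
    have i: "integrable \<nu> (\<lambda>\<phi>. cos (f k \<bullet> \<phi>))" for k
      by (rule N.integrable_const_bound[of _ 1]) auto
    have "(LINT \<phi>|\<nu>. A K \<phi>) = (\<Sum>k<K. (LINT \<phi>|\<nu>. cos (f k \<bullet> \<phi>)) - b) / real K"
      by (simp add: A_def Z_def i N.prob_space)
    also have "\<dots> \<le> (\<Sum>k<K. c - b) / real K"
      by (intro divide_right_mono sum_mono diff_right_mono c) simp
    finally show ?thesis using that by simp
  qed
  then have "\<forall>\<^sub>F n in sequentially. (LINT \<phi>|\<nu>. A (r n) \<phi>) \<le> c - b"
    by (intro eventually_sequentiallyI[of 1])
      (meson less_le_trans less_numeral_extra(1) r(1) strict_mono_imp_increasing)
  ultimately have "(LINT \<phi>|\<nu>. 0) \<le> c - b" by (intro tendsto_upperbound) auto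
  then show False using c(1) by (simp add: b_def)
qed

end

section \<open>Consequences of absolute continuity for weighted norms\<close>

locale diagonal_gaussian = gaussian_measure \<mu> + orthonormal_basis e
  for \<mu> :: "('a::real_inner) measure" and e :: "'i \<Rightarrow> 'a" +
  fixes w :: "'i \<Rightarrow> real"
  assumes w_pos: "w i > 0" and cov_basis: "cov f (e i) = w i * (f \<bullet> e i)"
begin

definition combination :: "'i set \<Rightarrow> ('i \<Rightarrow> real) \<Rightarrow> 'a" where
  "combination I a = (\<Sum>i\<in>I. a i *\<^sub>R e i)"

lemma inner_combination: "finite I \<Longrightarrow> combination I a \<bullet> e j = (if j \<in> I then a j else 0)"
  by (simp add: combination_def inner_sum_left orthonormal if_distrib cong: if_cong)

lemma cov_sum_right: "cov g (\<Sum>i\<in>I. f i) = (\<Sum>i\<in>I. cov g (f i))"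
  by (simp add: cov_commute[of g] cov_sum_left)

lemma cov_combination: "cov f (combination I a) = (\<Sum>i\<in>I. a i * (w i * (f \<bullet> e i)))"
  unfolding combination_def cov_sum_right by (simp add: cov_scaleR_right cov_basis)

lemma cov_combination_disjoint:
  assumes "finite I" "finite J" "I \<inter> J = {}"
  shows "cov (combination I a) (combination J b) = 0"
  unfolding cov_combination inner_combination[OF assms(1)]
  using assms(3) by (intro sum.neutral) auto

lemma cov_combination_self:
  "finite I \<Longrightarrow> cov (combination I a) (combination I a) = (\<Sum>i\<in>I. w i * (a i)\<^sup>2)"
  unfolding cov_combination inner_combination by (simp add: inner_combination power2_eq_square mult_ac)

context
  fixes S S' :: "'a \<Rightarrow> 'a"
  assumes S_borel: "S \<in> borel_measurable borel"
    and adjoint: "\<And>f \<phi>. f \<bullet> S \<phi> = S' f \<bullet> \<phi>"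
    and ac: "absolutely_continuous \<mu> (distr \<mu> borel S)"
begin

lemma adjoint_scaleR: "S' (c *\<^sub>R f) = c *\<^sub>R S' f"
proof -
  have "S' (c *\<^sub>R f) \<bullet> \<phi> = (c *\<^sub>R S' f) \<bullet> \<phi>" for \<phi>
    using adjoint[of f \<phi>] adjoint[of "c *\<^sub>R f" \<phi>] by simp
  then show ?thesis using vector_eq_rdot[of "S' (c *\<^sub>R f)" "c *\<^sub>R S' f"] by blast
qed

text \<open>This is the part of the Feldman-Hajek theorem that is needed: otherwise there are
  functionals that are independent under \<open>\<mu>\<close> and whose variances under the image measure
  exceed those under \<open>\<mu>\<close> by a fixed factor.\<close>

lemma asymptotic_contraction:
  assumes "\<epsilon> > 0"
  obtains N where "finite N"
    "\<And>I a. finite I \<Longrightarrow> I \<inter> N = {} \<Longrightarrow>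
      cov (S' (combination I a)) (S' (combination I a)) \<le> (1 + \<epsilon>) * (\<Sum>i\<in>I. w i * (a i)\<^sup>2)"
proof (rule ccontr)
  assume neg: "\<not> thesis"
  define bad where "bad I a \<longleftrightarrow>
    cov (S' (combination I a)) (S' (combination I a)) > (1 + \<epsilon>) * (\<Sum>i\<in>I. w i * (a i)\<^sup>2)" for I a
  have "\<forall>N. \<exists>I a. finite N \<longrightarrow> finite I \<and> I \<inter> N = {} \<and> bad I a"
    using neg that unfolding bad_def by (metis not_le_imp_less)
  then obtain II aa where II: "\<And>N. finite N \<Longrightarrow> finite (II N) \<and> II N \<inter> N = {} \<and> bad (II N) (aa N)"
    by metis
  \<comment> \<open>Greedy choice: \<open>NN k\<close> collects all indices used so far, and the
    next bad combination avoids them. Disjoint supports make the functionals uncorrelated.\<close>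
  define NN where "NN = rec_nat {} (\<lambda>_ N. N \<union> II N)"
  have NN: "NN 0 = {}" "NN (Suc k) = NN k \<union> II (NN k)" for k by (simp_all add: NN_def)
  have finNN: "finite (NN k)" for k by (induction k) (auto simp: NN II)
  define J where "J k = II (NN k)" for k
  define b where "b k = aa (NN k)" for k
  have J: "finite (J k)" "J k \<inter> NN k = {}" "bad (J k) (b k)" for k
    using II[OF finNN[of k]] by (auto simp: J_def b_def)
  have mono: "NN j \<subseteq> NN k" if "j \<le> k" for j k
    using that by (induction k rule: dec_induct) (auto simp: NN)
  have disj: "J j \<inter> J k = {}" if "j < k" for j k
    using mono[of "Suc j" k] that J(2)[of k] by (auto simp: NN J_def)
  have disj': "J j \<inter> J k = {}" if "j \<noteq> k" for j k
    using disj[of j k] disj[of k j] that by (cases "j < k") auto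
  define q where "q k = (\<Sum>i\<in>J k. w i * (b k i)\<^sup>2)" for k
  define g where "g k = combination (J k) (b k)" for k
  \<comment> \<open>A bad combination is nonzero: its strict inequality would otherwise read 0 > 0.
    Hence it can be normalised to unit variance.\<close>
  have q: "q k > 0" for k
  proof (rule ccontr)
    assume "\<not> q k > 0"
    moreover have "q k \<ge> 0" unfolding q_def by (intro sum_nonneg) (simp add: w_pos less_imp_le)
    ultimately have "q k = 0" by simp
    then have "\<forall>i\<in>J k. w i * (b k i)\<^sup>2 = 0"
      unfolding q_def using w_pos J(1) by (subst (asm) sum_nonneg_eq_0_iff) (auto simp: less_imp_le)
    moreover have "w i \<noteq> 0" for i using w_pos[of i] by simp
    ultimately have "\<forall>i\<in>J k. b k i = 0" by simp
    then have "g k = 0" by (simp add: g_def combination_def)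
    then have "S' (g k) = 0" using adjoint_scaleR[of 0 0] by simp
    then show False using J(3)[of k] \<open>q k = 0\<close> by (simp add: bad_def g_def[symmetric] q_def[symmetric])
  qed
  define f where "f k = (1 / sqrt (q k)) *\<^sub>R g k" for k
  have gg: "cov (g k) (g k) = q k" for k
    unfolding g_def q_def by (rule cov_combination_self[OF J(1)])
  have orth: "cov (f j) (f k) = (if j = k then 1 else 0)" for j k
  proof (cases "j = k")
    case True
    then show ?thesis using q[of k]
      by (simp add: f_def cov_scaleR_left cov_scaleR_right gg)
  next
    case False
    then show ?thesis unfolding f_def g_def
      by (simp add: cov_scaleR_left cov_scaleR_right cov_combination_disjoint[OF J(1) J(1) disj'])
  qed
  have S_meas [measurable]: "S \<in> measurable \<mu> borel" using S_borel by (simp cong: measurable_cong_sets)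
  have "\<not> absolutely_continuous \<mu> (distr \<mu> borel S)"
  proof (rule not_absolutely_continuousI[OF orth, where c = "exp (- (1 + \<epsilon>) / 2)"])
    show "prob_space (distr \<mu> borel S)" by (rule prob_space_distr) (rule S_meas)
    show "exp (- (1 + \<epsilon>) / 2) < exp (- 1 / 2)" using assms by simp
    show "(LINT \<phi>|distr \<mu> borel S. cos (f k \<bullet> \<phi>)) \<le> exp (- (1 + \<epsilon>) / 2)" for k
    proof -
      have m: "(\<lambda>\<phi>. cos (f k \<bullet> \<phi>)) \<in> borel_measurable borel"
        by (intro borel_measurable_continuous_onI continuous_intros)
      have "(LINT \<phi>|distr \<mu> borel S. cos (f k \<bullet> \<phi>)) = exp (- cov (S' (f k)) (S' (f k)) / 2)"
        by (subst integral_distr[OF S_meas m]) (simp add: adjoint expectation_cos)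
      moreover have "1 + \<epsilon> \<le> cov (S' (f k)) (S' (f k))"
        using J(3)[of k] q[of k]
        by (simp add: bad_def f_def adjoint_scaleR cov_scaleR_left cov_scaleR_right g_def[symmetric]
          q_def[symmetric] field_simps)
      ultimately show ?thesis by simp
    qed
  qed simp
  then show False using ac by simp
qed

text \<open>Duality between the norms with weights \<open>w\<close> and \<open>1 / w\<close>: test
  \<open>S (e k)\<close> against the functional that realises its dual norm over \<open>J\<close>,
  and apply Cauchy-Schwarz to \<open>cov\<close>. The set \<open>N\<close> does not depend on
  \<open>k\<close>.\<close>

lemma dual_asymptotic_contraction:
  assumes "\<epsilon> > 0"
  obtains N where "finite N"
    "\<And>k J. finite J \<Longrightarrow> J \<inter> N = {} \<Longrightarrow> (\<Sum>m\<in>J. (S (e k) \<bullet> e m)\<^sup>2 / w m) \<le> (1 + \<epsilon>) / w k"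
proof -
  obtain N where N: "finite N" "\<And>I a. finite I \<Longrightarrow> I \<inter> N = {} \<Longrightarrow>
      cov (S' (combination I a)) (S' (combination I a)) \<le> (1 + \<epsilon>) * (\<Sum>i\<in>I. w i * (a i)\<^sup>2)"
    using asymptotic_contraction[OF assms] by blast
  have "(\<Sum>m\<in>J. (S (e k) \<bullet> e m)\<^sup>2 / w m) \<le> (1 + \<epsilon>) / w k" if J: "finite J" "J \<inter> N = {}" for k J
  proof -
    define Q where "Q = (\<Sum>m\<in>J. (S (e k) \<bullet> e m)\<^sup>2 / w m)"
    define a where "a m = (S (e k) \<bullet> e m) / w m" for m
    define f where "f = combination J a"
    have Q0: "Q \<ge> 0" unfolding Q_def by (intro sum_nonneg) (simp add: w_pos less_imp_le)
    have wne: "w m \<noteq> 0" for m using w_pos[of m] by simp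
    have "(\<Sum>m\<in>J. w m * (a m)\<^sup>2) = Q"
      unfolding Q_def a_def using wne by (intro sum.cong) (auto simp: power2_eq_square field_simps)
    then have 1: "cov (S' f) (S' f) \<le> (1 + \<epsilon>) * Q"
      using N(2)[OF J, of a] by (simp add: f_def)
    have "f \<bullet> S (e k) = Q"
      unfolding f_def combination_def Q_def a_def inner_sum_left
      by (intro sum.cong) (auto simp: power2_eq_square inner_commute)
    then have "cov (S' f) (e k) = w k * Q" by (simp add: cov_basis adjoint[symmetric])
    moreover have "cov (e k) (e k) = w k" by (simp add: cov_basis orthonormal)
    ultimately have "(w k * Q)\<^sup>2 \<le> (1 + \<epsilon>) * Q * w k"
      using cov_Cauchy_Schwarz[of "S' f" "e k"] mult_right_mono[OF 1 less_imp_le[OF w_pos[of k]]]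
      by simp
    then have "(w k * Q) * (w k * Q) \<le> (1 + \<epsilon>) * (w k * Q)"
      by (simp add: power2_eq_square mult_ac)
    then have "w k * Q \<le> 1 + \<epsilon>"
    proof (cases "Q = 0")
      case False
      then have "0 < w k * Q" using Q0 w_pos[of k] by simp
      with \<open>(w k * Q) * (w k * Q) \<le> (1 + \<epsilon>) * (w k * Q)\<close> show ?thesis
        by (rule mult_right_le_imp_le)
    qed (use assms in simp)
    then show ?thesis unfolding Q_def[symmetric] using w_pos[of k] by (simp add: field_simps)
  qed
  with N(1) that show ?thesis by blast
qed

text \<open>By Jensen's inequality, the asymptotic bound passes from the norm with weights
  \<open>v powr \<alpha>\<close> to the one with weights \<open>v\<close>.\<close>

lemma energy_bound:
  fixes v :: "'i \<Rightarrow> real"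
  assumes iso: "\<And>k. norm (S (e k)) \<le> 1" and w: "\<And>i. w i = v i powr (- \<alpha>)" and v: "\<And>i. v i \<ge> 1"
    and "\<alpha> > 1" and "\<epsilon> > 0"
  obtains R where "\<And>k J. finite J \<Longrightarrow> v k \<ge> R \<Longrightarrow>
    (\<Sum>m\<in>J. v m * (S (e k) \<bullet> e m)\<^sup>2) \<le> (1 + \<epsilon>) * v k"
proof -
  \<comment> \<open>One half of \<open>\<epsilon>\<close> pays for the asymptotic contraction, the
    other half for the exceptional set \<open>N\<close>.\<close>
  have e2: "\<epsilon> / 2 > 0" using \<open>\<epsilon> > 0\<close> by simp
  obtain N where N: "finite N"
    "\<And>k J. finite J \<Longrightarrow> J \<inter> N = {} \<Longrightarrow> (\<Sum>m\<in>J. (S (e k) \<bullet> e m)\<^sup>2 / w m) \<le> (1 + \<epsilon> / 2) / w k"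
    using dual_asymptotic_contraction[OF e2] by blast
  \<comment> \<open>The coefficients on \<open>N\<close> are at most 1 in square, so
    \<open>C\<close> bounds their energy for all \<open>k\<close>; it is absorbed once
    \<open>v k \<ge> 2 * C / \<epsilon>\<close>.\<close>
  define C where "C = (\<Sum>m\<in>N. v m)"
  have C0: "C \<ge> 0" unfolding C_def using v by (intro sum_nonneg) (auto intro: order_trans[of 0 1])
  have "(\<Sum>m\<in>J. v m * (S (e k) \<bullet> e m)\<^sup>2) \<le> (1 + \<epsilon>) * v k" if J: "finite J" and k: "v k \<ge> 2 * C / \<epsilon>" for k J
  proof -
    define p where "p m = (S (e k) \<bullet> e m)\<^sup>2" for m
    define c where "c = v k"
    have c: "c > 0" using v[of k] by (simp add: c_def)
    have p0: "p m \<ge> 0" for m by (simp add: p_def)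
    \<comment> \<open>By Bessel's inequality and \<open>iso\<close>, \<open>p\<close> is a
      distribution of total mass at most 1 on the frequencies.\<close>
    have mass: "(\<Sum>m\<in>K. p m) \<le> 1" if "finite K" for K
    proof -
      have "(norm (S (e k)))\<^sup>2 \<le> 1" using iso[of k] by (simp add: abs_square_le_1)
      then show ?thesis using bessel_inequality[OF that, of "S (e k)"] by (simp add: p_def)
    qed
    have low: "(\<Sum>m\<in>J \<inter> N. v m * p m) \<le> C"
    proof -
      have "p m \<le> 1" for m using mass[of "{m}"] by simp
      then have "v m * p m \<le> v m" for m using v[of m] by (simp add: mult_left_le)
      then have "(\<Sum>m\<in>J \<inter> N. v m * p m) \<le> (\<Sum>m\<in>J \<inter> N. v m)" by (intro sum_mono)
      also have "\<dots> \<le> C" unfolding C_def using N(1) v by (intro sum_mono2) (auto intro: order_trans[of 0 1])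
      finally show ?thesis .
    qed
    \<comment> \<open>Linearised Jensen: the right-hand side is the tangent at
      \<open>v m = c\<close> of the concave power \<open>1 / \<alpha>\<close>, taken in the variable
      \<open>v m powr \<alpha>\<close>. In this form it can be summed over any part of the
      frequencies, here \<open>J - N\<close>.\<close>
    have young: "v m \<le> c * (1 - 1 / \<alpha>) + c powr (1 - \<alpha>) / \<alpha> * (v m powr \<alpha>)" for m
    proof -
      have y: "v m / c \<ge> 0" using v[of m] c by simp
      have "v m / c * 1 \<le> (v m / c) powr \<alpha> / \<alpha> + 1 powr (\<alpha> / (\<alpha> - 1)) / (\<alpha> / (\<alpha> - 1))"
        by (rule Youngs_inequality) (use \<open>\<alpha> > 1\<close> y in \<open>auto simp: field_simps\<close>)
      also have "\<dots> = (v m / c) powr \<alpha> / \<alpha> + (1 - 1 / \<alpha>)" using \<open>\<alpha> > 1\<close> by (simp add: field_simps)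
      finally have "v m \<le> c * ((v m / c) powr \<alpha> / \<alpha> + (1 - 1 / \<alpha>))"
        using c by (simp add: field_simps)
      also have "\<dots> = c * (1 - 1 / \<alpha>) + c * (v m / c) powr \<alpha> / \<alpha>" by (simp add: algebra_simps)
      also have "c * (v m / c) powr \<alpha> = c powr (1 - \<alpha>) * v m powr \<alpha>"
        using c v[of m] by (simp add: powr_divide powr_diff)
      finally show ?thesis by simp
    qed
    have winv: "v m powr \<alpha> = 1 / w m" for m using v[of m] by (simp add: w powr_minus_divide)
    have high: "(\<Sum>m\<in>J - N. v m * p m) \<le> c * (1 + \<epsilon> / 2)"
    proof -
      have "(\<Sum>m\<in>J - N. v m * p m) \<le>
          (\<Sum>m\<in>J - N. (c * (1 - 1 / \<alpha>) + c powr (1 - \<alpha>) / \<alpha> * (v m powr \<alpha>)) * p m)"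
        by (intro sum_mono mult_right_mono young p0)
      also have "\<dots> = c * (1 - 1 / \<alpha>) * (\<Sum>m\<in>J - N. p m) +
          c powr (1 - \<alpha>) / \<alpha> * (\<Sum>m\<in>J - N. p m / w m)"
        unfolding sum_distrib_left sum.distrib[symmetric] winv
        by (intro sum.cong refl) (simp add: distrib_right)
      also have "\<dots> \<le> c * (1 - 1 / \<alpha>) * 1 + c powr (1 - \<alpha>) / \<alpha> * ((1 + \<epsilon> / 2) / w k)"
        using J \<open>\<alpha> > 1\<close> c N(2)[of "J - N" k]
        by (intro add_mono mult_left_mono mass) (auto simp: p_def)
      also have "\<dots> = c * (1 - 1 / \<alpha>) + c * (1 + \<epsilon> / 2) / \<alpha>"
      proof -
        have "(1 + \<epsilon> / 2) / w k = (1 + \<epsilon> / 2) * c powr \<alpha>" using winv[of k] by (simp add: c_def)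
        moreover have "c powr (1 - \<alpha>) * c powr \<alpha> = c" using c by (simp flip: powr_add)
        moreover have "c powr (1 - \<alpha>) / \<alpha> * ((1 + \<epsilon> / 2) * c powr \<alpha>) =
            (c powr (1 - \<alpha>) * c powr \<alpha>) * (1 + \<epsilon> / 2) / \<alpha>" by (simp add: mult_ac)
        ultimately show ?thesis by (simp only:)
      qed
      also have "\<dots> = c * (1 + (\<epsilon> / 2) / \<alpha>)"
        by (simp add: right_diff_distrib distrib_left add_divide_distrib)
      also have "\<dots> \<le> c * (1 + \<epsilon> / 2)"
        using c \<open>\<alpha> > 1\<close> \<open>\<epsilon> > 0\<close> by (intro mult_left_mono add_left_mono) (auto simp: field_simps)
      finally show ?thesis .
    qed
    have "(\<Sum>m\<in>J. v m * p m) = (\<Sum>m\<in>J \<inter> N. v m * p m) + (\<Sum>m\<in>J - N. v m * p m)"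
      using J by (subst sum.union_disjoint[symmetric]) (auto intro!: sum.cong)
    also have "\<dots> \<le> C + c * (1 + \<epsilon> / 2)" using low high by simp
    also have "C \<le> c * (\<epsilon> / 2)" using k \<open>\<epsilon> > 0\<close> by (simp add: c_def field_simps)
    finally show ?thesis by (simp add: p_def c_def algebra_simps)
  qed
  then show ?thesis using that by blast
qed

end

end

section \<open>Measures on inner product spaces are determined by their characteristic functionals\<close>

text \<open>The normalised weight \<open>W / c\<close> makes the weighted law of \<open>X\<close> a
  probability measure on the line, where Levy's uniqueness theorem is at hand.\<close>

lemma char_density_distr:
  fixes X :: "'x \<Rightarrow> real"
  assumes "prob_space \<mu>" and [measurable]: "X \<in> borel_measurable \<mu>" "W \<in> borel_measurable \<mu>"
    and W: "\<And>\<phi>. 0 \<le> W \<phi>" "\<And>\<phi>. W \<phi> \<le> B" and c: "c = (LINT \<phi>|\<mu>. W \<phi>)" "c > 0"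
  defines "M \<equiv> distr (density \<mu> (\<lambda>\<phi>. ennreal (W \<phi> / c))) borel X"
  shows "real_distribution M"
    and "char M t = Complex ((LINT \<phi>|\<mu>. W \<phi> * cos (t * X \<phi>)) / c) ((LINT \<phi>|\<mu>. W \<phi> * sin (t * X \<phi>)) / c)"
    and "A \<in> sets borel \<Longrightarrow> measure M A = (LINT \<phi>|\<mu>. W \<phi> * indicator A (X \<phi>)) / c"
proof -
  interpret prob_space \<mu> by fact
  have int: "integrable \<mu> (\<lambda>\<phi>. W \<phi> * g \<phi>)" if [measurable]: "g \<in> borel_measurable \<mu>" and "\<And>\<phi>. \<bar>g \<phi>\<bar> \<le> 1" for g :: "'x \<Rightarrow> real"
  proof (rule integrable_const_bound[of _ B])
    show "AE \<phi> in \<mu>. norm (W \<phi> * g \<phi>) \<le> B"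
    proof (rule AE_I2)
      fix \<phi>
      have "\<bar>W \<phi>\<bar> * \<bar>g \<phi>\<bar> \<le> B * 1" using W[of \<phi>] that(2)[of \<phi>] by (intro mult_mono) auto
      then show "norm (W \<phi> * g \<phi>) \<le> B" by (simp add: abs_mult)
    qed
  qed simp
  have Wi: "integrable \<mu> W" using int[of "\<lambda>_. 1"] by simp
  let ?D = "density \<mu> (\<lambda>\<phi>. ennreal (W \<phi> / c))"
  have D: "prob_space ?D"
  proof
    have "emeasure ?D (space ?D) = (\<integral>\<^sup>+\<phi>. ennreal (W \<phi> / c) \<partial>\<mu>)"
      by (subst emeasure_density) (auto intro!: nn_integral_cong)
    also have "\<dots> = ennreal (LINT \<phi>|\<mu>. W \<phi> / c)"
      using W c Wi by (intro nn_integral_eq_integral) auto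
    also have "\<dots> = 1" using c by simp
    finally show "emeasure ?D (space ?D) = 1" .
  qed
  interpret D: prob_space ?D by fact
  show "real_distribution M" unfolding M_def by (intro D.real_distribution_distr) simp
  have tr: "(LINT x|M. g x) = (LINT \<phi>|\<mu>. W \<phi> * g (X \<phi>)) / c" if [measurable]: "g \<in> borel_measurable borel" for g :: "real \<Rightarrow> real"
    unfolding M_def using W(1) c
    by (subst integral_distr, simp, simp, subst integral_density) auto
  have ci: "integrable M (\<lambda>x. iexp (t * x))" for t
  proof -
    interpret M: real_distribution M by fact
    show ?thesis by (rule M.integrable_const_bound[of _ 1]) auto
  qed
  have "Re (char M t) = (LINT x|M. cos (t * x))" "Im (char M t) = (LINT x|M. sin (t * x))"
    unfolding char_def using ci[of t] by (simp_all add: Re_exp Im_exp flip: integral_Re integral_Im)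
  then show "char M t = Complex ((LINT \<phi>|\<mu>. W \<phi> * cos (t * X \<phi>)) / c) ((LINT \<phi>|\<mu>. W \<phi> * sin (t * X \<phi>)) / c)"
    by (simp add: complex_eq_iff tr)
  assume [measurable]: "A \<in> sets borel"
  have "A \<inter> space M = A" by (simp add: M_def)
  then have "measure M A = (LINT x|M. indicator A x)" by simp
  then show "measure M A = (LINT \<phi>|\<mu>. W \<phi> * indicator A (X \<phi>)) / c"
    by (subst (asm) tr) simp_all
qed

text \<open>One coordinate at a time: \<open>X\<close> is the coordinate whose trigonometric tests
  are exchanged for indicators, and \<open>W\<close> carries everything else.\<close>

lemma weighted_Levy_uniqueness:
  fixes X :: "'x \<Rightarrow> real"
  assumes \<mu>: "prob_space \<mu>" and \<nu>: "prob_space \<nu>" and sets: "sets \<mu> = sets \<nu>"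
    and m: "X \<in> borel_measurable \<mu>" "W \<in> borel_measurable \<mu>"
    and W: "\<And>\<phi>. 0 \<le> W \<phi>" "\<And>\<phi>. W \<phi> \<le> B"
    and cos: "\<And>t. (LINT \<phi>|\<mu>. W \<phi> * cos (t * X \<phi>)) = (LINT \<phi>|\<nu>. W \<phi> * cos (t * X \<phi>))"
    and sin: "\<And>t. (LINT \<phi>|\<mu>. W \<phi> * sin (t * X \<phi>)) = (LINT \<phi>|\<nu>. W \<phi> * sin (t * X \<phi>))"
    and A: "A \<in> sets borel"
  shows "(LINT \<phi>|\<mu>. W \<phi> * indicator A (X \<phi>)) = (LINT \<phi>|\<nu>. W \<phi> * indicator A (X \<phi>))"
proof -
  define c where "c = (LINT \<phi>|\<mu>. W \<phi>)"
  have c': "c = (LINT \<phi>|\<nu>. W \<phi>)" using cos[of 0] by (simp add: c_def)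
  have m': "X \<in> borel_measurable \<nu>" "W \<in> borel_measurable \<nu>"
    using m sets by (simp_all cong: measurable_cong_sets)
  \<comment> \<open>A weight of total mass 0 cannot be normalised, but then it vanishes almost
    everywhere.\<close>
  have zero: "(LINT \<phi>|\<rho>. W \<phi> * indicator A (X \<phi>)) = 0" if "prob_space \<rho>" "W \<in> borel_measurable \<rho>" "(LINT \<phi>|\<rho>. W \<phi>) = 0" for \<rho>
  proof -
    interpret prob_space \<rho> by fact
    have "integrable \<rho> W"
      by (rule integrable_const_bound[of _ B]) (use W that in auto)
    then have "AE \<phi> in \<rho>. W \<phi> = 0"
      using that(3) W integral_nonneg_eq_0_iff_AE by blast
    then have "AE \<phi> in \<rho>. W \<phi> * indicator A (X \<phi>) = 0" by eventually_elim simp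
    then show ?thesis by (rule integral_eq_zero_AE)
  qed
  show ?thesis
  proof (cases "c > 0")
    case True
    note M = char_density_distr[OF \<mu> m W c_def True]
    note N = char_density_distr[OF \<nu> m' W c' True]
    have "distr (density \<mu> (\<lambda>\<phi>. ennreal (W \<phi> / c))) borel X = distr (density \<nu> (\<lambda>\<phi>. ennreal (W \<phi> / c))) borel X"
      by (rule Levy_uniqueness[OF M(1) N(1)]) (simp add: fun_eq_iff M(2) N(2) cos sin)
    then show ?thesis using M(3)[OF A] N(3)[OF A] True by simp
  next
    case False
    moreover have "c \<ge> 0" unfolding c_def using W by simp
    ultimately have "c = 0" by simp
    then show ?thesis using zero[OF \<mu> m(2)] zero[OF \<nu> m'(2)] c_def c' by simp
  qed
qed

section \<open>Cylinder sets\<close>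

context orthonormal_basis
begin

text \<open>A list of conditions, in which indices may repeat: the intersection of two cylinders is
  the cylinder of the concatenated lists.\<close>

definition cylinder :: "('i \<times> real set) list \<Rightarrow> 'a set" where
  "cylinder L = {\<phi>. \<forall>(i, A)\<in>set L. e i \<bullet> \<phi> \<in> A}"

lemma cylinder_Cons: "cylinder ((i, A) # L) = {\<phi>. e i \<bullet> \<phi> \<in> A} \<inter> cylinder L"
  by (auto simp: cylinder_def)

lemma inner_measurable_borel [measurable]: "(\<lambda>\<phi>. h \<bullet> \<phi>) \<in> borel_measurable borel"
  by (intro borel_measurable_continuous_onI continuous_intros)

lemma cylinder_borel:
  "(\<And>i A. (i, A) \<in> set L \<Longrightarrow> A \<in> sets borel) \<Longrightarrow> cylinder L \<in> sets borel"
proof (induction L)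
  case (Cons p L)
  obtain i A where p: "p = (i, A)" by force
  have [measurable]: "A \<in> sets borel" "cylinder L \<in> sets borel" using Cons p by auto
  have "{\<phi> \<in> space borel. e i \<bullet> \<phi> \<in> A} \<in> sets borel" by measurable
  then show ?case unfolding p cylinder_Cons by (intro sets.Int) (auto intro: Cons p)
qed (simp add: cylinder_def)

text \<open>Induction on the list, with the claim strengthened to integrals of
  \<open>cos (h \<bullet> \<phi>)\<close> and \<open>sin (h \<bullet> \<phi>)\<close> over the
  cylinder for all \<open>h\<close> in the span. A new condition enters through
  \<open>weighted_Levy_uniqueness\<close>; as weights must be nonnegative, \<open>1 + cos\<close>
  and \<open>1 + sin\<close> are used and the constant part is subtracted afterwards.\<close>

lemma measure_cylinder_eq:
  fixes \<mu> \<nu> :: "'a measure"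
  assumes \<mu>: "prob_space \<mu>" "sets \<mu> = sets borel" and \<nu>: "prob_space \<nu>" "sets \<nu> = sets borel"
    and cos: "\<And>h. h \<in> span (range e) \<Longrightarrow> (LINT \<phi>|\<mu>. cos (h \<bullet> \<phi>)) = (LINT \<phi>|\<nu>. cos (h \<bullet> \<phi>))"
    and sin: "\<And>h. h \<in> span (range e) \<Longrightarrow> (LINT \<phi>|\<mu>. sin (h \<bullet> \<phi>)) = (LINT \<phi>|\<nu>. sin (h \<bullet> \<phi>))"
    and L: "\<And>i A. (i, A) \<in> set L \<Longrightarrow> A \<in> sets borel"
  shows "measure \<mu> (cylinder L) = measure \<nu> (cylinder L)"
proof -
  interpret M: prob_space \<mu> by fact
  interpret N: prob_space \<nu> by fact
  note [measurable_cong] = \<mu>(2) \<nu>(2)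
  have mc: "f \<in> borel_measurable \<mu>" "f \<in> borel_measurable \<nu>" if "f \<in> borel_measurable borel" for f :: "'a \<Rightarrow> real"
    using that by (simp_all cong: measurable_cong_sets add: \<mu>(2) \<nu>(2))
  have bi: "integrable \<mu> f" "integrable \<nu> f" if "f \<in> borel_measurable borel" "\<And>x. \<bar>f x\<bar> \<le> B" for f :: "'a \<Rightarrow> real" and B
  proof -
    show "integrable \<mu> f" by (rule M.integrable_const_bound[of _ B]) (simp_all add: mc that)
    show "integrable \<nu> f" by (rule N.integrable_const_bound[of _ B]) (simp_all add: mc that)
  qed
  define same where "same g \<longleftrightarrow> (LINT \<phi>|\<mu>. g \<phi>) = (LINT \<phi>|\<nu>. g \<phi>)" for g :: "'a \<Rightarrow> real"
  have same_lin: "same (\<lambda>\<phi>. f \<phi> + c * g \<phi>)" if "same f" "same g" "f \<in> borel_measurable borel" "g \<in> borel_measurable borel"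
     "\<And>x. \<bar>f x\<bar> \<le> B" "\<And>x. \<bar>g x\<bar> \<le> C" for f g c B C
    using that(1,2) bi[OF that(3,5)] bi[OF that(4,6)] unfolding same_def by simp
  have "\<forall>h\<in>span (range e). same (\<lambda>\<phi>. indicator (cylinder L) \<phi> * cos (h \<bullet> \<phi>)) \<and>
      same (\<lambda>\<phi>. indicator (cylinder L) \<phi> * sin (h \<bullet> \<phi>))"
    using L
  proof (induction L)
    case Nil
    then show ?case using cos sin by (simp add: cylinder_def same_def)
  next
    case (Cons p L)
    obtain i A where p: "p = (i, A)" by force
    have A [measurable]: "A \<in> sets borel" and cyl [measurable]: "cylinder L \<in> sets borel"
      using Cons.prems p by (auto intro!: cylinder_borel)
    define W :: "'a \<Rightarrow> real" where "W = indicator (cylinder L)"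
    have [measurable]: "W \<in> borel_measurable borel" unfolding W_def by simp
    have W01: "0 \<le> W \<phi>" "W \<phi> \<le> 1" for \<phi> by (auto simp: W_def indicator_def)
    have IHc: "same (\<lambda>\<phi>. W \<phi> * cos (h \<bullet> \<phi>))" and IHs: "same (\<lambda>\<phi>. W \<phi> * sin (h \<bullet> \<phi>))" if "h \<in> span (range e)" for h
      using Cons.IH Cons.prems that unfolding W_def by auto
    have Wb: "\<bar>W \<phi> * cos x\<bar> \<le> 1" "\<bar>W \<phi> * sin x\<bar> \<le> 1" for \<phi> x
      using W01[of \<phi>] mult_mono[of "\<bar>W \<phi>\<bar>" 1 "\<bar>cos x\<bar>" 1] mult_mono[of "\<bar>W \<phi>\<bar>" 1 "\<bar>sin x\<bar>" 1]
      by (auto simp: abs_mult)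
    have ei: "e i \<in> span (range e)" by (simp add: span_base)
    have sh: "h + t *\<^sub>R e i \<in> span (range e)" "h - t *\<^sub>R e i \<in> span (range e)" "t *\<^sub>R e i \<in> span (range e)"
      if "h \<in> span (range e)" for h t
      using that ei by (auto intro: span_add span_diff span_scale)
    \<comment> \<open>Product-to-sum formulas turn each product into a combination of trigonometric
      tests at \<open>h + t *\<^sub>R e i\<close>, \<open>h - t *\<^sub>R e i\<close> and
      \<open>t *\<^sub>R e i\<close>, which the induction hypothesis covers.\<close>
    have product: "same (\<lambda>\<phi>. W \<phi> * (1 + f (h \<bullet> \<phi>)) * g (t * (e i \<bullet> \<phi>)))"
      if h: "h \<in> span (range e)" and f: "f = cos \<or> f = sin" and g: "g = cos \<or> g = sin" for h t and f g :: "real \<Rightarrow> real"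
    proof -
      have id: "cos a * cos b = 1/2 * cos (a + b) + 1/2 * cos (a - b)"
        "cos a * sin b = 1/2 * sin (a + b) + (-1/2) * sin (a - b)"
        "sin a * cos b = 1/2 * sin (a + b) + 1/2 * sin (a - b)"
        "sin a * sin b = (-1/2) * cos (a + b) + 1/2 * cos (a - b)" for a b :: real
        by (simp_all add: cos_add cos_diff sin_add sin_diff field_simps)
      have ip: "(h + t *\<^sub>R e i) \<bullet> \<phi> = h \<bullet> \<phi> + t * (e i \<bullet> \<phi>)" "(h - t *\<^sub>R e i) \<bullet> \<phi> = h \<bullet> \<phi> - t * (e i \<bullet> \<phi>)"
        "(t *\<^sub>R e i) \<bullet> \<phi> = t * (e i \<bullet> \<phi>)" for \<phi>
        by (simp_all add: inner_add_left inner_diff_left)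
      have lin2: "same (\<lambda>\<phi>. (W \<phi> * k1 (t * (e i \<bullet> \<phi>)) + c1 * (W \<phi> * k2 (h \<bullet> \<phi> + t * (e i \<bullet> \<phi>))))
          + c2 * (W \<phi> * k2 (h \<bullet> \<phi> - t * (e i \<bullet> \<phi>))))"
        if k: "k1 = cos \<or> k1 = sin" "k2 = cos \<or> k2 = sin" for k1 k2 :: "real \<Rightarrow> real" and c1 c2
      proof -
        have mk: "k1 \<in> borel_measurable borel" "k2 \<in> borel_measurable borel"
          using k by (auto intro!: borel_measurable_continuous_onI continuous_intros)
        note [measurable] = measurable_compose[OF _ mk(1)] measurable_compose[OF _ mk(2)]
        have kb: "\<bar>W \<phi> * k1 x\<bar> \<le> 1" "\<bar>W \<phi> * k2 x\<bar> \<le> 1" for \<phi> x using k Wb by auto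
        show ?thesis
        proof (rule same_lin[of _ _ "1 + \<bar>c1\<bar>" 1], rule same_lin[of _ _ 1 1])
          show "same (\<lambda>\<phi>. W \<phi> * k1 (t * (e i \<bullet> \<phi>)))"
            using k(1) IHc[OF sh(3)[OF h], of t] IHs[OF sh(3)[OF h], of t] by (auto simp: ip)
          show "same (\<lambda>\<phi>. W \<phi> * k2 (h \<bullet> \<phi> + t * (e i \<bullet> \<phi>)))"
            using k(2) IHc[OF sh(1)[OF h], of t] IHs[OF sh(1)[OF h], of t] by (auto simp: ip)
          show "same (\<lambda>\<phi>. W \<phi> * k2 (h \<bullet> \<phi> - t * (e i \<bullet> \<phi>)))"
            using k(2) IHc[OF sh(2)[OF h], of t] IHs[OF sh(2)[OF h], of t] by (auto simp: ip)
          show "\<bar>W x * k1 (t * (e i \<bullet> x)) + c1 * (W x * k2 (h \<bullet> x + t * (e i \<bullet> x)))\<bar> \<le> 1 + \<bar>c1\<bar>" for x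
          proof -
            have "\<bar>c1 * (W x * k2 (h \<bullet> x + t * (e i \<bullet> x)))\<bar> \<le> \<bar>c1\<bar> * 1"
              unfolding abs_mult[of c1] by (intro mult_left_mono kb) simp
            then show ?thesis using kb(1)[of x "t * (e i \<bullet> x)"] by linarith
          qed
        qed (auto simp: kb)
      qed
      from f g show ?thesis
      proof (elim disjE)
        assume "f = cos" "g = cos"
        then show ?thesis using lin2[of cos cos "1/2" "1/2"] by (simp add: algebra_simps id)
      next
        assume "f = cos" "g = sin"
        then show ?thesis using lin2[of sin sin "1/2" "-1/2"] by (simp add: algebra_simps id)
      next
        assume "f = sin" "g = cos"
        then show ?thesis using lin2[of cos sin "1/2" "1/2"] by (simp add: algebra_simps id)
      next
        assume "f = sin" "g = sin"
        then show ?thesis using lin2[of sin cos "-1/2" "1/2"] by (simp add: algebra_simps id)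
      qed
    qed
    have step: "same (\<lambda>\<phi>. W \<phi> * (1 + f (h \<bullet> \<phi>)) * indicator A (e i \<bullet> \<phi>))"
      if h: "h \<in> span (range e)" and f: "f = cos \<or> f = sin" for h and f :: "real \<Rightarrow> real"
    proof -
      have mf: "f \<in> borel_measurable borel"
        using f by (auto intro!: borel_measurable_continuous_onI continuous_intros)
      note [measurable] = measurable_compose[OF _ mf]
      have fb: "- 1 \<le> f x" "f x \<le> 1" for x using f by auto
      show ?thesis unfolding same_def
      proof (rule weighted_Levy_uniqueness[OF \<mu>(1) \<nu>(1), where B = 2])
        show "0 \<le> W \<phi> * (1 + f (h \<bullet> \<phi>))" for \<phi> using W01[of \<phi>] fb[of "h \<bullet> \<phi>"] by simp
        show "W \<phi> * (1 + f (h \<bullet> \<phi>)) \<le> 2" for \<phi>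
          using W01[of \<phi>] fb[of "h \<bullet> \<phi>"] mult_mono[of "W \<phi>" 1 "1 + f (h \<bullet> \<phi>)" 2] by simp
        show "(\<lambda>\<phi>. e i \<bullet> \<phi>) \<in> borel_measurable \<mu>" "(\<lambda>\<phi>. W \<phi> * (1 + f (h \<bullet> \<phi>))) \<in> borel_measurable \<mu>"
          by (intro mc, measurable)+
        show "(LINT \<phi>|\<mu>. W \<phi> * (1 + f (h \<bullet> \<phi>)) * cos (t * (e i \<bullet> \<phi>))) =
            (LINT \<phi>|\<nu>. W \<phi> * (1 + f (h \<bullet> \<phi>)) * cos (t * (e i \<bullet> \<phi>)))" for t
          using product[OF h f, of cos t] by (simp add: same_def)
        show "(LINT \<phi>|\<mu>. W \<phi> * (1 + f (h \<bullet> \<phi>)) * sin (t * (e i \<bullet> \<phi>))) =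
            (LINT \<phi>|\<nu>. W \<phi> * (1 + f (h \<bullet> \<phi>)) * sin (t * (e i \<bullet> \<phi>)))" for t
          using product[OF h f, of sin t] by (simp add: same_def)
      qed (simp_all add: \<mu>(2) \<nu>(2) A)
    qed
    \<comment> \<open>At \<open>h = 0\<close> the weight \<open>1 + sin (h \<bullet> \<phi>)\<close>
      is the constant 1.\<close>
    have one: "same (\<lambda>\<phi>. W \<phi> * indicator A (e i \<bullet> \<phi>))"
      using step[of 0 sin] by (simp add: span_zero)
    have "same (\<lambda>\<phi>. indicator (cylinder (p # L)) \<phi> * f (h \<bullet> \<phi>))"
      if h: "h \<in> span (range e)" and f: "f = cos \<or> f = sin" for h and f :: "real \<Rightarrow> real"
    proof -
      have mf: "f \<in> borel_measurable borel"
        using f by (auto intro!: borel_measurable_continuous_onI continuous_intros)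
      note [measurable] = measurable_compose[OF _ mf]
      have fb: "- 1 \<le> f x" "f x \<le> 1" for x using f by auto
      have "same (\<lambda>\<phi>. W \<phi> * (1 + f (h \<bullet> \<phi>)) * indicator A (e i \<bullet> \<phi>) + (-1) * (W \<phi> * indicator A (e i \<bullet> \<phi>)))"
      proof (rule same_lin[of _ _ 2 1, OF step[OF h f] one])
        show "\<bar>W x * (1 + f (h \<bullet> x)) * indicator A (e i \<bullet> x)\<bar> \<le> 2" for x
          using fb[of "h \<bullet> x"] by (auto simp: W_def indicator_def)
        show "\<bar>W x * indicator A (e i \<bullet> x)\<bar> \<le> 1" for x by (auto simp: W_def indicator_def)
      qed measurable
      moreover have "W \<phi> * (1 + f (h \<bullet> \<phi>)) * indicator A (e i \<bullet> \<phi>) + (-1) * (W \<phi> * indicator A (e i \<bullet> \<phi>)) =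
          indicator (cylinder (p # L)) \<phi> * f (h \<bullet> \<phi>)" for \<phi>
        by (auto simp: W_def p cylinder_Cons indicator_def)
      ultimately show ?thesis by simp
    qed
    then show ?case by blast
  qed
  from bspec[OF this span_zero]
  have "same (\<lambda>\<phi>. indicator (cylinder L) \<phi>)" by simp
  moreover have "cylinder L \<in> sets borel" using L by (rule cylinder_borel)
  ultimately show ?thesis by (simp add: same_def \<mu>(2) \<nu>(2))
qed

lemma cylinder_append: "cylinder (L @ L') = cylinder L \<inter> cylinder L'"
  by (auto simp: cylinder_def)

text \<open>Indexed by lists, so that the set is countable when the basis is; its members serve as
  centres of balls.\<close>

definition rational_combinations :: "'a set" where
  "rational_combinations = range (\<lambda>L. \<Sum>(i, q)\<leftarrow>L. real_of_rat q *\<^sub>R e i)"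

lemma rational_combinations_dense: "closure rational_combinations = UNIV"
proof -
  let ?D = rational_combinations
  have zero: "0 \<in> ?D" unfolding rational_combinations_def by (rule range_eqI[of _ _ "[]"]) simp
  have add: "x + y \<in> ?D" if "x \<in> ?D" "y \<in> ?D" for x y
  proof -
    from that obtain L L' where "x = (\<Sum>(i, q)\<leftarrow>L. real_of_rat q *\<^sub>R e i)" "y = (\<Sum>(i, q)\<leftarrow>L'. real_of_rat q *\<^sub>R e i)"
      unfolding rational_combinations_def by blast
    then have "x + y = (\<Sum>(i, q)\<leftarrow>L @ L'. real_of_rat q *\<^sub>R e i)" by simp
    then show ?thesis unfolding rational_combinations_def by blast
  qed
  have add_closure: "x + y \<in> closure ?D" if x: "x \<in> closure ?D" and y: "y \<in> closure ?D" for x y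
  proof -
    from x obtain f where f: "\<And>n::nat. f n \<in> ?D" "f \<longlonglongrightarrow> x" by (auto simp: closure_sequential)
    from y obtain g where g: "\<And>n::nat. g n \<in> ?D" "g \<longlonglongrightarrow> y" by (auto simp: closure_sequential)
    show ?thesis unfolding closure_sequential
      by (rule exI[of _ "\<lambda>n. f n + g n"]) (simp add: add f g tendsto_add)
  qed
  have scale: "c *\<^sub>R e i \<in> closure ?D" for c i
    unfolding closure_approachable
  proof safe
    fix \<epsilon> :: real assume "\<epsilon> > 0"
    obtain q where q: "q \<in> \<rat>" "c < q" "q < c + \<epsilon>"
      using Rats_dense_in_real[of c "c + \<epsilon>"] \<open>\<epsilon> > 0\<close> by auto
    then obtain q' where q': "q = real_of_rat q'" by (auto elim: Rats_cases)
    have "q *\<^sub>R e i \<in> ?D" unfolding rational_combinations_def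
      by (rule range_eqI[of _ _ "[(i, q')]"]) (simp add: q')
    moreover have "dist (q *\<^sub>R e i) (c *\<^sub>R e i) < \<epsilon>"
      using q by (simp add: dist_norm norm_eq_sqrt_inner[of "e i"] orthonormal flip: scaleR_diff_left)
    ultimately show "\<exists>y\<in>?D. dist y (c *\<^sub>R e i) < \<epsilon>" by blast
  qed
  have "x \<in> closure ?D" if "x \<in> span (range e)" for x
    using that
  proof (induction rule: span_induct_alt)
    case base
    show ?case using zero closure_subset by blast
  next
    case (step c x y)
    then show ?case using scale add_closure by auto
  qed
  then have "closure (span (range e)) \<subseteq> closure ?D" by (intro closure_minimal) auto
  then show ?thesis using total by auto
qed

text \<open>Parseval's identity exhausts the norm by finite partial sums. The index sets form a
  countable family when the basis is countable, so balls lie in the sigma-algebra of the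
  coordinates.\<close>

lemma cball_eq_partial_sums:
  assumes "r \<ge> 0"
  shows "cball a r = (\<Inter>J\<in>{J. finite J \<and> J \<subseteq> UNIV}. {\<phi>. (\<Sum>i\<in>J. (e i \<bullet> \<phi> - e i \<bullet> a)\<^sup>2) \<le> r\<^sup>2})"
proof -
  have "dist a \<phi> \<le> r \<longleftrightarrow> (\<forall>J. finite J \<longrightarrow> (\<Sum>i\<in>J. (e i \<bullet> \<phi> - e i \<bullet> a)\<^sup>2) \<le> r\<^sup>2)" for \<phi>
  proof -
    have eq: "(\<Sum>i\<in>J. (e i \<bullet> \<phi> - e i \<bullet> a)\<^sup>2) = (\<Sum>i\<in>J. ((\<phi> - a) \<bullet> e i)\<^sup>2)" for J
      by (simp add: inner_commute[of "e _"] inner_diff_left)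
    have "dist a \<phi> \<le> r \<longleftrightarrow> (norm (\<phi> - a))\<^sup>2 \<le> r\<^sup>2"
      using abs_le_square_iff[of "norm (\<phi> - a)" r] assms by (simp add: dist_norm norm_minus_commute)
    also have "\<dots> \<longleftrightarrow> (\<forall>J. finite J \<longrightarrow> (\<Sum>i\<in>J. ((\<phi> - a) \<bullet> e i)\<^sup>2) \<le> r\<^sup>2)"
    proof
      assume "(norm (\<phi> - a))\<^sup>2 \<le> r\<^sup>2"
      then show "\<forall>J. finite J \<longrightarrow> (\<Sum>i\<in>J. ((\<phi> - a) \<bullet> e i)\<^sup>2) \<le> r\<^sup>2"
        using bessel_inequality[of _ "\<phi> - a"] order_trans by blast
    next
      assume *: "\<forall>J. finite J \<longrightarrow> (\<Sum>i\<in>J. ((\<phi> - a) \<bullet> e i)\<^sup>2) \<le> r\<^sup>2"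
      show "(norm (\<phi> - a))\<^sup>2 \<le> r\<^sup>2"
        by (rule has_sum_le_finite_sums[OF parseval]) (use * in auto)
    qed
    finally show ?thesis by (simp add: eq)
  qed
  then show ?thesis by auto
qed

text \<open>By separability an open set is a countable union of closed balls, each of which is
  measurable with respect to the coordinates.\<close>

lemma borel_eq_cylinders:
  assumes "countable (UNIV :: 'i set)"
  shows "sets borel = sigma_sets UNIV {cylinder L | L. \<forall>(i, A)\<in>set L. A \<in> sets borel}"
    (is "_ = sigma_sets UNIV ?E")
proof
  have EP: "?E \<subseteq> Pow UNIV" by simp
  define M where "M = sigma UNIV ?E"
  have M: "space M = UNIV" "sets M = sigma_sets UNIV ?E" by (simp_all add: M_def)
  have coord [measurable]: "(\<lambda>\<phi>. e i \<bullet> \<phi>) \<in> borel_measurable M" for i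
  proof (rule measurableI)
    fix A :: "real set" assume A: "A \<in> sets borel"
    have "(\<lambda>\<phi>. e i \<bullet> \<phi>) -` A \<inter> space M = cylinder [(i, A)]" by (auto simp: M cylinder_def)
    also have "\<dots> \<in> sets M" unfolding M(2) by (rule sigma_sets.Basic) (use A in force)
    finally show "(\<lambda>\<phi>. e i \<bullet> \<phi>) -` A \<inter> space M \<in> sets M" .
  qed simp
  have cball: "cball a r \<in> sets M" if "r \<ge> 0" for a r
    unfolding cball_eq_partial_sums[OF that]
  proof (rule sets.countable_INT'')
    show "countable {J :: 'i set. finite J \<and> J \<subseteq> UNIV}"
      by (rule countable_Collect_finite_subset[OF assms])
    show "UNIV \<in> sets M" using sets.top[of M] by (simp add: M)
    fix J :: "'i set"
    have "{\<phi> \<in> space M. (\<Sum>i\<in>J. (e i \<bullet> \<phi> - e i \<bullet> a)\<^sup>2) \<le> r\<^sup>2} \<in> sets M" by measurable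
    then show "{\<phi>. (\<Sum>i\<in>J. (e i \<bullet> \<phi> - e i \<bullet> a)\<^sup>2) \<le> r\<^sup>2} \<in> sets M" by (simp add: M)
  qed
  have "U \<in> sets M" if "open U" for U
  proof -
    define P where "P = {(d, q). d \<in> rational_combinations \<and> q \<in> \<rat> \<and> q \<ge> 0 \<and> cball d q \<subseteq> U}"
    have cD: "countable rational_combinations"
    proof -
      obtain f :: "'i \<Rightarrow> nat" where "inj f" using assms by (auto elim: countableE)
      then have "inj (map (map_prod f (id :: rat \<Rightarrow> rat)))"
        by (intro inj_mapI prod.inj_map) auto
      then have "countable (UNIV :: ('i \<times> rat) list set)"
        by (rule countableI')
      then show ?thesis unfolding rational_combinations_def by (rule countable_image)
    qed
    have "P \<subseteq> rational_combinations \<times> \<rat>" by (auto simp: P_def)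
    then have "countable P" by (rule countable_subset) (intro countable_SIGMA cD countable_rat)
    moreover have "U = (\<Union>(d, q)\<in>P. cball d q)"
    proof
      show "U \<subseteq> (\<Union>(d, q)\<in>P. cball d q)"
      proof
        fix x assume "x \<in> U"
        with \<open>open U\<close> obtain \<epsilon> where \<epsilon>: "\<epsilon> > 0" "ball x \<epsilon> \<subseteq> U" by (auto simp: open_contains_ball)
        have "x \<in> closure rational_combinations" by (simp add: rational_combinations_dense)
        then obtain d where d: "d \<in> rational_combinations" "dist d x < \<epsilon> / 3"
          using \<epsilon>(1) unfolding closure_approachable by (metis divide_pos_pos zero_less_numeral)
        \<comment> \<open>A centre within \<open>\<epsilon> / 3\<close> and a radius between
          \<open>\<epsilon> / 3\<close> and \<open>2 * \<epsilon> / 3\<close> make the ball contain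
          \<open>x\<close> and stay inside \<open>ball x \<epsilon>\<close>.\<close>
        obtain q where q: "q \<in> \<rat>" "\<epsilon> / 3 < q" "q < 2 * \<epsilon> / 3"
          using Rats_dense_in_real[of "\<epsilon> / 3" "2 * \<epsilon> / 3"] \<epsilon>(1) by auto
        have "cball d q \<subseteq> ball x \<epsilon>"
        proof
          fix y assume "y \<in> cball d q"
          then have "dist d y \<le> q" by simp
          then have "dist x y < \<epsilon>" using d(2) q(3) dist_triangle3[of x y d] by linarith
          then show "y \<in> ball x \<epsilon>" by simp
        qed
        then have "(d, q) \<in> P" using \<epsilon> d q by (auto simp: P_def)
        moreover have "x \<in> cball d q" using d q by simp
        ultimately show "x \<in> (\<Union>(d, q)\<in>P. cball d q)" by blast
      qed
    qed (auto simp: P_def)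
    moreover have "(\<Union>(d, q)\<in>P. cball d q) \<in> sets M"
    proof (rule sets.countable_UN''[OF \<open>countable P\<close>])
      fix p assume "p \<in> P"
      then show "(case p of (d, q) \<Rightarrow> cball d q) \<in> sets M"
        by (cases p) (simp add: P_def cball)
    qed
    ultimately show ?thesis by (simp only:)
  qed
  then have "{S. open S} \<subseteq> sigma_sets UNIV ?E" by (auto simp: M)
  then show "sets borel \<subseteq> sigma_sets UNIV ?E"
    unfolding borel_def by (simp add: sigma_sets_mono)
  show "sigma_sets UNIV ?E \<subseteq> sets borel"
    by (rule sets.sigma_sets_subset') (auto intro!: cylinder_borel)
qed

theorem measure_eqI_char:
  fixes \<mu> \<nu> :: "'a measure"
  assumes count: "countable (UNIV :: 'i set)"
    and \<mu>: "prob_space \<mu>" "sets \<mu> = sets borel" and \<nu>: "prob_space \<nu>" "sets \<nu> = sets borel"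
    and cos: "\<And>h. h \<in> span (range e) \<Longrightarrow> (LINT \<phi>|\<mu>. cos (h \<bullet> \<phi>)) = (LINT \<phi>|\<nu>. cos (h \<bullet> \<phi>))"
    and sin: "\<And>h. h \<in> span (range e) \<Longrightarrow> (LINT \<phi>|\<mu>. sin (h \<bullet> \<phi>)) = (LINT \<phi>|\<nu>. sin (h \<bullet> \<phi>))"
  shows "\<mu> = \<nu>"
proof -
  interpret M: prob_space \<mu> by fact
  interpret N: prob_space \<nu> by fact
  let ?E = "{cylinder L | L. \<forall>(i, A)\<in>set L. A \<in> sets borel}"
  show ?thesis
  proof (rule measure_eqI_generator_eq[where E = ?E and \<Omega> = UNIV and A = "\<lambda>_. UNIV"])
    show "Int_stable ?E"
    proof (rule Int_stableI)
      fix a b assume "a \<in> ?E" "b \<in> ?E"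
      then obtain L L' where "a = cylinder L" "\<forall>(i, A)\<in>set L. A \<in> sets borel"
        "b = cylinder L'" "\<forall>(i, A)\<in>set L'. A \<in> sets borel" by blast
      then show "a \<inter> b \<in> ?E"
        by (intro CollectI exI[of _ "L @ L'"]) (auto simp: cylinder_append)
    qed
    show "emeasure \<mu> X = emeasure \<nu> X" if "X \<in> ?E" for X
    proof -
      from that obtain L where "X = cylinder L" "\<forall>(i, A)\<in>set L. A \<in> sets borel" by blast
      then have "measure \<mu> X = measure \<nu> X"
        using measure_cylinder_eq[OF \<mu> \<nu> cos sin, of L] by auto
      then show ?thesis by (simp add: M.emeasure_eq_measure N.emeasure_eq_measure)
    qed
    show "range (\<lambda>_. UNIV) \<subseteq> ?E"
      by (auto intro!: exI[of _ "[]"] simp: cylinder_def)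
  qed (use borel_eq_cylinders[OF count] \<mu>(2) \<nu>(2) in auto)
qed

end

section \<open>A discrete Gronwall inequality and integrals of sheared functions\<close>

text \<open>Cuts off a final piece on which \<Phi> grows by \<delta>, or by its whole increment if
  this is smaller; the \<open>max\<close> merges the two cases.\<close>

lemma IVT_increment:
  fixes \<Phi> :: "real \<Rightarrow> real"
  assumes cont: "continuous_on {a..b} \<Phi>" and "a \<le> b" and mono: "\<Phi> a \<le> \<Phi> b" and "\<delta> \<ge> 0"
  obtains r where "a \<le> r" "r \<le> b" "\<Phi> r = max (\<Phi> a) (\<Phi> b - \<delta>)"
  using IVT'[of \<Phi> a "max (\<Phi> a) (\<Phi> b - \<delta>)" b] assms by auto

text \<open>Where \<Phi> grows by at most 1/2, \<open>v\<close> deviates from its maximum by at most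
  half of it, so the values at both ends differ by a factor of at most 2; \<open>n\<close> such
  pieces give \<open>2 ^ n\<close>. Increments of \<Phi> replace the derivative in Gronwall's
  inequality, and the two-sided conclusion serves both directions of time.\<close>

lemma gronwall_doubling:
  fixes \<Phi> v :: "real \<Rightarrow> real"
  assumes \<Phi>: "continuous_on {p..q} \<Phi>" and mono: "\<And>a b. p \<le> a \<Longrightarrow> a \<le> b \<Longrightarrow> b \<le> q \<Longrightarrow> \<Phi> a \<le> \<Phi> b"
    and v: "continuous_on {p..q} v" "\<And>s. v s \<ge> 0"
    and inc: "\<And>a b M. p \<le> a \<Longrightarrow> a \<le> b \<Longrightarrow> b \<le> q \<Longrightarrow> (\<And>s. a \<le> s \<Longrightarrow> s \<le> b \<Longrightarrow> v s \<le> M) \<Longrightarrow>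
      \<bar>v b - v a\<bar> \<le> M * (\<Phi> b - \<Phi> a)"
  shows "p \<le> a \<Longrightarrow> a \<le> b \<Longrightarrow> b \<le> q \<Longrightarrow> \<Phi> b - \<Phi> a \<le> real n / 2 \<Longrightarrow>
    v b \<le> 2 ^ n * v a \<and> v a \<le> 2 ^ n * v b"
proof (induction n arbitrary: b)
  have max: "\<exists>s. a \<le> s \<and> s \<le> b \<and> (\<forall>t. a \<le> t \<longrightarrow> t \<le> b \<longrightarrow> v t \<le> v s)" if "p \<le> a" "a \<le> b" "b \<le> q" for a b
    using continuous_attains_sup[of "{a..b}" v] continuous_on_subset[OF v(1), of "{a..b}"] that by auto
  case 0
  obtain s where s: "a \<le> s" "s \<le> b" "\<forall>t. a \<le> t \<longrightarrow> t \<le> b \<longrightarrow> v t \<le> v s" using max[of a b] 0 by blast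
  have "\<Phi> b - \<Phi> a = 0" using 0 mono[of a b] by simp
  then show ?case using inc[of a b "v s"] 0 s by simp
next
  have max: "\<exists>s. a \<le> s \<and> s \<le> b \<and> (\<forall>t. a \<le> t \<longrightarrow> t \<le> b \<longrightarrow> v t \<le> v s)" if "p \<le> a" "a \<le> b" "b \<le> q" for a b
    using continuous_attains_sup[of "{a..b}" v] continuous_on_subset[OF v(1), of "{a..b}"] that by auto
  case (Suc n)
  have "continuous_on {a..b} \<Phi>" using continuous_on_subset[OF \<Phi>, of "{a..b}"] Suc.prems by auto
  from IVT_increment[OF this Suc.prems(2) mono[OF Suc.prems(1-3)], of "1/2"]
  obtain r where r: "a \<le> r" "r \<le> b" "\<Phi> r = max (\<Phi> a) (\<Phi> b - 1/2)" by auto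
  have "\<Phi> r - \<Phi> a \<le> real n / 2" using r(3) Suc.prems(4) by (auto simp: max_def add_divide_distrib split: if_splits)
  then have 1: "v r \<le> 2 ^ n * v a \<and> v a \<le> 2 ^ n * v r"
    using Suc.prems r by (intro Suc.IH) auto
  \<comment> \<open>The maximum over the last piece; \<open>inc\<close> compares it with the values
    at both ends.\<close>
  obtain s where s: "r \<le> s" "s \<le> b" "\<And>t. r \<le> t \<Longrightarrow> t \<le> b \<Longrightarrow> v t \<le> v s"
    using max[of r b] r Suc.prems by auto
  have \<Phi>s: "\<Phi> r \<le> \<Phi> s" "\<Phi> s \<le> \<Phi> b" "\<Phi> b - \<Phi> r \<le> 1/2"
  proof -
    show "\<Phi> r \<le> \<Phi> s" "\<Phi> s \<le> \<Phi> b" using mono[of r s] mono[of s b] r s Suc.prems by auto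
    have "\<Phi> b - 1/2 \<le> \<Phi> r" using r(3) by simp
    then show "\<Phi> b - \<Phi> r \<le> 1/2" by linarith
  qed
  have "\<bar>v s - v r\<bar> \<le> v s * (\<Phi> s - \<Phi> r)" using s r Suc.prems by (intro inc) auto
  also have "\<dots> \<le> v s * (1/2)" using \<Phi>s v(2) by (intro mult_left_mono) auto
  finally have 2: "v s \<le> 2 * v r" by linarith
  have "\<bar>v b - v s\<bar> \<le> v s * (\<Phi> b - \<Phi> s)" using s r Suc.prems by (intro inc) auto
  also have "\<dots> \<le> v s * (1/2)" using \<Phi>s v(2) by (intro mult_left_mono) auto
  finally have 3: "v s \<le> 2 * v b" by linarith
  have "v b \<le> 2 * v r" "v r \<le> 2 * v b" using s(3)[of b] s(3)[of r] 2 3 r s(1,2) by linarith+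
  moreover have "2 ^ n * v r \<le> 2 ^ n * (2 * v b)" using calculation(2) by (intro mult_left_mono) auto
  ultimately have "v b \<le> 2 * (2 ^ n * v a)" "v a \<le> 2 ^ n * (2 * v b)" using 1 by linarith+
  then show ?case by (simp add: mult_ac)
qed

text \<open>Cutting into \<open>n\<close> pieces of equal \<Phi>-increment bounds the change of
  \<open>I\<close> by \<open>n\<close> times a multiple of \<open>1 / n\<^sup>2\<close>. This stands
  in for a vanishing time derivative.\<close>

lemma quadratic_increment_const:
  fixes \<Phi> I :: "real \<Rightarrow> real"
  assumes \<Phi>: "continuous_on {p..q} \<Phi>" and mono: "\<And>a b. p \<le> a \<Longrightarrow> a \<le> b \<Longrightarrow> b \<le> q \<Longrightarrow> \<Phi> a \<le> \<Phi> b"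
    and "p \<le> q" "\<delta>0 > 0" "C \<ge> 0"
    and inc: "\<And>a b. p \<le> a \<Longrightarrow> a \<le> b \<Longrightarrow> b \<le> q \<Longrightarrow> \<Phi> b - \<Phi> a \<le> \<delta>0 \<Longrightarrow> \<bar>I b - I a\<bar> \<le> C * (\<Phi> b - \<Phi> a)\<^sup>2"
  shows "I p = I q"
proof -
  have step: "\<bar>I b - I p\<bar> \<le> C * real n * \<delta>\<^sup>2"
    if "0 \<le> \<delta>" "\<delta> \<le> \<delta>0" "p \<le> b" "b \<le> q" "\<Phi> b - \<Phi> p \<le> real n * \<delta>" for n b \<delta>
    using that
  proof (induction n arbitrary: b)
    case 0
    then show ?case using inc[of p b] mono[of p b] \<open>\<delta>0 > 0\<close> by auto
  next
    case (Suc n)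
    have "continuous_on {p..b} \<Phi>" using continuous_on_subset[OF \<Phi>, of "{p..b}"] Suc.prems by auto
    from IVT_increment[OF this Suc.prems(3) mono[of p b] Suc.prems(1)]
    obtain r where r: "p \<le> r" "r \<le> b" "\<Phi> r = max (\<Phi> p) (\<Phi> b - \<delta>)" using Suc.prems by auto
    have 1: "\<bar>I r - I p\<bar> \<le> C * real n * \<delta>\<^sup>2"
      using Suc.prems r by (intro Suc.IH) (auto simp: algebra_simps)
    have m: "\<Phi> r \<le> \<Phi> b" "\<Phi> b - \<Phi> r \<le> \<delta>" using mono[of r b] r Suc.prems by auto
    have "\<bar>I b - I r\<bar> \<le> C * (\<Phi> b - \<Phi> r)\<^sup>2" using r Suc.prems m by (intro inc) auto
    also have "\<dots> \<le> C * \<delta>\<^sup>2" using m \<open>C \<ge> 0\<close> by (intro mult_left_mono power_mono) auto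
    finally show ?case using 1 by (simp add: algebra_simps)
  qed
  define \<Delta> where "\<Delta> = \<Phi> q - \<Phi> p"
  have \<Delta>: "\<Delta> \<ge> 0" using mono[of p q] \<open>p \<le> q\<close> by (simp add: \<Delta>_def)
  have bound: "\<bar>I q - I p\<bar> \<le> C * \<Delta>\<^sup>2 / real n" if "n > 0" "\<Delta> / \<delta>0 \<le> real n" for n
  proof -
    have "\<bar>I q - I p\<bar> \<le> C * real n * (\<Delta> / real n)\<^sup>2"
      using that \<open>\<delta>0 > 0\<close> \<open>p \<le> q\<close> \<Delta> by (intro step) (auto simp: field_simps \<Delta>_def)
    then show ?thesis using that by (simp add: power2_eq_square field_simps)
  qed
  have "(\<lambda>n. C * \<Delta>\<^sup>2 / real n) \<longlonglongrightarrow> 0"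
    using tendsto_mult_right_zero[OF lim_inverse_n, of "C * \<Delta>\<^sup>2"] by (simp add: divide_inverse)
  moreover have "\<forall>\<^sub>F n in sequentially. \<bar>I q - I p\<bar> \<le> C * \<Delta>\<^sup>2 / real n"
  proof -
    obtain n0 :: nat where "\<Delta> / \<delta>0 \<le> real n0" using real_arch_simple by blast
    then show ?thesis
      by (intro eventually_sequentiallyI[of "Suc n0"] bound) auto
  qed
  ultimately have "\<bar>I q - I p\<bar> \<le> 0" by (intro tendsto_lowerbound) auto
  then show ?thesis by simp
qed

text \<open>Fubini along one axis without splitting \<open>real^'n\<close> into a product: every
  line parallel to the axis meets the slab \<open>0 \<le> y $ i \<le> 1\<close> in length 1, so each
  point is counted with total weight 1.\<close>

lemma nn_integral_lines:
  fixes H :: "real^'n \<Rightarrow> ennreal"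
  assumes [measurable]: "H \<in> borel_measurable borel"
  shows "(\<integral>\<^sup>+y. indicator {0..1} (y $ i) * (\<integral>\<^sup>+s. H (y + s *\<^sub>R axis i 1) \<partial>lborel) \<partial>lborel) = (\<integral>\<^sup>+x. H x \<partial>lborel)"
proof -
  have [measurable]: "(\<lambda>y::real^'n. y $ i) \<in> borel_measurable borel"
    by (intro borel_measurable_continuous_onI continuous_intros)
  have addm: "(\<lambda>p::(real^'n) \<times> real. fst p + snd p *\<^sub>R axis i 1) \<in> borel_measurable borel"
    by (intro borel_measurable_continuous_onI continuous_intros)
  have pair: "(\<lambda>p::(real^'n) \<times> real. fst p + snd p *\<^sub>R axis i 1) \<in> borel_measurable (lborel \<Otimes>\<^sub>M lborel)"
    using addm by (simp add: borel_prod lborel_prod)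
  note [measurable] = measurable_compose[OF pair assms]
  have "(\<integral>\<^sup>+y. indicator {0..1} (y $ i) * (\<integral>\<^sup>+s. H (y + s *\<^sub>R axis i 1) \<partial>lborel) \<partial>lborel)
      = (\<integral>\<^sup>+y. (\<integral>\<^sup>+s. indicator {0..1} (y $ i) * H (y + s *\<^sub>R axis i 1) \<partial>lborel) \<partial>lborel)"
    by (intro nn_integral_cong nn_integral_cmult[symmetric])
       (auto intro!: measurable_compose[OF _ assms] borel_measurable_continuous_onI continuous_intros)
  also have "\<dots> = (\<integral>\<^sup>+s. (\<integral>\<^sup>+y. indicator {0..1} (y $ i) * H (y + s *\<^sub>R axis i 1) \<partial>lborel) \<partial>(lborel::real measure))"
    by (rule lborel_pair.Fubini'[symmetric]) (simp add: split_beta')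
  also have "\<dots> = (\<integral>\<^sup>+s. (\<integral>\<^sup>+z. indicator {0..1} (z $ i - s) * H z \<partial>lborel) \<partial>(lborel::real measure))"
  proof (rule nn_integral_cong)
    fix s :: real
    have "(\<integral>\<^sup>+z. indicator {0..1} (z $ i - s) * H z \<partial>lborel) =
        (\<integral>\<^sup>+z. indicator {0..1} (z $ i - s) * H z \<partial>distr lborel borel ((+) (s *\<^sub>R axis i 1)))"
      by (simp only: lborel_distr_plus)
    also have "\<dots> = (\<integral>\<^sup>+y. indicator {0..1} (y $ i) * H (y + s *\<^sub>R axis i 1) \<partial>lborel)"
      by (subst nn_integral_distr) (auto simp: add.commute axis_def)
    finally show "(\<integral>\<^sup>+y. indicator {0..1} (y $ i) * H (y + s *\<^sub>R axis i 1) \<partial>lborel) =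
      (\<integral>\<^sup>+z. indicator {0..1} (z $ i - s) * H z \<partial>lborel)" ..
  qed
  also have "\<dots> = (\<integral>\<^sup>+z. (\<integral>\<^sup>+s. indicator {0..1} (z $ i - s) * H z \<partial>(lborel::real measure)) \<partial>lborel)"
    by (rule lborel_pair.Fubini') (simp add: split_beta')
  also have "\<dots> = (\<integral>\<^sup>+z. H z \<partial>lborel)"
  proof (rule nn_integral_cong)
    fix z :: "real^'n"
    have "(\<integral>\<^sup>+s. indicator {0..1} (z $ i - s) * H z \<partial>(lborel::real measure)) =
        (\<integral>\<^sup>+s. indicator {z $ i - 1..z $ i} s \<partial>(lborel::real measure)) * H z"
      by (subst nn_integral_multc[symmetric]) (auto intro!: nn_integral_cong simp: indicator_def)
    then show "(\<integral>\<^sup>+s. indicator {0..1} (z $ i - s) * H z \<partial>(lborel::real measure)) = H z" by simp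
  qed
  finally show ?thesis .
qed

lemma nn_integral_line_shift:
  fixes G p g :: "real \<Rightarrow> real"
  assumes G: "continuous_on UNIV G" "\<And>x. G x \<ge> 0" "\<And>x. \<bar>x\<bar> > R \<Longrightarrow> G x = 0"
    and p: "\<And>s. (p has_real_derivative g s) (at s)" "\<And>s. \<bar>p s\<bar> \<le> B"
    and g: "continuous_on UNIV g" "\<And>s. 1 + g s \<ge> 0"
  shows "(\<integral>\<^sup>+s. ennreal (G (s + p s) * (1 + g s)) \<partial>lborel) = (\<integral>\<^sup>+s. ennreal (G s) \<partial>lborel)"
proof -
  \<comment> \<open>As \<open>p\<close> is bounded by \<open>B\<close>, beyond \<open>M\<close> the
    shifted point leaves the support of \<open>G\<close>, and the image of \<open>{- M..M}\<close>
    covers that support.\<close>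
  define M where "M = \<bar>R\<bar> + B + 1"
  have B: "B \<ge> 0" using p(2)[of 0] by linarith
  have "(\<integral>\<^sup>+s. ennreal (G s * indicator {- M + p (- M)..M + p M} s) \<partial>lborel) =
      (\<integral>\<^sup>+s. ennreal (G (s + p s) * (1 + g s) * indicator {- M..M} s) \<partial>lborel)"
  proof (rule nn_integral_substitution[where g = "\<lambda>s. s + p s"])
    show "set_borel_measurable borel {- M + p (- M)..M + p M} G"
    proof -
      have [measurable]: "G \<in> borel_measurable borel" by (intro borel_measurable_continuous_onI G)
      show ?thesis unfolding set_borel_measurable_def real_scaleR_def by measurable
    qed
    show "((\<lambda>s. s + p s) has_real_derivative 1 + g x) (at x)" for x
      by (intro derivative_intros p)
    show "continuous_on {- M..M} (\<lambda>x. 1 + g x)"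
      by (intro continuous_intros continuous_on_subset[OF g(1)]) auto
  qed (use g B in \<open>auto simp: M_def\<close>)
  moreover have "G s * indicator {- M + p (- M)..M + p M} s = G s" for s
  proof (cases "\<bar>s\<bar> > R")
    case False
    have "- M + p (- M) \<le> s" "s \<le> M + p M" using p(2)[of M] p(2)[of "- M"] False by (auto simp: M_def)
    then show ?thesis by simp
  qed (simp add: G(3))
  moreover have "G (s + p s) * (1 + g s) * indicator {- M..M} s = G (s + p s) * (1 + g s)" for s
  proof (cases "s \<in> {- M..M}")
    case False
    then have "\<bar>s + p s\<bar> > R" using p(2)[of s] by (auto simp: M_def)
    then show ?thesis by (simp add: G(3))
  qed simp
  ultimately show ?thesis by (simp only:)
qed

text \<open>A shear moves points along lines parallel to one axis, so its Jacobian
  \<open>1 + g\<close> comes from one-dimensional substitution on each line.\<close>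

lemma nn_integral_shear:
  fixes G p g :: "real^'n \<Rightarrow> real"
  assumes G: "continuous_on UNIV G" "\<And>x. G x \<ge> 0" "\<And>x. norm x > R \<Longrightarrow> G x = 0"
    and p: "continuous_on UNIV p" "\<And>x. \<bar>p x\<bar> \<le> B"
      "\<And>y s. ((\<lambda>s. p (y + s *\<^sub>R axis i 1)) has_real_derivative g (y + s *\<^sub>R axis i 1)) (at s)"
    and g: "continuous_on UNIV g" "\<And>x. 1 + g x \<ge> 0"
  shows "(\<integral>\<^sup>+x. ennreal (G (x + p x *\<^sub>R axis i 1) * (1 + g x)) \<partial>lborel) = (\<integral>\<^sup>+x. ennreal (G x) \<partial>lborel)"
proof -
  have Gc: "continuous_on UNIV (\<lambda>x. G (f x))" if "continuous_on UNIV f" for f :: "'b::topological_space \<Rightarrow> real^'n"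
    using continuous_on_compose2[OF G(1) that] by simp
  have m1: "(\<lambda>x. ennreal (G (x + p x *\<^sub>R axis i 1) * (1 + g x))) \<in> borel_measurable borel"
    by (intro measurable_compose[OF _ measurable_ennreal] borel_measurable_continuous_onI continuous_intros Gc p g)
  have m2: "(\<lambda>x. ennreal (G x)) \<in> borel_measurable borel"
    by (intro measurable_compose[OF _ measurable_ennreal] borel_measurable_continuous_onI G)
  have line: "(\<integral>\<^sup>+s. ennreal (G ((y + s *\<^sub>R axis i 1) + p (y + s *\<^sub>R axis i 1) *\<^sub>R axis i 1) * (1 + g (y + s *\<^sub>R axis i 1))) \<partial>lborel)
      = (\<integral>\<^sup>+s. ennreal (G (y + s *\<^sub>R axis i 1)) \<partial>lborel)" for y
  proof -
    have "(\<integral>\<^sup>+s. ennreal (G (y + (s + p (y + s *\<^sub>R axis i 1)) *\<^sub>R axis i 1) * (1 + g (y + s *\<^sub>R axis i 1))) \<partial>lborel)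
      = (\<integral>\<^sup>+s. ennreal (G (y + s *\<^sub>R axis i 1)) \<partial>lborel)"
    proof (rule nn_integral_line_shift[where R = "R + norm y"])
      show "continuous_on UNIV (\<lambda>s. G (y + s *\<^sub>R axis i 1))" by (intro Gc continuous_intros)
      show "G (y + s *\<^sub>R axis i 1) = 0" if "\<bar>s\<bar> > R + norm y" for s
      proof (rule G(3))
        have "norm (s *\<^sub>R axis i (1::real)) \<le> norm (y + s *\<^sub>R axis i 1) + norm y"
          using norm_triangle_ineq4[of "y + s *\<^sub>R axis i 1" y] by simp
        then show "R < norm (y + s *\<^sub>R axis i 1)" using that by (simp add: norm_axis_1)
      qed
      show "continuous_on UNIV (\<lambda>s. g (y + s *\<^sub>R axis i 1))"
        by (rule continuous_on_compose2[OF g(1)]) (auto intro!: continuous_intros)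
    qed (use G p g in auto)
    then show ?thesis by (simp add: scaleR_add_left add.assoc)
  qed
  show ?thesis
    unfolding nn_integral_lines[OF m1, of i, symmetric] nn_integral_lines[OF m2, of i, symmetric] line ..
qed

section \<open>Regular vector fields\<close>

text \<open>One constant bounds the field, its partial derivatives and its Lipschitz quotients, so
  that a single integrable function of time controls everything.\<close>

definition regular_field :: "(real^'n \<Rightarrow> real^'n) \<Rightarrow> real \<Rightarrow> bool" where
  "regular_field v L \<longleftrightarrow> torus_periodic v \<and> (\<forall>x. v differentiable (at x)) \<and>
     (\<forall>i. continuous_on UNIV (partial_deriv i v)) \<and> (\<forall>x. norm (v x) \<le> L) \<and>
     (\<forall>i x. norm (partial_deriv i v x) \<le> L) \<and> (\<forall>x y. norm (v x - v y) \<le> L * norm (x - y)) \<and>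
     (\<forall>x. divergence v x = 0)"

lemma partial_deriv_const [simp]: "partial_deriv i (\<lambda>_. c) x = 0"
  by (simp add: partial_deriv_def frechet_derivative_const)

lemma regular_field_zero: "regular_field (\<lambda>_::real^'n. 0) 0"
proof -
  have "partial_deriv i (\<lambda>_. 0 :: real^'n) = (\<lambda>_. 0)" for i :: 'n by (simp add: fun_eq_iff)
  then show ?thesis by (simp add: regular_field_def torus_periodic_def divergence_def)
qed

lemma partial_deriv_diff:
  assumes "f differentiable (at x)" "g differentiable (at x)"
  shows "partial_deriv i (\<lambda>x. f x - g x) x = partial_deriv i f x - partial_deriv i g x"
proof -
  have "((\<lambda>x. f x - g x) has_derivative (\<lambda>h. frechet_derivative f (at x) h - frechet_derivative g (at x) h)) (at x)"
    by (intro has_derivative_diff) (use assms frechet_derivative_works in blast)+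
  from frechet_derivative_at[OF this] show ?thesis
    by (simp add: partial_deriv_def fun_eq_iff)
qed

text \<open>The third bound is taken over a set \<open>D\<close> because suprema over a countable
  dense set stay measurable in time.\<close>

lemma norm_le_holder_norm:
  fixes f :: "real^'n \<Rightarrow> 'b::real_normed_vector"
  shows "ennreal (norm (f x)) \<le> holder_norm 1 \<epsilon> f"
    and "ennreal (norm (partial_deriv i f x)) \<le> holder_norm 1 \<epsilon> f"
    and "(SUP x\<in>D. ennreal (norm (f x))) + (\<Sum>i\<in>UNIV. SUP x\<in>D. ennreal (norm (partial_deriv i f x))) \<le> holder_norm 1 \<epsilon> f"
proof -
  let ?F = "\<lambda>js. SUP x. ennreal (norm (iterated_partial js f x))"
  have fin: "finite {js :: 'n list. length js \<le> 1}"
    using finite_lists_length_le[of "UNIV :: 'n set" 1] by simp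
  have inj: "inj (\<lambda>i::'n. [i])" by (auto simp: inj_def)
  have ip: "iterated_partial [] f = f" "iterated_partial [i] f = partial_deriv i f" for i
    by (simp_all add: iterated_partial_def)
  have sub: "(\<Sum>js\<in>A. ?F js) \<le> holder_norm 1 \<epsilon> f" if "A \<subseteq> {js. length js \<le> 1}" for A
  proof -
    have "(\<Sum>js\<in>A. ?F js) \<le> (\<Sum>js | length js \<le> 1. ?F js)"
      by (rule sum_mono2) (use fin that in auto)
    then show ?thesis unfolding holder_norm_def by (rule order_trans) simp
  qed
  have "ennreal (norm (f x)) \<le> ?F []" unfolding ip by (rule SUP_upper) simp
  also have "\<dots> \<le> holder_norm 1 \<epsilon> f" using sub[of "{[]}"] by simp
  finally show "ennreal (norm (f x)) \<le> holder_norm 1 \<epsilon> f" .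
  have "ennreal (norm (partial_deriv i f x)) \<le> ?F [i]" unfolding ip by (rule SUP_upper) simp
  also have "\<dots> \<le> holder_norm 1 \<epsilon> f" using sub[of "{[i]}"] by simp
  finally show "ennreal (norm (partial_deriv i f x)) \<le> holder_norm 1 \<epsilon> f" .
  have "(SUP x\<in>D. ennreal (norm (f x))) + (\<Sum>i\<in>UNIV. SUP x\<in>D. ennreal (norm (partial_deriv i f x)))
      \<le> ?F [] + (\<Sum>i\<in>UNIV. ?F [i])"
    by (intro add_mono sum_mono SUP_subset_mono) (simp_all add: ip)
  also have "\<dots> = (\<Sum>js\<in>insert [] (range (\<lambda>i. [i])). ?F js)"
    by (subst sum.insert) (auto simp: sum.reindex[OF inj])
  also have "\<dots> \<le> holder_norm 1 \<epsilon> f" by (rule sub) auto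
  finally show "(SUP x\<in>D. ennreal (norm (f x))) + (\<Sum>i\<in>UNIV. SUP x\<in>D. ennreal (norm (partial_deriv i f x))) \<le> holder_norm 1 \<epsilon> f" .
qed

lemma frechet_derivative_partial:
  fixes f :: "real^'n \<Rightarrow> 'b::real_normed_vector"
  assumes "f differentiable (at x)"
  shows "frechet_derivative f (at x) h = (\<Sum>i\<in>UNIV. h $ i *\<^sub>R partial_deriv i f x)"
proof -
  interpret linear "frechet_derivative f (at x)"
    using assms by (rule linear_frechet_derivative)
  have "h = (\<Sum>i\<in>UNIV. h $ i *\<^sub>R axis i 1)"
    by (simp add: vec_eq_iff axis_def if_distrib if_distribR cong: if_cong)
  then have "frechet_derivative f (at x) h = frechet_derivative f (at x) (\<Sum>i\<in>UNIV. h $ i *\<^sub>R axis i 1)"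
    by simp
  then show ?thesis by (simp add: sum scaleR partial_deriv_def)
qed

lemma lipschitz_of_partial_bounds:
  fixes f :: "real^'n \<Rightarrow> 'b::real_normed_vector"
  assumes d: "\<And>x. f differentiable (at x)" and b: "\<And>i x. norm (partial_deriv i f x) \<le> B i"
  shows "norm (f x - f y) \<le> (\<Sum>i\<in>UNIV. B i) * norm (x - y)"
proof (rule differentiable_bound[of UNIV])
  show "(f has_derivative frechet_derivative f (at x)) (at x within UNIV)" for x
    using d[of x] by (simp add: frechet_derivative_works)
  show "onorm (frechet_derivative f (at x)) \<le> (\<Sum>i\<in>UNIV. B i)" for x
  proof (rule onorm_bound)
    have B: "B i \<ge> 0" for i using order_trans[OF norm_ge_zero b[of i x]] .
    then show "0 \<le> (\<Sum>i\<in>UNIV. B i)" by (simp add: sum_nonneg)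
    show "norm (frechet_derivative f (at x) h) \<le> (\<Sum>i\<in>UNIV. B i) * norm h" for h
    proof -
      have "norm (frechet_derivative f (at x) h) \<le> (\<Sum>i\<in>UNIV. norm (h $ i *\<^sub>R partial_deriv i f x))"
        unfolding frechet_derivative_partial[OF d] by (rule norm_sum)
      also have "\<dots> \<le> (\<Sum>i\<in>UNIV. norm h * B i)"
        using b component_le_norm_cart[of h] B by (intro sum_mono) (auto intro!: mult_mono)
      finally show ?thesis by (simp add: sum_distrib_left mult.commute)
    qed
  qed
qed auto

lemma norm_le_dense_SUP:
  fixes f :: "'a::topological_space \<Rightarrow> 'b::real_normed_vector"
  assumes "continuous_on UNIV f" and dense: "\<And>X. open X \<Longrightarrow> X \<noteq> {} \<Longrightarrow> \<exists>d\<in>D. d \<in> X"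
    and fin: "(SUP x\<in>D. ennreal (norm (f x))) < \<infinity>"
  shows "norm (f x) \<le> enn2real (SUP x\<in>D. ennreal (norm (f x)))"
proof (rule ccontr)
  let ?S = "SUP x\<in>D. ennreal (norm (f x))"
  assume "\<not> norm (f x) \<le> enn2real ?S"
  then have "x \<in> {x. enn2real ?S < norm (f x)}" by simp
  moreover have "open {x. enn2real ?S < norm (f x)}"
    by (intro open_Collect_less continuous_intros assms)
  ultimately obtain d where d: "d \<in> D" "enn2real ?S < norm (f d)" using dense by blast
  have "ennreal (norm (f d)) \<le> ?S" using d by (intro SUP_upper)
  then have "norm (f d) \<le> enn2real ?S"
    using fin by (metis enn2real_ennreal enn2real_mono infinity_ennreal_def norm_ge_zero)
  then show False using d by simp
qed

lemma regular_field_C1: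
  fixes f :: "real^'n \<Rightarrow> real^'n"
  assumes "torus_periodic f" "cont_diff 1 f" and div: "\<And>x. divergence f x = 0"
    and dense: "\<And>X. open X \<Longrightarrow> X \<noteq> {} \<Longrightarrow> \<exists>d\<in>D. d \<in> X"
  defines "G \<equiv> (SUP x\<in>D. ennreal (norm (f x))) + (\<Sum>i\<in>UNIV. SUP x\<in>D. ennreal (norm (partial_deriv i f x)))"
  assumes G: "G < \<infinity>"
  shows "regular_field f (enn2real G)"
proof -
  have d: "f differentiable (at x)" and c: "continuous_on UNIV (partial_deriv i f)" for x i
    using \<open>cont_diff 1 f\<close>[unfolded One_nat_def] by simp_all
  have cf: "continuous_on UNIV f"
    by (intro differentiable_imp_continuous_on) (simp add: differentiable_on_def d)
  let ?A = "SUP x\<in>D. ennreal (norm (f x))" and ?B = "\<lambda>i. SUP x\<in>D. ennreal (norm (partial_deriv i f x))"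
  have "(\<Sum>i\<in>UNIV. ?B i) < \<infinity>" and A: "?A < \<infinity>" using G by (auto simp: G_def)
  then have B: "?B i < \<infinity>" for i by (simp add: less_top)
  have G_eq: "enn2real G = enn2real ?A + (\<Sum>i\<in>UNIV. enn2real (?B i))"
    unfolding G_def using A B by (subst enn2real_plus) (auto simp: enn2real_sum less_top)
  have nf: "norm (f x) \<le> enn2real ?A" for x by (rule norm_le_dense_SUP[OF cf dense A])
  have np: "norm (partial_deriv i f x) \<le> enn2real (?B i)" for i x
    by (rule norm_le_dense_SUP[OF c dense B])
  have Bsum: "enn2real (?B i) \<le> (\<Sum>i\<in>UNIV. enn2real (?B i))" for i
    by (rule member_le_sum) auto
  have lip: "norm (f x - f y) \<le> enn2real G * norm (x - y)" for x y
  proof -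
    have "norm (f x - f y) \<le> (\<Sum>i\<in>UNIV. enn2real (?B i)) * norm (x - y)"
      by (rule lipschitz_of_partial_bounds[OF d np])
    also have "\<dots> \<le> enn2real G * norm (x - y)" unfolding G_eq by (intro mult_right_mono) auto
    finally show ?thesis .
  qed
  have "norm (f x) \<le> enn2real G" for x
    using nf[of x] by (simp add: G_eq add_increasing2 sum_nonneg)
  moreover have "norm (partial_deriv i f x) \<le> enn2real G" for i x
    using np[of i x] Bsum[of i] enn2real_nonneg[of ?A] unfolding G_eq by linarith
  ultimately show ?thesis using assms d c lip by (simp add: regular_field_def)
qed

text \<open>Setting the field to 0 at the exceptional times makes every property hold at all times.
  Strong measurability yields measurability of each value and each derivative, as limits along the
  simple functions; a bound over a countable dense set is then measurable as well.\<close>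

lemma L1_loc_holder_regular:
  fixes u :: "real \<Rightarrow> real^'n \<Rightarrow> real^'n"
  assumes u: "u \<in> L1_loc_holder 1 \<epsilon>" and div: "AE t in lebesgue. \<forall>x. divergence (u t) x = 0"
  obtains v N where "AE t in lebesgue. v t = u t" "\<And>t. regular_field (v t) (N t)"
    "\<And>x. (\<lambda>t. v t x) \<in> borel_measurable lebesgue"
    "\<And>i x. (\<lambda>t. partial_deriv i (v t) x) \<in> borel_measurable lebesgue"
    "\<And>a b. N integrable_on {a..b}"
proof -
  note One_nat_def [simp del]
  from u obtain s :: "nat \<Rightarrow> real \<Rightarrow> real^'n \<Rightarrow> real^'n" where
    s: "\<And>m. simple_function lebesgue (s m)" "\<And>m t. s m t \<in> holder_space 1 \<epsilon>"
      "AE t in lebesgue. (\<lambda>m. holder_norm 1 \<epsilon> (\<lambda>x. s m t x - u t x)) \<longlonglongrightarrow> 0"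
    and hs: "AE t in lebesgue. u t \<in> holder_space 1 \<epsilon>"
    and int: "\<And>T. (\<integral>\<^sup>+t\<in>{-T..T}. holder_norm 1 \<epsilon> (u t) \<partial>lebesgue) < \<infinity>"
    unfolding L1_loc_holder_def by blast
  obtain D :: "(real^'n) set" where D: "countable D" "\<And>X. open X \<Longrightarrow> X \<noteq> {} \<Longrightarrow> \<exists>d\<in>D. d \<in> X"
    by (erule countable_dense_setE)
  define good where "good t \<longleftrightarrow> u t \<in> holder_space 1 \<epsilon> \<and> (\<forall>x. divergence (u t) x = 0) \<and>
    (\<lambda>m. holder_norm 1 \<epsilon> (\<lambda>x. s m t x - u t x)) \<longlonglongrightarrow> 0" for t
  have AE_good: "AE t in lebesgue. good t"
    using hs div s(3) by eventually_elim (simp add: good_def)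
  then obtain Z where Z: "Z \<in> null_sets lebesgue" "{t \<in> space lebesgue. \<not> good t} \<subseteq> Z"
    unfolding eventually_ae_filter by blast
  \<comment> \<open>\<open>good\<close> is not visibly measurable; its complement is a subset of a
    null set, and Lebesgue measure is complete.\<close>
  have "{t. \<not> good t} \<in> null_sets lebesgue"
    by (rule null_sets_completion_subset[OF _ Z(1)]) (use Z(2) in simp)
  then have "UNIV - {t. \<not> good t} \<in> sets lebesgue"
    by (intro sets.Diff) (auto simp: null_sets_def)
  then have good_sets [measurable]: "{t. good t} \<in> sets lebesgue" by (simp add: Diff_eq Collect_neg_eq[symmetric])
  have good_pred [measurable]: "Measurable.pred lebesgue good"
    using good_sets by (simp add: pred_def)
  define v where "v t = (if good t then u t else (\<lambda>_. 0))" for t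
  define G where "G f = (SUP x\<in>D. ennreal (norm (f x))) + (\<Sum>i\<in>UNIV. SUP x\<in>D. ennreal (norm (partial_deriv i f x)))"
    for f :: "real^'n \<Rightarrow> real^'n"
  define N where "N t = enn2real (G (v t))" for t
  have diff: "f differentiable (at x)" if "f \<in> holder_space 1 \<epsilon>" for f :: "real^'n \<Rightarrow> real^'n" and x
    using that unfolding holder_space_def One_nat_def by simp
  \<comment> \<open>\<open>F\<close> stands for evaluation of the field, or of a partial derivative,
    at a fixed point.\<close>
  have lim: "(\<lambda>m. F (s m t)) \<longlonglongrightarrow> F (u t)"
    if "good t" and F: "\<And>f g. f \<in> holder_space 1 \<epsilon> \<Longrightarrow> g \<in> holder_space 1 \<epsilon> \<Longrightarrow>
       ennreal (norm (F f - F g)) \<le> holder_norm 1 \<epsilon> (\<lambda>x. f x - g x)" for t and F :: "(real^'n \<Rightarrow> real^'n) \<Rightarrow> real^'n"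
  proof -
    have "(\<lambda>m. ennreal (norm (F (s m t) - F (u t)))) \<longlonglongrightarrow> 0"
    proof -
      have g: "u t \<in> holder_space 1 \<epsilon>" and l: "(\<lambda>m. holder_norm 1 \<epsilon> (\<lambda>x. s m t x - u t x)) \<longlonglongrightarrow> 0"
        using that(1) by (simp_all add: good_def)
      show ?thesis
        by (rule tendsto_sandwich[OF _ _ tendsto_const l]) (auto intro!: always_eventually F s(2) g)
    qed
    then have "(\<lambda>m. norm (F (s m t) - F (u t))) \<longlonglongrightarrow> 0"
      by (simp add: tendsto_ennreal_iff flip: ennreal_0)
    then show ?thesis by (simp add: tendsto_norm_zero_iff LIM_zero_iff)
  qed
  have meas: "(\<lambda>t. F (v t)) \<in> borel_measurable lebesgue"
    if F: "\<And>f g. f \<in> holder_space 1 \<epsilon> \<Longrightarrow> g \<in> holder_space 1 \<epsilon> \<Longrightarrow>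
       ennreal (norm (F f - F g)) \<le> holder_norm 1 \<epsilon> (\<lambda>x. f x - g x)" and F0: "F (\<lambda>_. 0) = 0"
    for F :: "(real^'n \<Rightarrow> real^'n) \<Rightarrow> real^'n"
  proof (rule borel_measurable_LIMSEQ_metric)
    fix m
    have "simple_function lebesgue (\<lambda>t. F (s m t))"
      using simple_function_compose[OF s(1)[of m], of F] by (simp add: comp_def)
    then have [measurable]: "(\<lambda>t. F (s m t)) \<in> borel_measurable lebesgue"
      by (rule borel_measurable_simple_function)
    show "(\<lambda>t. if good t then F (s m t) else 0) \<in> borel_measurable lebesgue" by measurable
  next
    fix t
    show "(\<lambda>m. if good t then F (s m t) else 0) \<longlonglongrightarrow> F (v t)"
    proof (cases "good t")
      case True
      have "(\<lambda>m. F (s m t)) \<longlonglongrightarrow> F (u t)" by (rule lim[OF True]) (rule F)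
      then show ?thesis using True by (simp add: v_def)
    qed (simp add: v_def F0)
  qed
  have mv: "(\<lambda>t. v t x) \<in> borel_measurable lebesgue" for x
  proof (rule meas[of "\<lambda>f. f x"])
    fix f g :: "real^'n \<Rightarrow> real^'n"
    show "ennreal (norm (f x - g x)) \<le> holder_norm 1 \<epsilon> (\<lambda>x. f x - g x)"
      using norm_le_holder_norm(1)[of "\<lambda>x. f x - g x" x \<epsilon>] .
  qed simp
  have mp: "(\<lambda>t. partial_deriv i (v t) x) \<in> borel_measurable lebesgue" for i x
  proof (rule meas[of "\<lambda>f. partial_deriv i f x"])
    fix f g :: "real^'n \<Rightarrow> real^'n" assume "f \<in> holder_space 1 \<epsilon>" "g \<in> holder_space 1 \<epsilon>"
    then show "ennreal (norm (partial_deriv i f x - partial_deriv i g x)) \<le> holder_norm 1 \<epsilon> (\<lambda>x. f x - g x)"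
      using norm_le_holder_norm(2)[where i = i and f = "\<lambda>x. f x - g x" and x = x and \<epsilon> = \<epsilon>] partial_deriv_diff[of f x g i] diff[of f x] diff[of g x] by simp
  qed simp
  have mG: "(\<lambda>t. G (v t)) \<in> borel_measurable lebesgue"
    unfolding G_def using mv mp D(1)
    by (intro borel_measurable_add borel_measurable_sum borel_measurable_SUP) auto
  have Gle: "G (v t) \<le> holder_norm 1 \<epsilon> (u t)" for t
  proof (cases "good t")
    case True then show ?thesis unfolding v_def G_def using norm_le_holder_norm(3)[where D = D and f = "u t" and \<epsilon> = \<epsilon>] by simp
  next
    case False
    obtain d where "d \<in> D" using D(2)[of UNIV] by auto
    then have "D \<noteq> {}" by auto
    then show ?thesis using False by (simp add: v_def G_def)
  qed
  have Gfin: "G (v t) < \<infinity>" for t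
  proof (cases "good t")
    case True
    then have "holder_norm 1 \<epsilon> (u t) < \<infinity>" by (simp add: good_def holder_space_def)
    then show ?thesis using Gle[of t] by (rule le_less_trans[rotated])
  next
    case False
    obtain d where "d \<in> D" using D(2)[of UNIV] by auto
    then have "D \<noteq> {}" by auto
    then show ?thesis using False by (simp add: v_def G_def)
  qed
  have reg: "regular_field (v t) (N t)" for t
  proof (cases "good t")
    case True
    then show ?thesis unfolding N_def using Gfin[of t] unfolding G_def
      by (intro regular_field_C1 D(2)) (auto simp: v_def good_def holder_space_def)
  next
    case False
    obtain d where "d \<in> D" using D(2)[of UNIV] by auto
    then have "D \<noteq> {}" by auto
    then show ?thesis using False regular_field_zero by (simp add: v_def N_def G_def)
  qed
  have mN: "N \<in> borel_measurable lebesgue"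
    unfolding N_def using mG by (rule measurable_compose) simp
  have Nint: "N integrable_on {a..b}" for a b
  proof -
    define T where "T = max \<bar>a\<bar> \<bar>b\<bar>"
    have "set_integrable lebesgue {-T..T} N"
      unfolding set_integrable_def
    proof (rule integrableI_bounded)
      show "(\<lambda>t. indicator {-T..T} t *\<^sub>R N t) \<in> borel_measurable lebesgue"
        by (intro borel_measurable_scaleR borel_measurable_indicator mN) simp
      have "(\<integral>\<^sup>+t. ennreal (norm (indicator {-T..T} t *\<^sub>R N t)) \<partial>lebesgue) \<le>
          (\<integral>\<^sup>+t\<in>{-T..T}. holder_norm 1 \<epsilon> (u t) \<partial>lebesgue)"
        using Gle Gfin by (intro nn_integral_mono) (auto simp: N_def indicator_def less_top)
      also have "\<dots> < \<infinity>" by (rule int)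
      finally show "(\<integral>\<^sup>+t. ennreal (norm (indicator {-T..T} t *\<^sub>R N t)) \<partial>lebesgue) < \<infinity>" .
    qed
    then have "N integrable_on {-T..T}" by (rule absolutely_integrable_on_def[THEN iffD1, THEN conjunct1])
    then show ?thesis by (rule integrable_on_subinterval) (auto simp: T_def)
  qed
  show ?thesis
    by (rule that[OF _ reg mv mp Nint]) (use AE_good in \<open>eventually_elim, simp add: v_def\<close>)
qed

section \<open>The flow of a regular vector field\<close>

locale torus_flow =
  fixes u :: "real \<Rightarrow> real^'n \<Rightarrow> real^'n" and N :: "real \<Rightarrow> real" and X :: "real \<Rightarrow> real^'n \<Rightarrow> real^'n"
  assumes reg: "regular_field (u t) (N t)"
    and meas: "(\<lambda>t. u t x) \<in> borel_measurable lebesgue"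
    and meas_partial: "(\<lambda>t. partial_deriv i (u t) x) \<in> borel_measurable lebesgue"
    and N_integrable: "N integrable_on {a..b}"
    and flow: "is_flow_of u X"
begin

lemma u_periodic: "u t (x + (2 * pi) *\<^sub>R axis i 1) = u t x"
  using reg[of t] by (simp add: regular_field_def torus_periodic_def)

lemma u_bound: "norm (u t x) \<le> N t"
  using reg[of t] by (simp add: regular_field_def)

lemma u_lipschitz: "norm (u t x - u t y) \<le> N t * norm (x - y)"
  using reg[of t] by (simp add: regular_field_def)

lemma u_continuous: "continuous_on S (u t)"
proof -
  have "u t differentiable (at x)" for x using reg[of t] by (simp add: regular_field_def)
  then show ?thesis
    by (intro differentiable_imp_continuous_on) (simp add: differentiable_on_def differentiable_at_withinI)
qed

lemma N_nonneg: "N t \<ge> 0"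
  using u_bound[of t 0] norm_ge_zero order_trans by blast

text \<open>The clock of the flow: it is continuous in its endpoint although \<open>N\<close> is
  only integrable, and plays the role of \<Phi> in the Gronwall lemmas.\<close>

definition mass :: "real \<Rightarrow> real \<Rightarrow> real" where
  "mass a b = integral {a..b} N"

lemma mass_nonneg: "mass a b \<ge> 0"
  unfolding mass_def by (intro integral_nonneg N_integrable) (simp add: N_nonneg)

lemma mass_split: "a \<le> b \<Longrightarrow> b \<le> c \<Longrightarrow> mass a c = mass a b + mass b c"
  unfolding mass_def by (rule Henstock_Kurzweil_Integration.integral_combine[symmetric]) (auto intro: N_integrable)

lemma mass_mono: "p \<le> a \<Longrightarrow> a \<le> b \<Longrightarrow> mass p a \<le> mass p b"
  using mass_split[of p a b] mass_nonneg[of a b] by simp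

lemma mass_continuous: "continuous_on {p..q} (mass p)"
  unfolding mass_def by (intro indefinite_integral_continuous_1 N_integrable)

text \<open>Stated through increments, without an initial time, so that solutions can be compared
  from any time in either direction.\<close>

definition solution :: "(real \<Rightarrow> real^'n) \<Rightarrow> bool" where
  "solution Y \<longleftrightarrow> (\<forall>a b. a \<le> b \<longrightarrow> (\<lambda>s. u s (Y s)) integrable_on {a..b} \<and>
      Y b - Y a = integral {a..b} (\<lambda>s. u s (Y s)))"

lemma solution_X: "solution (\<lambda>s. X s x)"
  using flow by (auto simp: solution_def is_flow_of_def absolutely_integrable_on_def)

lemma X_0 [simp]: "X 0 x = x"
  using flow by (simp add: is_flow_of_def)

lemma solution_displacement:
  assumes "solution Y" "a \<le> b" shows "norm (Y b - Y a) \<le> mass a b"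
  using assms unfolding solution_def mass_def
  by (auto intro!: integral_norm_bound_integral N_integrable u_bound)

lemma solution_continuous: "solution Y \<Longrightarrow> continuous_on {p..q} Y"
proof -
  assume Y: "solution Y"
  show ?thesis
  proof (cases "p \<le> q")
    case True
    have "continuous_on {p..q} (\<lambda>t. Y p + integral {p..t} (\<lambda>s. u s (Y s)))"
      using Y True by (intro continuous_intros indefinite_integral_continuous_1) (simp add: solution_def)
    moreover have "Y p + integral {p..t} (\<lambda>s. u s (Y s)) = Y t" if "t \<in> {p..q}" for t
      using Y that unfolding solution_def by (metis add_diff_cancel_left' atLeastAtMost_iff diff_add_cancel add.commute)
    ultimately show ?thesis by (rule continuous_on_eq)
  qed simp
qed

text \<open>Supplies the increment hypothesis of \<open>gronwall_doubling\<close> for the distance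
  of two solutions.\<close>

lemma solution_difference:
  assumes Y: "solution Y" and Z: "solution Z" and "a \<le> b"
    and M: "\<And>s. a \<le> s \<Longrightarrow> s \<le> b \<Longrightarrow> norm (Y s - Z s) \<le> M"
  shows "\<bar>norm (Y b - Z b) - norm (Y a - Z a)\<bar> \<le> M * mass a b"
proof -
  have iY: "(\<lambda>s. u s (Y s)) integrable_on {a..b}" "Y b - Y a = integral {a..b} (\<lambda>s. u s (Y s))"
    using Y \<open>a \<le> b\<close> by (auto simp: solution_def)
  have iZ: "(\<lambda>s. u s (Z s)) integrable_on {a..b}" "Z b - Z a = integral {a..b} (\<lambda>s. u s (Z s))"
    using Z \<open>a \<le> b\<close> by (auto simp: solution_def)
  have "\<bar>norm (Y b - Z b) - norm (Y a - Z a)\<bar> \<le> norm ((Y b - Y a) - (Z b - Z a))"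
    using norm_triangle_ineq3[of "Y b - Z b" "Y a - Z a"] by (simp add: algebra_simps)
  also have "(Y b - Y a) - (Z b - Z a) = integral {a..b} (\<lambda>s. u s (Y s) - u s (Z s))"
    using iY iZ by (simp add: Henstock_Kurzweil_Integration.integral_diff)
  also have "norm \<dots> \<le> integral {a..b} (\<lambda>s. N s * M)"
  proof (rule integral_norm_bound_integral)
    show "(\<lambda>s. u s (Y s) - u s (Z s)) integrable_on {a..b}"
      using iY iZ by (intro Henstock_Kurzweil_Integration.integrable_diff)
    show "(\<lambda>s. N s * M) integrable_on {a..b}" by (intro integrable_on_mult_left N_integrable)
    show "norm (u s (Y s) - u s (Z s)) \<le> N s * M" if "s \<in> {a..b}" for s
      using u_lipschitz[of s "Y s" "Z s"] mult_left_mono[OF M N_nonneg, of s s] that by auto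
  qed
  finally show ?thesis by (simp add: mass_def mult.commute)
qed

text \<open>\<open>gronwall_doubling\<close> with \<open>mass p\<close> as clock and
  \<open>K = 2 ^ n\<close>, where \<open>n / 2\<close> is at least the total mass. The bound in both
  time directions gives uniqueness backward in time and thus injectivity of the flow.\<close>

lemma solution_compare:
  assumes "p \<le> q"
  obtains K where "K \<ge> 1" "\<And>Y Z a b. solution Y \<Longrightarrow> solution Z \<Longrightarrow> p \<le> a \<Longrightarrow> a \<le> q \<Longrightarrow> p \<le> b \<Longrightarrow> b \<le> q \<Longrightarrow>
     norm (Y b - Z b) \<le> K * norm (Y a - Z a)"
proof -
  obtain n :: nat where n: "2 * mass p q \<le> real n" using real_arch_simple by blast
  have "norm (Y b - Z b) \<le> 2 ^ n * norm (Y a - Z a) \<and> norm (Y a - Z a) \<le> 2 ^ n * norm (Y b - Z b)"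
    if "solution Y" "solution Z" "p \<le> a" "a \<le> b" "b \<le> q" for Y Z a b
  proof (rule gronwall_doubling[of p q "mass p" "\<lambda>s. norm (Y s - Z s)"])
    show "continuous_on {p..q} (\<lambda>s. norm (Y s - Z s))"
      by (intro continuous_intros solution_continuous that)
    show "\<bar>norm (Y d - Z d) - norm (Y c - Z c)\<bar> \<le> M * (mass p d - mass p c)"
      if "p \<le> c" "c \<le> d" "d \<le> q" "\<And>s. c \<le> s \<Longrightarrow> s \<le> d \<Longrightarrow> norm (Y s - Z s) \<le> M" for c d M
      using solution_difference[OF \<open>solution Y\<close> \<open>solution Z\<close> that(2,4)] mass_split[OF that(1,2)] by simp
    show "mass p b - mass p a \<le> real n / 2"
      using mass_split[of p b q] mass_nonneg[of b q] mass_nonneg[of p a] n that by simp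
  qed (use that in \<open>auto intro: mass_continuous mass_mono\<close>)
  then have "norm (Y b - Z b) \<le> 2 ^ n * norm (Y a - Z a)"
    if "solution Y" "solution Z" "p \<le> a" "a \<le> q" "p \<le> b" "b \<le> q" for Y Z a b
    using that by (cases "a \<le> b") (force, metis linear)
  then show ?thesis by (intro that[of "2 ^ n"]) auto
qed

lemma solution_unique:
  assumes "solution Y" "solution Z" "Y a = Z a" shows "Y b = Z b"
proof -
  have ab: "min a b \<le> max a b" by simp
  obtain K where K: "K \<ge> 1" "\<And>Y Z c d. solution Y \<Longrightarrow> solution Z \<Longrightarrow> min a b \<le> c \<Longrightarrow> c \<le> max a b \<Longrightarrow>
      min a b \<le> d \<Longrightarrow> d \<le> max a b \<Longrightarrow> norm (Y d - Z d) \<le> K * norm (Y c - Z c)"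
    by (rule solution_compare[OF ab]) (rule that)
  from K(2)[OF assms(1,2), of a b] show ?thesis using assms by simp
qed

lemma X_injective: "X t x = X t y \<Longrightarrow> x = y"
  using solution_unique[OF solution_X solution_X, where a = t and b = 0] by simp

lemma X_continuous: "continuous_on S (X t)"
proof -
  have ab: "min 0 t \<le> max 0 t" by simp
  obtain K where K: "K \<ge> 1" "\<And>Y Z c d. solution Y \<Longrightarrow> solution Z \<Longrightarrow> min 0 t \<le> c \<Longrightarrow> c \<le> max 0 t \<Longrightarrow>
      min 0 t \<le> d \<Longrightarrow> d \<le> max 0 t \<Longrightarrow> norm (Y d - Z d) \<le> K * norm (Y c - Z c)"
    by (rule solution_compare[OF ab]) (rule that)
  have "dist (X t x) (X t y) \<le> K * dist x y" for x y
    using K(2)[OF solution_X[of x] solution_X[of y], of 0 t] by (simp add: dist_norm)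
  then have "K-lipschitz_on S (X t)" using K(1) by (intro lipschitz_onI) auto
  then show ?thesis by (rule lipschitz_on_continuous_on)
qed

lemma X_displacement: "norm (X t x - x) \<le> mass (min 0 t) (max 0 t)"
proof (cases "0 \<le> t")
  case True
  then show ?thesis using solution_displacement[OF solution_X, of 0 t x] by simp
next
  case False
  then show ?thesis using solution_displacement[OF solution_X, of t 0 x] by (simp add: norm_minus_commute)
qed

text \<open>Only the trajectories starting at time 0 are given, so none through \<open>y\<close> at
  time \<open>t\<close> is at hand. A point that reaches \<open>y\<close> is a fixed point of
  \<open>y - (X t x - x)\<close>, and Brouwer applies because displacements are bounded
  uniformly.\<close>

lemma X_surjective: "\<exists>x. X t x = y"
proof -
  define M where "M = mass (min 0 t) (max 0 t)"
  have M0: "M \<ge> 0" by (simp add: M_def mass_nonneg)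
  obtain x where "x \<in> cball y M" "y - (X t x - x) = x"
  proof (rule brouwer[of "cball y M" "\<lambda>x. y - (X t x - x)"])
    show "continuous_on (cball y M) (\<lambda>x. y - (X t x - x))" by (intro continuous_intros X_continuous)
    show "(\<lambda>x. y - (X t x - x)) \<in> cball y M \<rightarrow> cball y M"
      using X_displacement by (auto simp: M_def dist_norm)
  qed (use M0 in auto)
  then show ?thesis by (intro exI[of _ x]) (simp add: algebra_simps)
qed

lemma X_bij: "bij (X t)"
  using X_injective X_surjective by (auto simp: bij_def inj_def surj_def) metis

lemma X_inv [simp]: "X t (inv (X t) y) = y" "inv (X t) (X t x) = x"
  using X_bij[of t] by (simp_all add: bij_is_surj surj_f_inv_f bij_is_inj)

lemma X_translate: "X t (x + (2 * pi) *\<^sub>R axis i 1) = X t x + (2 * pi) *\<^sub>R axis i 1"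
proof -
  have "solution (\<lambda>s. X s x + (2 * pi) *\<^sub>R axis i 1)"
    using solution_X[of x] by (simp add: solution_def u_periodic)
  from solution_unique[OF solution_X this, where a = 0] show ?thesis by simp
qed

definition transition :: "real \<Rightarrow> real \<Rightarrow> real^'n \<Rightarrow> real^'n" where
  "transition a b x = X b (inv (X a) x)"

lemma transition_comp: "transition b c (transition a b x) = transition a c x"
  by (simp add: transition_def)

lemma transition_self [simp]: "transition a a x = x"
  by (simp add: transition_def)

lemma transition_from_0: "transition 0 t = X t"
proof -
  have "inv (X 0) x = x" for x using X_inv(2)[of 0 x] by simp
  then show ?thesis by (simp add: fun_eq_iff transition_def)
qed

lemma transition_to_0: "transition t 0 = inv (X t)"
  by (simp add: fun_eq_iff transition_def)

lemma transition_displacement: "a \<le> b \<Longrightarrow> norm (transition a b x - x) \<le> mass a b"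
  using solution_displacement[OF solution_X, of a b "inv (X a) x"] by (simp add: transition_def)

lemma transition_lipschitz:
  assumes "p \<le> q"
  obtains K where "K \<ge> 1" "\<And>a b x y. p \<le> a \<Longrightarrow> a \<le> q \<Longrightarrow> p \<le> b \<Longrightarrow> b \<le> q \<Longrightarrow>
     norm (transition a b x - transition a b y) \<le> K * norm (x - y)"
proof -
  obtain K where K: "K \<ge> 1" "\<And>Y Z a b. solution Y \<Longrightarrow> solution Z \<Longrightarrow> p \<le> a \<Longrightarrow> a \<le> q \<Longrightarrow> p \<le> b \<Longrightarrow> b \<le> q \<Longrightarrow>
     norm (Y b - Z b) \<le> K * norm (Y a - Z a)"
    by (rule solution_compare[OF assms]) (rule that)
  have "norm (transition a b x - transition a b y) \<le> K * norm (x - y)"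
    if "p \<le> a" "a \<le> q" "p \<le> b" "b \<le> q" for a b x y
    using K(2)[OF solution_X[of "inv (X a) x"] solution_X[of "inv (X a) y"] that]
    by (simp add: transition_def)
  with K(1) that show ?thesis by blast
qed

lemma transition_continuous: "continuous_on S (transition a b)"
proof -
  have ab: "min a b \<le> max a b" by simp
  obtain K where K: "K \<ge> 1" "\<And>c d x y. min a b \<le> c \<Longrightarrow> c \<le> max a b \<Longrightarrow> min a b \<le> d \<Longrightarrow> d \<le> max a b \<Longrightarrow>
      norm (transition c d x - transition c d y) \<le> K * norm (x - y)"
    by (rule transition_lipschitz[OF ab]) (rule that)
  have "norm (transition a b x - transition a b y) \<le> K * norm (x - y)" for x y by (rule K(2)) auto
  with K(1) have "K-lipschitz_on S (transition a b)" by (intro lipschitz_onI) (auto simp: dist_norm)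
  then show ?thesis by (rule lipschitz_on_continuous_on)
qed

lemma transition_periodic: "torus_periodic (\<lambda>x. transition a b x - x)"
proof -
  have "inv (X a) (x + (2 * pi) *\<^sub>R axis i 1) = inv (X a) x + (2 * pi) *\<^sub>R axis i 1" for x i
    by (rule X_injective[of a]) (simp add: X_translate)
  then show ?thesis by (simp add: torus_periodic_def transition_def X_translate)
qed

end

subsection \<open>Preservation of volume\<close>

lemma integrable_lborel_compact_support:
  fixes f :: "'a::euclidean_space \<Rightarrow> real"
  assumes "continuous_on UNIV f" "\<And>x. norm x > R \<Longrightarrow> f x = 0"
  shows "integrable lborel f"
proof -
  have "integrable lborel (\<lambda>x. indicator (cball 0 R) x *\<^sub>R f x)"
    by (intro borel_integrable_compact compact_cball continuous_on_subset[OF assms(1)]) simp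
  moreover have "(\<lambda>x. indicator (cball 0 R) x *\<^sub>R f x) = f"
    using assms(2) by (auto simp: fun_eq_iff indicator_def not_le)
  ultimately show ?thesis by simp
qed

lemma integral_lborel_compact_support_le:
  fixes f :: "'a::euclidean_space \<Rightarrow> real"
  assumes f: "continuous_on UNIV f" "\<And>x. norm x > R \<Longrightarrow> f x = 0" and "\<And>x. \<bar>f x\<bar> \<le> c"
  shows "\<bar>LINT x|lborel. f x\<bar> \<le> c * measure lborel (cball (0::'a) R)"
proof -
  have "\<bar>LINT x|lborel. f x\<bar> \<le> (LINT x|lborel. \<bar>f x\<bar>)" by (rule integral_abs_bound)
  also have "\<dots> \<le> (LINT x|lborel. c * indicator (cball (0::'a) R) x)"
  proof (rule integral_mono)
    show "integrable lborel (\<lambda>x. \<bar>f x\<bar>)" using integrable_lborel_compact_support[OF f] by simp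
    show "integrable lborel (\<lambda>x. c * indicator (cball (0::'a) R) x)"
      by (intro integrable_mult_right integrable_real_indicator emeasure_lborel_cball_finite) simp
    show "\<bar>f x\<bar> \<le> c * indicator (cball (0::'a) R) x" for x
      using assms(3)[of x] f(2)[of x] by (auto simp: indicator_def)
  qed
  also have "\<dots> = c * measure lborel (cball (0::'a) R)" by simp
  finally show ?thesis .
qed

text \<open>\<open>nn_integral_shear\<close> with the Jacobian multiplied out; the last term is the
  change of volume, to be summed over the axes.\<close>

lemma integral_shear:
  fixes G p g :: "real^'n \<Rightarrow> real"
  assumes G: "continuous_on UNIV G" "\<And>x. G x \<ge> 0" "\<And>x. norm x > R \<Longrightarrow> G x = 0"
    and p: "continuous_on UNIV p" "\<And>x. \<bar>p x\<bar> \<le> B"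
      "\<And>y s. ((\<lambda>s. p (y + s *\<^sub>R axis i 1)) has_real_derivative g (y + s *\<^sub>R axis i 1)) (at s)"
    and g: "continuous_on UNIV g" "\<And>x. 1 + g x \<ge> 0"
  shows "(LINT x|lborel. G (x + p x *\<^sub>R axis i 1)) =
    (LINT x|lborel. G x) - (LINT x|lborel. G (x + p x *\<^sub>R axis i 1) * g x)"
proof -
  have c: "continuous_on UNIV (\<lambda>x. G (x + p x *\<^sub>R axis i 1))"
    by (rule continuous_on_compose2[OF G(1)]) (auto intro!: continuous_intros p)
  have s: "G (x + p x *\<^sub>R axis i 1) = 0" if "norm x > R + B" for x
  proof (rule G(3))
    have "norm x \<le> norm (x + p x *\<^sub>R axis i 1) + norm (p x *\<^sub>R axis i (1::real))"
      using norm_triangle_ineq4[of "x + p x *\<^sub>R axis i 1" "p x *\<^sub>R axis i 1"] by simp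
    then show "R < norm (x + p x *\<^sub>R axis i 1)" using that p(2)[of x] by (simp add: norm_axis_1)
  qed
  have i1: "integrable lborel (\<lambda>x. G (x + p x *\<^sub>R axis i 1))"
    by (rule integrable_lborel_compact_support[OF c s])
  have i2: "integrable lborel (\<lambda>x. G (x + p x *\<^sub>R axis i 1) * g x)"
    by (rule integrable_lborel_compact_support[of _ "R + B"]) (auto intro!: continuous_intros c g s)
  have i3: "integrable lborel (\<lambda>x. G (x + p x *\<^sub>R axis i 1) * (1 + g x))"
    using Bochner_Integration.integrable_add[OF i1 i2] by (simp add: algebra_simps)
  have "(LINT x|lborel. G (x + p x *\<^sub>R axis i 1) * (1 + g x)) =
      enn2real (\<integral>\<^sup>+x. ennreal (G (x + p x *\<^sub>R axis i 1) * (1 + g x)) \<partial>lborel)"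
    using i3 G(2) g(2) by (intro integral_eq_nn_integral) (auto intro!: AE_I2)
  also have "\<dots> = enn2real (\<integral>\<^sup>+x. ennreal (G x) \<partial>lborel)"
    by (simp only: nn_integral_shear[OF G p g])
  also have "\<dots> = (LINT x|lborel. G x)"
    using integrable_lborel_compact_support[OF G(1,3)] G(2) by (intro integral_eq_nn_integral[symmetric]) auto
  finally show ?thesis using i1 i2 by (simp add: distrib_left)
qed

lemma partial_deriv_DERIV:
  fixes f :: "real^'n \<Rightarrow> real^'m"
  assumes "f differentiable (at x)"
  shows "((\<lambda>h. f (x + h *\<^sub>R axis i 1) $ j) has_real_derivative partial_deriv i f x $ j) (at 0)"
proof -
  have f: "(f has_derivative frechet_derivative f (at x)) (at (x + 0 *\<^sub>R axis i 1))"
    using assms by (simp add: frechet_derivative_works)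
  have "((\<lambda>h. x + h *\<^sub>R axis i (1::real)) has_derivative (\<lambda>h. h *\<^sub>R axis i 1)) (at 0)"
    by (auto intro!: derivative_eq_intros)
  from diff_chain_at[OF this f]
  have "((\<lambda>h. f (x + h *\<^sub>R axis i 1)) has_derivative (\<lambda>h. frechet_derivative f (at x) (h *\<^sub>R axis i 1))) (at 0)"
    by (simp add: comp_def)
  from bounded_linear.has_derivative[OF bounded_linear_vec_nth this, of j]
  have "((\<lambda>h. f (x + h *\<^sub>R axis i 1) $ j) has_derivative (\<lambda>h. frechet_derivative f (at x) (h *\<^sub>R axis i 1) $ j)) (at 0)" .
  moreover have "(\<lambda>h. frechet_derivative f (at x) (h *\<^sub>R axis i 1) $ j) = (*) (partial_deriv i f x $ j)"
    by (rule ext) (simp add: partial_deriv_def linear_scale[OF linear_frechet_derivative[OF assms]] mult.commute)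
  ultimately show ?thesis by (simp add: has_field_derivative_def)
qed

section \<open>Drifts at a frozen position and splitting into shears\<close>

context torus_flow
begin

lemma u_differentiable: "u t differentiable (at x)"
  using reg[of t] by (simp add: regular_field_def)

lemma partial_continuous: "continuous_on S (partial_deriv i (u t))"
  using reg[of t] continuous_on_subset[of UNIV "partial_deriv i (u t)" S] by (simp add: regular_field_def)

lemma partial_bound: "norm (partial_deriv i (u t) x) \<le> N t"
  using reg[of t] by (simp add: regular_field_def)

lemma u_divergence: "(\<Sum>i\<in>UNIV. partial_deriv i (u t) x $ i) = 0"
  using reg[of t] by (simp add: regular_field_def divergence_def)

lemma dominated_integrable:
  fixes f :: "real \<Rightarrow> 'a::euclidean_space"
  assumes "f \<in> borel_measurable lebesgue" "\<And>r. norm (f r) \<le> N r"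
  shows "f integrable_on {a..b}"
proof (rule measurable_bounded_by_integrable_imp_integrable[where g = N])
  show "f \<in> borel_measurable (lebesgue_on {a..b})" using assms(1) by (rule measurable_restrict_space1)
qed (use assms N_integrable in auto)

lemma component_measurable:
  "(\<lambda>r. u r x $ i) \<in> borel_measurable lebesgue" "(\<lambda>r. partial_deriv j (u r) x $ i) \<in> borel_measurable lebesgue"
  using meas[of x] meas_partial[of j x]
  by (auto intro: measurable_compose[OF _ borel_measurable_nth])

lemma component_bound: "norm (u r x $ i) \<le> N r" "norm (partial_deriv j (u r) x $ i) \<le> N r"
  using order_trans[OF component_le_norm_cart u_bound] order_trans[OF component_le_norm_cart partial_bound] by auto

text \<open>The displacement of component \<open>i\<close> during \<open>{a..b}\<close> if the
  position stayed at \<open>x\<close>. Integrating in time first gives a function with a continuous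
  derivative along axis \<open>i\<close>, which is what the shear lemmas require.\<close>

definition drift :: "real \<Rightarrow> real \<Rightarrow> 'n \<Rightarrow> real^'n \<Rightarrow> real" where
  "drift a b i x = integral {a..b} (\<lambda>r. u r x $ i)"

definition drift_deriv :: "real \<Rightarrow> real \<Rightarrow> 'n \<Rightarrow> real^'n \<Rightarrow> real" where
  "drift_deriv a b i x = integral {a..b} (\<lambda>r. partial_deriv i (u r) x $ i)"

lemma component_integrable:
  "(\<lambda>r. u r x $ i) integrable_on {a..b}" "(\<lambda>r. partial_deriv j (u r) x $ i) integrable_on {a..b}"
  by (auto intro!: dominated_integrable component_measurable component_bound)

lemma drift_bound: "\<bar>drift a b i x\<bar> \<le> mass a b"
  unfolding drift_def mass_def real_norm_def[symmetric]
  by (rule integral_norm_bound_integral[OF component_integrable(1) N_integrable component_bound(1)])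

lemma drift_deriv_bound: "\<bar>drift_deriv a b i x\<bar> \<le> mass a b"
  unfolding drift_deriv_def mass_def real_norm_def[symmetric]
  by (rule integral_norm_bound_integral[OF component_integrable(2) N_integrable component_bound(2)])

lemma drift_lipschitz: "\<bar>drift a b i x - drift a b i y\<bar> \<le> mass a b * norm (x - y)"
proof -
  have "norm (integral {a..b} (\<lambda>r. u r x $ i - u r y $ i)) \<le> integral {a..b} (\<lambda>r. N r * norm (x - y))"
  proof (rule integral_norm_bound_integral)
    show "(\<lambda>r. u r x $ i - u r y $ i) integrable_on {a..b}"
      by (intro Henstock_Kurzweil_Integration.integrable_diff component_integrable)
    show "(\<lambda>r. N r * norm (x - y)) integrable_on {a..b}" by (intro integrable_on_mult_left N_integrable)
    show "norm (u r x $ i - u r y $ i) \<le> N r * norm (x - y)" for r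
      using order_trans[OF component_le_norm_cart u_lipschitz, of r x y i] by simp
  qed
  then show ?thesis
    by (simp add: drift_def mass_def Henstock_Kurzweil_Integration.integral_diff component_integrable)
qed

lemma drift_continuous: "continuous_on S (drift a b i)"
proof -
  have "(mass a b)-lipschitz_on S (drift a b i)"
    using drift_lipschitz mass_nonneg by (intro lipschitz_onI) (auto simp: dist_norm)
  then show ?thesis by (rule lipschitz_on_continuous_on)
qed

text \<open>Differentiation under the integral: \<open>N\<close> dominates the difference quotients
  by the Lipschitz bound.\<close>

lemma drift_has_derivative:
  "((\<lambda>s. drift a b i (y + s *\<^sub>R axis i 1)) has_real_derivative drift_deriv a b i (y + s *\<^sub>R axis i 1)) (at s)"
proof -
  define x where "x = y + s *\<^sub>R axis i (1::real)"
  have "((\<lambda>h. (drift a b i (x + h *\<^sub>R axis i 1) - drift a b i x) / h) \<longlongrightarrow> drift_deriv a b i x) (at 0)"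
    unfolding tendsto_at_iff_sequentially
  proof (intro allI impI)
    fix h :: "nat \<Rightarrow> real" assume h: "\<forall>n. h n \<in> UNIV - {0}" "h \<longlonglongrightarrow> 0"
    let ?f = "\<lambda>n r. (u r (x + h n *\<^sub>R axis i 1) $ i - u r x $ i) / h n"
    have int: "?f n integrable_on {a..b}" for n
      by (intro integrable_on_divide Henstock_Kurzweil_Integration.integrable_diff component_integrable)
    have "(\<lambda>n. integral {a..b} (?f n)) \<longlonglongrightarrow> integral {a..b} (\<lambda>r. partial_deriv i (u r) x $ i)"
    proof (rule dominated_convergence(2)[OF int N_integrable])
      fix n r
      have "\<bar>u r (x + h n *\<^sub>R axis i 1) $ i - u r x $ i\<bar> \<le> N r * norm (h n *\<^sub>R axis i (1::real))"
        using order_trans[OF component_le_norm_cart u_lipschitz, of r "x + h n *\<^sub>R axis i 1" x i] by simp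
      then show "norm (?f n r) \<le> N r" using h by (simp add: field_simps norm_axis_1 abs_mult)
    next
      fix r
      have "((\<lambda>h. (u r (x + h *\<^sub>R axis i 1) $ i - u r x $ i) / h) \<longlongrightarrow> partial_deriv i (u r) x $ i) (at 0)"
        using partial_deriv_DERIV[OF u_differentiable[of r x], of i i] by (simp add: DERIV_def)
      then show "(\<lambda>n. ?f n r) \<longlonglongrightarrow> partial_deriv i (u r) x $ i"
        using h unfolding tendsto_at_iff_sequentially by (auto simp: comp_def)
    qed
    moreover have "integral {a..b} (?f n) = (drift a b i (x + h n *\<^sub>R axis i 1) - drift a b i x) / h n" for n
      by (simp add: drift_def Henstock_Kurzweil_Integration.integral_diff component_integrable)
    ultimately show "((\<lambda>h. (drift a b i (x + h *\<^sub>R axis i 1) - drift a b i x) / h) \<circ> h) \<longlonglongrightarrow> drift_deriv a b i x"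
      by (simp only: comp_def drift_deriv_def)
  qed
  then show ?thesis by (simp add: DERIV_def x_def scaleR_add_left add.assoc)
qed

lemma drift_deriv_continuous: "continuous_on S (drift_deriv a b i)"
  unfolding continuous_on_sequentially
proof (intro allI ballI impI)
  fix z x assume z: "x \<in> S" "(\<forall>n. z n \<in> S) \<and> z \<longlonglongrightarrow> x"
  have "(\<lambda>n. integral {a..b} (\<lambda>r. partial_deriv i (u r) (z n) $ i)) \<longlonglongrightarrow> integral {a..b} (\<lambda>r. partial_deriv i (u r) x $ i)"
  proof (rule dominated_convergence(2)[OF component_integrable(2) N_integrable component_bound(2)])
    fix r
    have "(\<lambda>n. partial_deriv i (u r) (z n)) \<longlonglongrightarrow> partial_deriv i (u r) x"
      using partial_continuous[of UNIV i r] z by (auto simp: continuous_on_sequentially comp_def)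
    then show "(\<lambda>n. partial_deriv i (u r) (z n) $ i) \<longlonglongrightarrow> partial_deriv i (u r) x $ i" by (rule tendsto_vec_nth)
  qed
  then show "(drift_deriv a b i \<circ> z) \<longlonglongrightarrow> drift_deriv a b i x" by (simp add: comp_def drift_deriv_def)
qed

lemma sum_drift_deriv: "(\<Sum>i\<in>UNIV. drift_deriv a b i x) = 0"
proof -
  have "(\<Sum>i\<in>UNIV. drift_deriv a b i x) = integral {a..b} (\<lambda>r. \<Sum>i\<in>UNIV. partial_deriv i (u r) x $ i)"
    unfolding drift_deriv_def by (intro integral_sum[symmetric] component_integrable) simp
  then show ?thesis by (simp add: u_divergence)
qed

text \<open>During the step a trajectory moves by at most \<open>mass a b\<close>, and the Lipschitz
  bound turns this into an error with density \<open>N s * mass a b\<close>.\<close>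

lemma transition_euler:
  assumes "a \<le> b"
  shows "norm (transition a b x - (x + (\<chi> i. drift a b i x))) \<le> (mass a b)\<^sup>2"
proof -
  define Y where "Y s = X s (inv (X a) x)" for s
  have Y: "solution Y" unfolding Y_def by (rule solution_X)
  have Ya: "Y a = x" "Y b = transition a b x" by (simp_all add: Y_def transition_def)
  have iY: "(\<lambda>s. u s (Y s)) integrable_on {a..b}" "Y b - Y a = integral {a..b} (\<lambda>s. u s (Y s))"
    using Y \<open>a \<le> b\<close> by (auto simp: solution_def)
  have ix: "(\<lambda>s. u s x) integrable_on {a..b}" by (intro dominated_integrable meas u_bound)
  have "(\<chi> i. drift a b i x) = integral {a..b} (\<lambda>s. u s x)"
    unfolding drift_def vec_eq_iff using integral_component_eq_cart[OF ix] by simp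
  then have "transition a b x - (x + (\<chi> i. drift a b i x)) = integral {a..b} (\<lambda>s. u s (Y s) - u s x)"
    using iY ix Ya by (simp add: Henstock_Kurzweil_Integration.integral_diff algebra_simps)
  also have "norm \<dots> \<le> integral {a..b} (\<lambda>s. N s * mass a b)"
  proof (rule integral_norm_bound_integral)
    show "(\<lambda>s. u s (Y s) - u s x) integrable_on {a..b}"
      by (intro Henstock_Kurzweil_Integration.integrable_diff iY ix)
    show "(\<lambda>s. N s * mass a b) integrable_on {a..b}" by (intro integrable_on_mult_left N_integrable)
    fix s assume s: "s \<in> {a..b}"
    have "norm (Y s - Y a) \<le> mass a b"
      using solution_displacement[OF Y, of a s] mass_mono[of a s b] s by auto
    then show "norm (u s (Y s) - u s x) \<le> N s * mass a b"
      using u_lipschitz[of s "Y s" x] mult_left_mono[OF _ N_nonneg] Ya by (metis order_trans)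
  qed
  finally show ?thesis by (simp add: mass_def power2_eq_square)
qed

text \<open>The time step is split into shears parallel to the coordinate axes. Up to terms of second
  order, the volume changes caused by the shears add up to the divergence.\<close>

definition shear :: "real \<Rightarrow> real \<Rightarrow> 'n \<Rightarrow> real^'n \<Rightarrow> real^'n" where
  "shear a b i x = x + drift a b i x *\<^sub>R axis i 1"

lemma shear_continuous: "continuous_on S (shear a b i)"
  unfolding shear_def by (intro continuous_intros drift_continuous)

lemma shear_displacement: "norm (shear a b i x - x) \<le> mass a b"
  using drift_bound by (simp add: shear_def norm_axis_1)

lemma fold_shear_continuous: "continuous_on S (fold (shear a b) l)"
proof (induction l arbitrary: S)
  case (Cons j l)
  then show ?case
    using continuous_on_compose[OF shear_continuous[of S a b j], of "fold (shear a b) l"] by simp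
qed (simp add: id_def)

lemma fold_shear_displacement: "norm (fold (shear a b) l x - x) \<le> real (length l) * mass a b"
proof (induction l arbitrary: x)
  case (Cons j l)
  have "norm (fold (shear a b) (j # l) x - x) \<le>
      norm (fold (shear a b) l (shear a b j x) - shear a b j x) + norm (shear a b j x - x)"
    using norm_triangle_ineq[of "fold (shear a b) l (shear a b j x) - shear a b j x" "shear a b j x - x"] by simp
  also have "\<dots> \<le> real (length l) * mass a b + mass a b"
    by (intro add_mono Cons shear_displacement)
  finally show ?case by (simp add: distrib_right)
qed simp

text \<open>Each shear moves the point by at most \<open>mass a b\<close>, which alters every later
  drift by at most \<open>(mass a b)\<^sup>2\<close>; there are at most
  \<open>(length l)\<^sup>2\<close> such pairs of shears.\<close>

lemma fold_shear_euler:
  "norm (fold (shear a b) l x - (x + (\<Sum>j\<leftarrow>l. drift a b j x *\<^sub>R axis j 1))) \<le> (real (length l))\<^sup>2 * (mass a b)\<^sup>2"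
proof (induction l arbitrary: x)
  case (Cons j l)
  define z where "z = shear a b j x"
  let ?m = "mass a b" and ?n = "real (length l)"
  have z: "norm (z - x) \<le> ?m" using shear_displacement by (simp add: z_def)
  have d: "norm (drift a b k z *\<^sub>R axis k (1::real) - drift a b k x *\<^sub>R axis k 1) \<le> ?m\<^sup>2" for k
  proof -
    have "norm (drift a b k z *\<^sub>R axis k (1::real) - drift a b k x *\<^sub>R axis k 1) = \<bar>drift a b k z - drift a b k x\<bar>"
      by (simp add: norm_axis_1 flip: scaleR_diff_left)
    also have "\<dots> \<le> ?m * norm (z - x)" by (rule drift_lipschitz)
    also have "\<dots> \<le> ?m * ?m" by (intro mult_left_mono z mass_nonneg)
    finally show ?thesis by (simp add: power2_eq_square)
  qed
  have sum: "norm ((\<Sum>k\<leftarrow>l. drift a b k z *\<^sub>R axis k (1::real)) - (\<Sum>k\<leftarrow>l. drift a b k x *\<^sub>R axis k 1)) \<le> ?n * ?m\<^sup>2"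
  proof (induction l)
    case (Cons k l)
    have "norm ((\<Sum>k\<leftarrow>k # l. drift a b k z *\<^sub>R axis k (1::real)) - (\<Sum>k\<leftarrow>k # l. drift a b k x *\<^sub>R axis k 1))
      \<le> norm (drift a b k z *\<^sub>R axis k (1::real) - drift a b k x *\<^sub>R axis k 1) +
        norm ((\<Sum>k\<leftarrow>l. drift a b k z *\<^sub>R axis k (1::real)) - (\<Sum>k\<leftarrow>l. drift a b k x *\<^sub>R axis k 1))"
      by (rule order_trans[OF _ norm_triangle_ineq]) (simp add: algebra_simps)
    then show ?case using d[of k] Cons by (simp add: distrib_right)
  qed simp
  have "norm (fold (shear a b) (j # l) x - (x + (\<Sum>k\<leftarrow>j # l. drift a b k x *\<^sub>R axis k 1))) \<le>
    norm (fold (shear a b) l z - (z + (\<Sum>k\<leftarrow>l. drift a b k z *\<^sub>R axis k 1))) +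
    norm ((\<Sum>k\<leftarrow>l. drift a b k z *\<^sub>R axis k (1::real)) - (\<Sum>k\<leftarrow>l. drift a b k x *\<^sub>R axis k 1))"
    by (rule order_trans[OF _ norm_triangle_ineq]) (simp add: z_def shear_def algebra_simps)
  also have "\<dots> \<le> ?n\<^sup>2 * ?m\<^sup>2 + ?n * ?m\<^sup>2" by (intro add_mono Cons sum)
  also have "\<dots> \<le> (real (length (j # l)))\<^sup>2 * ?m\<^sup>2"
    by (simp add: power2_sum distrib_right add_nonneg_nonneg power2_eq_square algebra_simps)
  finally show ?case .
qed simp

end

lemma compact_support_perturb:
  fixes H :: "real^'n \<Rightarrow> real"
  assumes "\<And>x. norm x > R \<Longrightarrow> H x = 0" "norm (y - x) \<le> D" "norm x > R + D"
  shows "H y = 0"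
proof (rule assms(1))
  have "norm x \<le> norm y + norm (y - x)" using norm_triangle_sub[of x y] by (simp add: norm_minus_commute)
  then show "R < norm y" using assms(2,3) by linarith
qed

section \<open>Invariance of Lebesgue measure under the flow\<close>

context torus_flow
begin

context
  fixes H :: "real^'n \<Rightarrow> real" and L R :: real and a b :: real
  assumes H_nonneg: "\<And>x. H x \<ge> 0" and H_lipschitz: "\<And>x y. \<bar>H x - H y\<bar> \<le> L * norm (x - y)"
    and H_support: "\<And>x. norm x > R \<Longrightarrow> H x = 0" and small: "mass a b \<le> 1 / 2" and ab: "a \<le> b"
begin

lemma L_nonneg: "L \<ge> 0"
proof -
  have "0 \<le> \<bar>H (axis (undefined::'n) 1) - H 0\<bar>" by simp
  also have "\<dots> \<le> L * norm (axis (undefined::'n) (1::real) - 0)" by (rule H_lipschitz)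
  finally show ?thesis by (simp add: norm_axis_1)
qed

lemma H_continuous: "continuous_on S H"
proof -
  have "L-lipschitz_on S H" using H_lipschitz L_nonneg by (intro lipschitz_onI) (auto simp: dist_norm)
  then show ?thesis by (rule lipschitz_on_continuous_on)
qed

lemma fold_shear_support:
  "length l \<le> CARD('n) \<Longrightarrow> norm x > R + real CARD('n) \<Longrightarrow> H (fold (shear a b) l x) = 0"
proof (rule compact_support_perturb[OF H_support _ ])
  assume l: "length l \<le> CARD('n)"
  have "real (length l) * mass a b \<le> real CARD('n) * 1"
    using l small mass_nonneg by (intro mult_mono) auto
  then show "norm (fold (shear a b) l x - x) \<le> real CARD('n)"
    using fold_shear_displacement[of a b l x] by simp
qed

text \<open>Induction on the list: \<open>integral_shear\<close> exposes the volume change of one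
  shear, with the sheared function \<open>F\<close> as weight. Replacing \<open>F\<close> by
  \<open>H\<close> costs only second order, because \<open>H - F\<close> and
  \<open>drift_deriv\<close> are both of the order of \<open>mass a b\<close>.\<close>

lemma fold_shear_integral:
  "length l \<le> CARD('n) \<Longrightarrow>
    \<bar>(LINT x|lborel. H (fold (shear a b) l x)) - (LINT x|lborel. H x) +
      (\<Sum>j\<leftarrow>l. LINT x|lborel. H x * drift_deriv a b j x)\<bar> \<le> (real (length l))\<^sup>2 * L * (mass a b)\<^sup>2 * measure lborel (cball (0::real^'n) (R + real CARD('n)))"
proof (induction l)
  case (Cons j l)
  let ?m = "mass a b" and ?n = "real (length l)"
  define G where "G x = H (fold (shear a b) l x)" for x
  define F where "F x = H (fold (shear a b) (j # l) x)" for x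
  have Gc: "continuous_on UNIV G"
    unfolding G_def by (rule continuous_on_compose2[OF H_continuous fold_shear_continuous]) auto
  have Fc: "continuous_on UNIV F"
    unfolding F_def by (rule continuous_on_compose2[OF H_continuous fold_shear_continuous]) auto
  have G0: "G x = 0" if "norm x > R + real CARD('n)" for x
    unfolding G_def by (rule fold_shear_support) (use that Cons.prems in auto)
  have F0: "F x = 0" if "norm x > R + real CARD('n)" for x
    unfolding F_def by (rule fold_shear_support[OF Cons.prems that])
  \<comment> \<open>The restriction to short steps, \<open>small\<close>, keeps the Jacobian of a
    single shear nonnegative.\<close>
  have g1: "1 + drift_deriv a b j x \<ge> 0" for x
    using drift_deriv_bound[of a b j x] small by linarith
  have H0: "H x = 0" if "norm x > R + real CARD('n)" for x
    using that by (intro H_support) auto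
  have "(LINT x|lborel. G (x + drift a b j x *\<^sub>R axis j 1)) =
    (LINT x|lborel. G x) - (LINT x|lborel. G (x + drift a b j x *\<^sub>R axis j 1) * drift_deriv a b j x)"
    by (rule integral_shear[OF Gc _ G0 drift_continuous drift_bound drift_has_derivative drift_deriv_continuous g1])
       (auto simp: G_def H_nonneg)
  then have F: "(LINT x|lborel. F x) = (LINT x|lborel. G x) - (LINT x|lborel. F x * drift_deriv a b j x)"
    by (simp add: F_def G_def shear_def)
  have iH: "integrable lborel (\<lambda>x. H x * drift_deriv a b j x)"
    by (rule integrable_lborel_compact_support[of _ "R + real CARD('n)"])
       (auto intro!: continuous_intros H_continuous drift_deriv_continuous H0)
  have iF: "integrable lborel (\<lambda>x. F x * drift_deriv a b j x)"
    by (rule integrable_lborel_compact_support[of _ "R + real CARD('n)"])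
       (auto intro!: continuous_intros Fc drift_deriv_continuous F0)
  have "\<bar>LINT x|lborel. (H x - F x) * drift_deriv a b j x\<bar> \<le> (L * ((?n + 1) * ?m) * ?m) * measure lborel (cball (0::real^'n) (R + real CARD('n)))"
  proof (rule integral_lborel_compact_support_le)
    show "continuous_on UNIV (\<lambda>x. (H x - F x) * drift_deriv a b j x)"
      by (intro continuous_intros H_continuous Fc drift_deriv_continuous)
    show "(H x - F x) * drift_deriv a b j x = 0" if "norm x > R + real CARD('n)" for x
      using F0[OF that] H0[OF that] by simp
    fix x
    have "\<bar>H x - F x\<bar> \<le> L * norm (x - fold (shear a b) (j # l) x)" unfolding F_def by (rule H_lipschitz)
    also have "\<dots> \<le> L * (real (length (j # l)) * ?m)"
      using fold_shear_displacement[of a b "j # l" x] L_nonneg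
      by (intro mult_left_mono) (simp_all only: norm_minus_commute)
    finally have "\<bar>H x - F x\<bar> \<le> L * ((?n + 1) * ?m)" by (simp add: add.commute)
    then show "\<bar>(H x - F x) * drift_deriv a b j x\<bar> \<le> L * ((?n + 1) * ?m) * ?m"
      unfolding abs_mult using drift_deriv_bound[of a b j x] L_nonneg mass_nonneg[of a b]
      by (intro mult_mono) auto
  qed
  then have "\<bar>(LINT x|lborel. H x * drift_deriv a b j x) - (LINT x|lborel. F x * drift_deriv a b j x)\<bar>
      \<le> (?n + 1) * L * ?m\<^sup>2 * measure lborel (cball (0::real^'n) (R + real CARD('n)))"
    using iH iF by (simp add: left_diff_distrib power2_eq_square mult_ac)
  moreover have "\<bar>(LINT x|lborel. G x) - (LINT x|lborel. H x) + (\<Sum>j\<leftarrow>l. LINT x|lborel. H x * drift_deriv a b j x)\<bar>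
      \<le> ?n\<^sup>2 * L * ?m\<^sup>2 * measure lborel (cball (0::real^'n) (R + real CARD('n)))"
    using Cons by (simp add: G_def)
  ultimately have "\<bar>(LINT x|lborel. F x) - (LINT x|lborel. H x) +
      (\<Sum>j\<leftarrow>j # l. LINT x|lborel. H x * drift_deriv a b j x)\<bar> \<le> ?n\<^sup>2 * L * ?m\<^sup>2 * measure lborel (cball (0::real^'n) (R + real CARD('n))) + (?n + 1) * L * ?m\<^sup>2 * measure lborel (cball (0::real^'n) (R + real CARD('n)))"
    unfolding F by simp
  also have "\<dots> = (?n\<^sup>2 + (?n + 1)) * (L * ?m\<^sup>2 * measure lborel (cball (0::real^'n) (R + real CARD('n))))" by (simp add: algebra_simps)
  also have "\<dots> \<le> (real (length (j # l)))\<^sup>2 * (L * ?m\<^sup>2 * measure lborel (cball (0::real^'n) (R + real CARD('n))))"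
    by (rule mult_right_mono) (simp add: power2_eq_square algebra_simps,
      intro mult_nonneg_nonneg L_nonneg measure_nonneg zero_le_power2)
  finally show ?case by (simp add: F_def mult.assoc)
qed simp

text \<open>The first-order terms add up to the integral of \<open>H\<close> against the sum of the
  \<open>drift_deriv\<close>, which is 0 as the field is divergence-free. The factor
  \<open>1 + 2 * (real CARD('n))\<^sup>2\<close> collects 1 from the Euler error and twice the
  square of the dimension from the successive shears, once for their position and once for their
  volume change.\<close>

lemma transition_integral_step:
  "\<bar>(LINT x|lborel. H (transition a b x)) - (LINT x|lborel. H x)\<bar>
    \<le> (1 + 2 * (real CARD('n))\<^sup>2) * L * measure lborel (cball (0::real^'n) (R + real CARD('n))) * (mass a b)\<^sup>2"
proof -
  let ?m = "mass a b"
  obtain l :: "'n list" where l: "set l = UNIV" "distinct l" using finite_distinct_list[of "UNIV :: 'n set"] by auto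
  have len: "length l = CARD('n)" using distinct_card[OF l(2)] l(1) by simp
  define F where "F x = H (fold (shear a b) l x)" for x
  define T where "T x = H (transition a b x)" for x
  have Fc: "continuous_on UNIV F"
    unfolding F_def by (rule continuous_on_compose2[OF H_continuous fold_shear_continuous]) auto
  have Tc: "continuous_on UNIV T"
    unfolding T_def by (rule continuous_on_compose2[OF H_continuous transition_continuous]) auto
  have d1: "real CARD('n) \<ge> 1" by (simp add: Suc_leI)
  have F0: "F x = 0" if "norm x > R + real CARD('n)" for x
    unfolding F_def by (rule fold_shear_support) (use that len in auto)
  have T0: "T x = 0" if "norm x > R + real CARD('n)" for x
    unfolding T_def
  proof (rule compact_support_perturb[OF H_support])
    show "norm (transition a b x - x) \<le> real CARD('n)"
      using transition_displacement[OF ab, of x] small d1 by linarith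
  qed (use that in auto)
  have H0: "H x = 0" if "norm x > R + real CARD('n)" for x
    using that by (intro H_support) auto
  have iH: "integrable lborel (\<lambda>x. H x * drift_deriv a b j x)" for j
    by (rule integrable_lborel_compact_support[of _ "R + real CARD('n)"])
       (auto intro!: continuous_intros H_continuous drift_deriv_continuous H0)
  have "(\<Sum>j\<leftarrow>l. LINT x|lborel. H x * drift_deriv a b j x) = (\<Sum>j\<in>UNIV. LINT x|lborel. H x * drift_deriv a b j x)"
    using l by (simp add: sum_list_distinct_conv_sum_set)
  also have "\<dots> = (LINT x|lborel. (\<Sum>j\<in>UNIV. H x * drift_deriv a b j x))"
    using iH by simp
  also have "\<dots> = 0" by (simp add: sum_distrib_left[symmetric] sum_drift_deriv)
  finally have z: "(\<Sum>j\<leftarrow>l. LINT x|lborel. H x * drift_deriv a b j x) = 0" .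
  have 1: "\<bar>(LINT x|lborel. F x) - (LINT x|lborel. H x)\<bar> \<le> (real CARD('n))\<^sup>2 * L * ?m\<^sup>2 * measure lborel (cball (0::real^'n) (R + real CARD('n)))"
    using fold_shear_integral[of l] by (simp add: F_def z len)
  have "\<bar>LINT x|lborel. T x - F x\<bar> \<le> (L * ((1 + (real CARD('n))\<^sup>2) * ?m\<^sup>2)) * measure lborel (cball (0::real^'n) (R + real CARD('n)))"
  proof (rule integral_lborel_compact_support_le)
    show "continuous_on UNIV (\<lambda>x. T x - F x)" by (intro continuous_intros Tc Fc)
    show "T x - F x = 0" if "norm x > R + real CARD('n)" for x using F0[OF that] T0[OF that] by simp
    fix x
    \<comment> \<open>The Euler point, with all drifts applied at once; both the flow and the
      composed shears stay within second order of it.\<close>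
    define e where "e = x + (\<chi> i. drift a b i x)"
    have "(\<Sum>j\<leftarrow>l. drift a b j x *\<^sub>R axis j (1::real)) = (\<Sum>j\<in>UNIV. drift a b j x *\<^sub>R axis j 1)"
      using l by (simp add: sum_list_distinct_conv_sum_set)
    also have "\<dots> = (\<chi> i. drift a b i x)"
      by (simp add: vec_eq_iff axis_def if_distrib if_distribR cong: if_cong)
    finally have "norm (fold (shear a b) l x - e) \<le> (real CARD('n))\<^sup>2 * ?m\<^sup>2"
      using fold_shear_euler[of a b l x] by (simp add: e_def len)
    moreover have "norm (transition a b x - e) \<le> ?m\<^sup>2"
      unfolding e_def by (rule transition_euler[OF ab])
    ultimately have "norm (transition a b x - fold (shear a b) l x) \<le> (1 + (real CARD('n))\<^sup>2) * ?m\<^sup>2"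
      using norm_triangle_ineq4[of "transition a b x - e" "fold (shear a b) l x - e"] by (simp add: algebra_simps)
    then show "\<bar>T x - F x\<bar> \<le> L * ((1 + (real CARD('n))\<^sup>2) * ?m\<^sup>2)"
      unfolding T_def F_def using H_lipschitz mult_left_mono[OF _ L_nonneg] order_trans by blast
  qed
  moreover have "(LINT x|lborel. T x - F x) = (LINT x|lborel. T x) - (LINT x|lborel. F x)"
    by (intro Bochner_Integration.integral_diff integrable_lborel_compact_support[OF Tc T0]
        integrable_lborel_compact_support[OF Fc F0])
  ultimately have "\<bar>(LINT x|lborel. T x) - (LINT x|lborel. H x)\<bar> \<le>
      (L * ((1 + (real CARD('n))\<^sup>2) * ?m\<^sup>2)) * measure lborel (cball (0::real^'n) (R + real CARD('n))) + (real CARD('n))\<^sup>2 * L * ?m\<^sup>2 * measure lborel (cball (0::real^'n) (R + real CARD('n)))"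
    using 1 by linarith
  also have "\<dots> = (1 + 2 * (real CARD('n))\<^sup>2) * L * measure lborel (cball (0::real^'n) (R + real CARD('n))) * ?m\<^sup>2" by (simp add: algebra_simps)
  finally show ?thesis by (simp add: T_def)
qed

end

text \<open>As \<open>s\<close> runs from \<open>p\<close> to \<open>q\<close>, the integral of
  \<open>h (transition s q x)\<close> has increments bounded by a multiple of the squared increment
  of mass, hence is constant. On a short step from \<open>a\<close> to \<open>b\<close> the test
  function is \<open>h\<close> after the flow from \<open>b\<close> to \<open>q\<close>; the
  Lipschitz constant \<open>L * K\<close> and the support radius \<open>R'\<close> are common to all
  steps.\<close>

lemma transition_integral:
  fixes h :: "real^'n \<Rightarrow> real"
  assumes "p \<le> q" and h: "\<And>x. h x \<ge> 0" "\<And>x y. \<bar>h x - h y\<bar> \<le> L * norm (x - y)" "\<And>x. norm x > R \<Longrightarrow> h x = 0"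
  shows "(LINT x|lborel. h (transition p q x)) = (LINT x|lborel. h x)"
proof -
  obtain K where K: "K \<ge> 1" "\<And>c d x y. p \<le> c \<Longrightarrow> c \<le> q \<Longrightarrow> p \<le> d \<Longrightarrow> d \<le> q \<Longrightarrow>
     norm (transition c d x - transition c d y) \<le> K * norm (x - y)"
    by (rule transition_lipschitz[OF \<open>p \<le> q\<close>]) (rule that)
  have L: "L \<ge> 0"
  proof -
    have "0 \<le> \<bar>h (axis (undefined::'n) 1) - h 0\<bar>" by simp
    also have "\<dots> \<le> L * norm (axis (undefined::'n) (1::real) - 0)" by (rule h)
    finally show ?thesis by (simp add: norm_axis_1)
  qed
  define R' where "R' = R + mass p q"
  let ?d = "real CARD('n)"
  define C where "C = (1 + 2 * ?d\<^sup>2) * (L * K) * measure lborel (cball (0::real^'n) (R' + ?d))"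
  define I where "I s = (LINT x|lborel. h (transition s q x))" for s
  have "I p = I q"
  proof (rule quadratic_increment_const[of p q "mass p" "1/2" C I])
    show "C \<ge> 0" unfolding C_def using L K(1) by (intro mult_nonneg_nonneg) auto
    fix a b assume ab: "p \<le> a" "a \<le> b" "b \<le> q" and m: "mass p b - mass p a \<le> 1/2"
    have m': "mass p b - mass p a = mass a b" using mass_split[OF ab(1,2)] by simp
    have "\<bar>(LINT x|lborel. h (transition b q (transition a b x))) - (LINT x|lborel. h (transition b q x))\<bar>
      \<le> (1 + 2 * ?d\<^sup>2) * (L * K) * measure lborel (cball (0::real^'n) (R' + ?d)) * (mass a b)\<^sup>2"
    proof (rule transition_integral_step)
      show "\<bar>h (transition b q x) - h (transition b q y)\<bar> \<le> L * K * norm (x - y)" for x y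
        using h(2)[of "transition b q x" "transition b q y"]
          mult_left_mono[OF K(2)[of b q x y] L] ab by auto
      show "h (transition b q x) = 0" if "norm x > R'" for x
      proof (rule compact_support_perturb[OF h(3)])
        show "norm (transition b q x - x) \<le> mass p q"
          using transition_displacement[of b q x] mass_split[of p b q] mass_nonneg[of p b] ab by auto
      qed (use that in \<open>auto simp: R'_def\<close>)
    qed (use h m m' ab in auto)
    then show "\<bar>I b - I a\<bar> \<le> C * (mass p b - mass p a)\<^sup>2"
      unfolding m' by (simp add: I_def C_def transition_comp abs_minus_commute)
  qed (use \<open>p \<le> q\<close> in \<open>auto intro: mass_continuous mass_mono\<close>)
  then show ?thesis by (simp add: I_def)
qed

text \<open>The indicator of an open box is the increasing limit of compactly supported Lipschitz
  functions, for which \<open>transition_integral\<close> holds.\<close>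

lemma transition_lborel:
  assumes "p \<le> q"
  shows "distr lborel borel (transition p q) = lborel"
proof -
  have m [measurable]: "transition p q \<in> borel_measurable borel"
    by (intro borel_measurable_continuous_onI transition_continuous)
  have "lborel = distr lborel borel (transition p q)"
  proof (rule lborel_eqI)
    fix l r :: "real^'n" assume lr: "\<And>b. b \<in> Basis \<Longrightarrow> l \<bullet> b \<le> r \<bullet> b"
    define B where "B = box l r"
    define g where "g k x = min 1 (real k * infdist x (- B))" for k :: nat and x
    have "bounded B" by (simp add: B_def bounded_box)
    then obtain R where R: "\<And>x. x \<in> B \<Longrightarrow> norm x \<le> R" by (auto simp: bounded_iff)
    have oB: "open B" by (simp add: B_def open_box)
    have neU: "- B \<noteq> {}" using \<open>bounded B\<close> not_bounded_UNIV by (metis Compl_empty_eq double_complement)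
    have gb: "g k \<in> borel_measurable borel" for k
      unfolding g_def by (intro borel_measurable_continuous_onI continuous_intros)
    have g0: "g k x \<ge> 0" for k x by (simp add: g_def infdist_nonneg)
    have glip: "\<bar>g k x - g k y\<bar> \<le> real k * norm (x - y)" for k x y
    proof -
      have "\<bar>real k * infdist x (- B) - real k * infdist y (- B)\<bar> \<le> real k * dist x y"
        using mult_left_mono[OF infdist_triangle_abs, of "real k" x "- B" y]
        by (simp add: abs_mult flip: right_diff_distrib)
      then show ?thesis unfolding g_def by (simp add: dist_norm min_def abs_if split: if_splits)
    qed
    have gs: "g k x = 0" if "norm x > R" for k x
    proof -
      have "x \<in> - B" using R[of x] that by auto
      then show ?thesis by (simp add: g_def)
    qed
    have inc: "incseq (\<lambda>k. ennreal (g k x))" for x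
    proof (rule incseq_SucI, rule ennreal_leI)
      fix k
      have "real k * infdist x (- B) \<le> real (Suc k) * infdist x (- B)"
        by (intro mult_right_mono) (auto simp: infdist_nonneg)
      then show "g k x \<le> g (Suc k) x" unfolding g_def by (rule min.mono[OF order_refl])
    qed
    have lim: "(SUP k. ennreal (g k x)) = indicator B x" for x
    proof (rule LIMSEQ_unique[OF LIMSEQ_SUP[OF inc]])
      show "(\<lambda>k. ennreal (g k x)) \<longlonglongrightarrow> indicator B x"
      proof (cases "x \<in> B")
        case True
        define d where "d = infdist x (- B)"
        have "d > 0" unfolding d_def
          by (rule infdist_pos_not_in_closed) (use oB neU True in auto)
        then obtain k0 :: nat where "1 / d < k0" using reals_Archimedean2 by blast
        then have k0: "1 \<le> real k0 * d" using \<open>d > 0\<close> by (simp add: field_simps)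
        have "g k x = 1" if "k \<ge> k0" for k
        proof -
          have "real k0 * d \<le> real k * d" using that \<open>d > 0\<close> by (intro mult_right_mono) auto
          then show ?thesis using k0 by (simp add: g_def d_def)
        qed
        then have "\<forall>\<^sub>F k in sequentially. ennreal (g k x) = 1"
          unfolding eventually_sequentially by (intro exI[of _ k0]) auto
        then show ?thesis using True by (simp add: tendsto_eventually)
      next
        case False then show ?thesis by (simp add: g_def)
      qed
    qed
    have nn: "(\<integral>\<^sup>+x. ennreal (g k (transition p q x)) \<partial>lborel) = (\<integral>\<^sup>+x. ennreal (g k x) \<partial>lborel)" for k
    proof -
      have i: "integrable lborel (g k)"
        by (rule integrable_lborel_compact_support[OF _ gs]) (unfold g_def, intro continuous_intros)
      have i': "integrable lborel (\<lambda>x. g k (transition p q x))"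
      proof (rule integrable_lborel_compact_support)
        show "continuous_on UNIV (\<lambda>x. g k (transition p q x))"
          unfolding g_def by (intro continuous_intros transition_continuous)
        show "g k (transition p q x) = 0" if "norm x > R + mass p q" for x
          by (rule compact_support_perturb[OF gs transition_displacement[OF assms] that])
      qed
      have "(LINT x|lborel. g k (transition p q x)) = (LINT x|lborel. g k x)"
        by (rule transition_integral[OF assms g0 glip gs])
      then show ?thesis
        using i i' g0 by (simp add: nn_integral_eq_integral)
    qed
    have "emeasure (distr lborel borel (transition p q)) B = (\<integral>\<^sup>+x. indicator B x \<partial>distr lborel borel (transition p q))"
      using oB by (subst nn_integral_indicator) auto
    also have "\<dots> = (\<integral>\<^sup>+x. indicator B (transition p q x) \<partial>lborel)"
      using oB by (subst nn_integral_distr) auto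
    also have "\<dots> = (\<integral>\<^sup>+x. (SUP k. ennreal (g k (transition p q x))) \<partial>lborel)" by (simp add: lim)
    also have "\<dots> = (SUP k. \<integral>\<^sup>+x. ennreal (g k (transition p q x)) \<partial>lborel)"
      using inc gb by (intro nn_integral_monotone_convergence_SUP) (auto simp: incseq_def le_fun_def)
    also have "\<dots> = (SUP k. \<integral>\<^sup>+x. ennreal (g k x) \<partial>lborel)" by (simp only: nn)
    also have "\<dots> = (\<integral>\<^sup>+x. (SUP k. ennreal (g k x)) \<partial>lborel)"
      using inc gb by (intro nn_integral_monotone_convergence_SUP[symmetric]) (auto simp: incseq_def le_fun_def)
    also have "\<dots> = emeasure lborel B" using oB by (simp add: lim)
    also have "\<dots> = ennreal (prod ((\<bullet>) (r - l)) Basis)"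
      unfolding B_def using lr by (simp add: emeasure_lborel_box)
    finally show "emeasure (distr lborel borel (transition p q)) (box l r) = ennreal (prod ((\<bullet>) (r - l)) Basis)"
      by (simp add: B_def)
  qed simp
  then show ?thesis ..
qed

text \<open>Backward in time, the map is inverse to one that preserves the measure.\<close>

theorem torus_map_transition: "torus_map (transition a b)"
proof -
  have m: "transition c d \<in> borel_measurable borel" for c d
    by (intro borel_measurable_continuous_onI transition_continuous)
  have "distr lborel borel (transition a b) = lborel"
  proof (cases "a \<le> b")
    case False
    have "transition a b \<circ> transition b a = (\<lambda>x. x)" by (simp add: fun_eq_iff transition_comp)
    then have "distr lborel borel (\<lambda>x. x) = distr (distr lborel borel (transition b a)) borel (transition a b)"
      by (subst distr_distr) (use m in auto)
    then have "lborel = distr lborel borel (transition a b)"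
      using False by (simp add: transition_lborel distr_id2)
    then show ?thesis ..
  qed (rule transition_lborel)
  then show ?thesis using m transition_periodic by (simp add: torus_map_def)
qed

lemma torus_map_X: "torus_map (X t)"
  using torus_map_transition[of 0 t] by (simp add: transition_from_0)

lemma torus_map_inv_X: "torus_map (inv (X t))"
  using torus_map_transition[of t 0] by (simp add: transition_to_0)

end

section \<open>Rigidity of maps that asymptotically contract the energy\<close>

lemma pullback_hartley:
  "torus_map \<phi> \<Longrightarrow> pullback \<phi> (hartley n) = abs_torus_L2 (\<lambda>x. hartley_const TYPE('n) * cas (phase n (\<phi> x)))"
  for n :: "int^('n::finite)"
  unfolding hartley_def
  by (subst pullback_abs) (auto intro: torus_square_integrable_scale torus_square_integrable_cas simp: comp_def)

lemma pullback_translation_hartley: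
  fixes m :: "int^('n::finite)"
  shows "pullback (\<lambda>x. x + b) (hartley m) = cos (phase m b) *\<^sub>R hartley m + sin (phase m b) *\<^sub>R hartley (- m)"
proof -
  let ?c = "hartley_const TYPE('n)"
  have sq: "torus_square_integrable (\<lambda>x. ?c * cas (phase k x))" for k
    by (intro torus_square_integrable_scale torus_square_integrable_cas)
  have "cos (phase m b) *\<^sub>R hartley m + sin (phase m b) *\<^sub>R hartley (- m) =
      abs_torus_L2 (\<lambda>x. cos (phase m b) * (?c * cas (phase m x)) + sin (phase m b) * (?c * cas (phase (- m) x)))"
    unfolding hartley_def scaleR_abs_torus_L2[OF sq]
    by (rule plus_abs_torus_L2) (intro torus_square_integrable_scale[OF sq])+
  also have "\<dots> = pullback (\<lambda>x. x + b) (hartley m)"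
    unfolding pullback_hartley[OF torus_map_translation]
    by (simp add: phase_plus cas_add phase_minus_left algebra_simps)
  finally show ?thesis ..
qed

lemma inner_pullback_translation:
  "pullback (\<lambda>x. x + a) g \<bullet> hartley m = cos (phase m a) * (g \<bullet> hartley m) - sin (phase m a) * (g \<bullet> hartley (- m))"
proof -
  have "pullback (\<lambda>x. x + a) g \<bullet> hartley m = g \<bullet> pullback (\<lambda>x. x + - a) (hartley m)"
    by (rule inner_pullback_adjoint[OF torus_map_translation torus_map_translation]) simp
  moreover have "phase m (- a) = - phase m a" using phase_scaleR[of m "-1" a] by simp
  ultimately show ?thesis
    unfolding pullback_translation_hartley by (simp add: inner_add_right inner_diff_right)
qed

text \<open>Translation by \<open>a\<close> rotates the plane of \<open>hartley m\<close> and
  \<open>hartley (- m)\<close> by the angle \<open>phase m a\<close>; a rotation by \<theta> minus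
  the identity multiplies squared lengths by \<open>2 - 2 * cos \<theta>\<close>.\<close>

lemma translation_pair:
  fixes g :: "('n::finite) torus_L2"
  defines "D \<equiv> \<lambda>a. pullback (\<lambda>x. x + a) g - g"
  shows "(D a \<bullet> hartley m)\<^sup>2 + (D a \<bullet> hartley (- m))\<^sup>2 =
    (2 - 2 * cos (phase m a)) * ((g \<bullet> hartley m)\<^sup>2 + (g \<bullet> hartley (- m))\<^sup>2)"
proof -
  have s: "(sin (phase m a))\<^sup>2 = 1 - (cos (phase m a))\<^sup>2" by (simp add: sin_squared_eq)
  have "(D a \<bullet> hartley m)\<^sup>2 + (D a \<bullet> hartley (- m))\<^sup>2 =
    ((cos (phase m a) - 1)\<^sup>2 + (sin (phase m a))\<^sup>2) * ((g \<bullet> hartley m)\<^sup>2 + (g \<bullet> hartley (- m))\<^sup>2)"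
  proof -
    have 1: "D a \<bullet> hartley m = (cos (phase m a) - 1) * (g \<bullet> hartley m) - sin (phase m a) * (g \<bullet> hartley (- m))"
      by (simp only: D_def inner_diff_left inner_pullback_translation left_diff_distrib)
    have 2: "D a \<bullet> hartley (- m) = (cos (phase m a) - 1) * (g \<bullet> hartley (- m)) + sin (phase m a) * (g \<bullet> hartley m)"
      by (simp only: D_def inner_diff_left inner_pullback_translation left_diff_distrib phase_minus_left) simp
    show ?thesis unfolding 1 2 by algebra
  qed
  also have "(cos (phase m a) - 1)\<^sup>2 + (sin (phase m a))\<^sup>2 = 2 - 2 * cos (phase m a)"
    unfolding s by (simp add: power2_eq_square algebra_simps)
  finally show ?thesis .
qed

lemma one_minus_cos_le: "2 - 2 * cos x \<le> x\<^sup>2" for x :: real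
proof -
  have "2 - 2 * cos x = 4 * (sin (x / 2))\<^sup>2" using cos_double_sin[of "x / 2"] by simp
  also have "\<dots> \<le> 4 * (x / 2)\<^sup>2"
    using abs_le_square_iff[of "sin (x / 2)" "x / 2"] abs_sin_x_le_abs_x[of "x / 2"] by simp
  finally show ?thesis by (simp add: power_divide)
qed

text \<open>With \<open>x = \<bar>y\<bar> / 2\<close> the right-hand side is
  \<open>4 * (sin x)\<^sup>2\<close>; now \<open>sin x \<ge> x * cos x\<close>, and
  \<open>(cos x)\<^sup>2\<close> is within \<open>\<eta>\<^sup>2\<close> of 1.\<close>

lemma one_minus_cos_ge:
  fixes y \<eta> :: real
  assumes "\<bar>y\<bar> \<le> \<eta>" "\<eta> \<le> 1"
  shows "y\<^sup>2 * (1 - \<eta>\<^sup>2) \<le> 2 - 2 * cos y"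
proof -
  have key: "x * cos x \<le> sin x" if "0 \<le> x" "x \<le> 1" for x :: real
  proof -
    have "sin 0 - 0 * cos 0 \<le> sin x - x * cos x"
    proof (rule DERIV_nonneg_imp_nondecreasing[OF that(1)])
      fix t assume t: "0 \<le> t" "t \<le> x"
      have "((\<lambda>t. sin t - t * cos t) has_real_derivative t * sin t) (at t)"
        by (auto intro!: derivative_eq_intros)
      moreover have "0 \<le> t * sin t" using t that pi_gt3 by (intro mult_nonneg_nonneg sin_ge_zero) auto
      ultimately show "\<exists>y. ((\<lambda>t. sin t - t * cos t) has_real_derivative y) (at t) \<and> 0 \<le> y" by blast
    qed
    then show ?thesis by simp
  qed
  define x where "x = \<bar>y\<bar> / 2"
  have x: "0 \<le> x" "x \<le> 1" "2 * x \<le> \<eta>" using assms by (auto simp: x_def)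
  have c: "cos x \<ge> 0" using x pi_gt3 by (intro cos_ge_zero) auto
  have y: "y\<^sup>2 = 4 * x\<^sup>2" by (simp add: x_def power_divide)
  have "y\<^sup>2 * (1 - \<eta>\<^sup>2) \<le> 4 * (x\<^sup>2 * (cos x)\<^sup>2)"
  proof -
    have "(sin x)\<^sup>2 \<le> \<eta>\<^sup>2"
      using abs_sin_x_le_abs_x[of x] x by (intro order_trans[OF iffD1[OF abs_le_square_iff] power_mono[of x \<eta> 2]]) auto
    then have "1 - \<eta>\<^sup>2 \<le> (cos x)\<^sup>2" by (simp add: cos_squared_eq)
    from mult_left_mono[OF this, of "4 * x\<^sup>2"] show ?thesis by (simp add: y)
  qed
  also have "\<dots> = 4 * (x * cos x)\<^sup>2" by (simp add: power_mult_distrib)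
  also have "\<dots> \<le> 4 * (sin x)\<^sup>2"
    using key[OF x(1,2)] x c by (intro mult_left_mono power_mono) auto
  also have "\<dots> = 2 - 2 * cos (2 * x)" using cos_double_sin[of x] by simp
  also have "cos (2 * x) = cos y" by (simp add: x_def)
  finally show ?thesis .
qed

lemma has_sum_finite_sum:
  fixes f :: "'i \<Rightarrow> 'a \<Rightarrow> 'b::{topological_comm_monoid_add}"
  assumes "finite I" "\<And>i. i \<in> I \<Longrightarrow> (f i has_sum s i) A"
  shows "((\<lambda>x. \<Sum>i\<in>I. f i x) has_sum (\<Sum>i\<in>I. s i)) A"
  using assms by (induction I rule: finite_induct) (auto intro: has_sum_add)

text \<open>Difference quotients are bounded by derivatives: by \<open>translation_pair\<close> the
  factor at frequency \<open>m\<close> is at most \<open>(\<tau> * m $ j)\<^sup>2\<close> for axis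
  \<open>j\<close>, and these factors sum to at most \<open>\<tau>\<^sup>2\<close> times the squared
  bracket of \<open>m\<close>.\<close>

lemma translation_energy:
  fixes g :: "('n::finite) torus_L2"
  assumes E: "\<And>J. finite J \<Longrightarrow> (\<Sum>m\<in>J. (japanese_bracket m)\<^sup>2 * (g \<bullet> hartley m)\<^sup>2) \<le> E"
  shows "(\<Sum>j\<in>UNIV. (norm (pullback (\<lambda>x. x + \<tau> *\<^sub>R axis j 1) g - g))\<^sup>2) \<le> \<tau>\<^sup>2 * E"
proof -
  define d where "d j m = (pullback (\<lambda>x. x + \<tau> *\<^sub>R axis j 1) g - g) \<bullet> hartley m" for j m
  define G where "G m = (g \<bullet> hartley m)\<^sup>2" for m
  have hs: "((\<lambda>m. \<Sum>j\<in>UNIV. (d j m)\<^sup>2) has_sum (\<Sum>j\<in>UNIV. (norm (pullback (\<lambda>x. x + \<tau> *\<^sub>R axis j 1) g - g))\<^sup>2)) UNIV"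
    unfolding d_def by (intro has_sum_finite_sum hartley.parseval) simp
  show ?thesis
  proof (rule has_sum_le_finite_sums[OF hs])
    fix J :: "(int^'n) set" assume "finite J"
    \<comment> \<open>\<open>translation_pair\<close> controls only the sum over \<open>m\<close>
      and \<open>- m\<close>, so the set of frequencies is made symmetric first.\<close>
    define J' where "J' = J \<union> uminus ` J"
    have J': "finite J'" "J \<subseteq> J'" "uminus ` J' = J'" using \<open>finite J\<close> by (auto simp: J'_def image_Un image_image)
    have flip: "(\<Sum>m\<in>J'. f (- m)) = (\<Sum>m\<in>J'. f m)" for f :: "int^'n \<Rightarrow> real"
      using sum.reindex[of uminus J' f] J'(3) by (simp add: inj_on_def)
    have pair: "(d j m)\<^sup>2 + (d j (- m))\<^sup>2 = (2 - 2 * cos (phase m (\<tau> *\<^sub>R axis j 1))) * (G m + G (- m))" for j m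
      unfolding d_def G_def by (rule translation_pair)
    have one: "(\<Sum>m\<in>J'. (d j m)\<^sup>2) = (\<Sum>m\<in>J'. (2 - 2 * cos (\<tau> * of_int (m $ j))) * G m)" for j
    proof -
      have "2 * (\<Sum>m\<in>J'. (d j m)\<^sup>2) = (\<Sum>m\<in>J'. (d j m)\<^sup>2) + (\<Sum>m\<in>J'. (d j (- m))\<^sup>2)"
        using flip[of "\<lambda>m. (d j m)\<^sup>2"] by simp
      also have "\<dots> = (\<Sum>m\<in>J'. (2 - 2 * cos (\<tau> * of_int (m $ j))) * G m) +
          (\<Sum>m\<in>J'. (2 - 2 * cos (\<tau> * of_int (m $ j))) * G (- m))"
        by (simp add: sum.distrib[symmetric] pair phase_scaleR phase_axis distrib_left)
      also have "(\<Sum>m\<in>J'. (2 - 2 * cos (\<tau> * of_int (m $ j))) * G (- m)) =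
          (\<Sum>m\<in>J'. (2 - 2 * cos (\<tau> * of_int (m $ j))) * G m)"
        using flip[of "\<lambda>m. (2 - 2 * cos (\<tau> * of_int (m $ j))) * G m"] by simp
      finally show ?thesis by simp
    qed
    have "(\<Sum>m\<in>J. \<Sum>j\<in>UNIV. (d j m)\<^sup>2) \<le> (\<Sum>m\<in>J'. \<Sum>j\<in>UNIV. (d j m)\<^sup>2)"
      using J' by (intro sum_mono2) (auto intro: sum_nonneg)
    also have "\<dots> = (\<Sum>j\<in>UNIV. \<Sum>m\<in>J'. (2 - 2 * cos (\<tau> * of_int (m $ j))) * G m)"
      by (subst sum.swap) (simp add: one)
    also have "\<dots> \<le> (\<Sum>j\<in>UNIV. \<Sum>m\<in>J'. (\<tau> * of_int (m $ j))\<^sup>2 * G m)"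
      by (intro sum_mono mult_right_mono one_minus_cos_le) (simp add: G_def)
    also have "\<dots> = \<tau>\<^sup>2 * (\<Sum>m\<in>J'. (\<Sum>j\<in>UNIV. (of_int (m $ j))\<^sup>2) * G m)"
      by (subst sum.swap) (simp add: power_mult_distrib sum_distrib_left sum_distrib_right mult_ac)
    also have "\<dots> \<le> \<tau>\<^sup>2 * (\<Sum>m\<in>J'. (japanese_bracket m)\<^sup>2 * G m)"
      unfolding japanese_bracket_square by (intro mult_left_mono sum_mono mult_right_mono) (auto simp: G_def)
    also have "\<dots> \<le> \<tau>\<^sup>2 * E" unfolding G_def by (intro mult_left_mono E J') simp
    finally show "(\<Sum>m\<in>J. \<Sum>j\<in>UNIV. (d j m)\<^sup>2) \<le> \<tau>\<^sup>2 * E" .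
  qed
qed

text \<open>Taken together, \<open>n\<close> and \<open>- n\<close> give an expression in the
  difference of the phases only; a single \<open>cas\<close> does not.\<close>

lemma cas_difference_pair:
  "(cas x - cas y)\<^sup>2 + (cas (- x) - cas (- y))\<^sup>2 = 2 * (2 - 2 * cos (x - y))"
proof -
  have "(cas x - cas y)\<^sup>2 + (cas (- x) - cas (- y))\<^sup>2 =
      2 * ((sin x)\<^sup>2 + (cos x)\<^sup>2) + 2 * ((sin y)\<^sup>2 + (cos y)\<^sup>2) - 4 * (cos x * cos y + sin x * sin y)"
    unfolding cas_def sin_minus cos_minus by algebra
  then show ?thesis by (simp add: cos_diff)
qed

text \<open>A point of disagreement can be moved into the closed cell, and the open set of
  disagreement then meets the interior of the cell in a nonempty open set, which is not
  null.\<close>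

lemma constant_if_AE_constant:
  fixes f :: "real^'n \<Rightarrow> real"
  assumes cont: "continuous_on UNIV f" and per: "torus_periodic f" and ae: "AE x in torus_cell. f x = c"
  shows "f x = c"
proof (rule ccontr)
  assume ne: "f x \<noteq> c"
  have "\<exists>k. x + lattice_vector k \<in> half_open_cell"
  proof (rule ccontr)
    assume "\<nexists>k. x + lattice_vector k \<in> half_open_cell"
    then have "(\<integral>\<^sup>+k. indicator half_open_cell (x + lattice_vector k) \<partial>count_space UNIV) = (0::ennreal)"
      by simp
    then show False using nn_integral_cell_translates[of x] by simp
  qed
  then obtain k where k: "x + lattice_vector k \<in> half_open_cell" by blast
  define y where "y = x + lattice_vector k"
  define U where "U = {z. f z \<noteq> c}"
  have U: "open U" unfolding U_def by (intro open_Collect_neq cont continuous_intros)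
  have "f y = f x" unfolding y_def by (rule torus_periodic_lattice[OF per])
  then have "y \<in> U" using ne by (simp add: U_def)
  have "y \<in> cbox 0 (\<chi> i. 2 * pi)"
    using k by (auto simp: y_def half_open_cell_def mem_box_cart less_imp_le)
  also have "cbox (0::real^'n) (\<chi> i. 2 * pi) = closure (box 0 (\<chi> i. 2 * pi))"
  proof (rule closure_box[symmetric])
    have "(\<chi> i. pi) \<in> box (0::real^'n) (\<chi> i. 2 * pi)" by (simp add: mem_box_cart)
    then show "box (0::real^'n) (\<chi> i. 2 * pi) \<noteq> {}" by blast
  qed
  finally have "y \<in> closure (box 0 (\<chi> i. 2 * pi))" .
  then have "U \<inter> box 0 (\<chi> i. 2 * pi) \<noteq> {}"
    using U \<open>y \<in> U\<close> open_Int_closure_eq_empty[OF U, of "box 0 (\<chi> i. 2 * pi)"] by blast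
  moreover have "open (U \<inter> box 0 (\<chi> i. 2 * pi))" using U open_box by blast
  ultimately have nn: "\<not> negligible (U \<inter> box 0 (\<chi> i. 2 * pi))" using open_not_negligible by blast
  have "AE z in lborel. z \<in> cbox 0 (\<chi> i. 2 * pi) \<longrightarrow> f z = c"
    using ae unfolding torus_cell_def by (subst (asm) AE_restrict_space_iff) auto
  then have "AE z in lborel. z \<notin> U \<inter> box 0 (\<chi> i. 2 * pi)"
    by eventually_elim (use box_subset_cbox in \<open>auto simp: U_def\<close>)
  moreover have "U \<inter> box 0 (\<chi> i. 2 * pi) \<in> sets lborel" using U open_box by auto
  ultimately have "U \<inter> box 0 (\<chi> i. 2 * pi) \<in> null_sets lborel"
    by (simp add: AE_iff_null_sets)
  then show False using nn by (simp add: negligible_iff_null_sets null_sets_completionI)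
qed

lemma inner_hartley_pair_le:
  fixes g :: "('n::finite) torus_L2"
  assumes "m \<noteq> 0"
  shows "(2 - 2 * cos (phase m a)) * (g \<bullet> hartley m)\<^sup>2 \<le> (norm (pullback (\<lambda>x. x + a) g - g))\<^sup>2"
proof -
  \<comment> \<open>The sum over \<open>{m, - m}\<close> has two terms only if the two frequencies
    differ.\<close>
  have ne: "m \<noteq> - m"
  proof
    assume "m = - m"
    then have "m $ i = 0" for i by (metis vector_uminus_component equal_neg_zero)
    then show False using assms by (simp add: vec_eq_iff)
  qed
  have "(2 - 2 * cos (phase m a)) * (g \<bullet> hartley m)\<^sup>2 \<le>
      (2 - 2 * cos (phase m a)) * ((g \<bullet> hartley m)\<^sup>2 + (g \<bullet> hartley (- m))\<^sup>2)"
    by (intro mult_left_mono) auto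
  also have "\<dots> = (\<Sum>k\<in>{m, - m}. ((pullback (\<lambda>x. x + a) g - g) \<bullet> hartley k)\<^sup>2)"
    unfolding translation_pair[symmetric] using ne by simp
  also have "\<dots> \<le> (norm (pullback (\<lambda>x. x + a) g - g))\<^sup>2"
    by (rule hartley.bessel_inequality) simp
  finally show ?thesis .
qed

lemma norm_pullback_translate_diff:
  fixes F :: "real^'n \<Rightarrow> real^('n::finite)"
  assumes F: "torus_map F"
  shows "(norm (pullback (\<lambda>x. x + a) (pullback F (hartley k)) - pullback F (hartley k)))\<^sup>2 =
    (LINT x|torus_cell. (hartley_const TYPE('n))\<^sup>2 * (cas (phase k (F (x + a))) - cas (phase k (F x)))\<^sup>2)"
proof -
  let ?c = "hartley_const TYPE('n)"
  have sq: "torus_square_integrable (\<lambda>x. ?c * cas (phase k (F x)))"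
    using torus_square_integrable_comp[OF F torus_square_integrable_scale[OF torus_square_integrable_cas], of ?c k]
    by (simp add: comp_def)
  have sq': "torus_square_integrable (\<lambda>x. ?c * cas (phase k (F (x + a))))"
    using torus_square_integrable_comp[OF torus_map_translation sq] by (simp add: comp_def)
  have "pullback (\<lambda>x. x + a) (pullback F (hartley k)) - pullback F (hartley k) =
      abs_torus_L2 (\<lambda>x. ?c * cas (phase k (F (x + a))) - ?c * cas (phase k (F x)))"
    unfolding pullback_hartley[OF F] pullback_abs[OF torus_map_translation sq] comp_def
    by (rule minus_abs_torus_L2[OF sq' sq])
  then have "(norm (pullback (\<lambda>x. x + a) (pullback F (hartley k)) - pullback F (hartley k)))\<^sup>2 =
      (LINT x|torus_cell. (?c * cas (phase k (F (x + a))) - ?c * cas (phase k (F x)))\<^sup>2)"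
    by (simp only: norm_abs_torus_L2[OF torus_square_integrable_diff[OF sq' sq]])
  then show ?thesis by (simp only: right_diff_distrib[symmetric] power_mult_distrib)
qed

text \<open>A frequency parallel to axis \<open>i\<close> sees only the component
  \<open>F x $ i\<close>. When \<open>r\<close> times its increment is small,
  \<open>2 - 2 * cos\<close> of it is nearly its square, so the oscillating test functions measure
  the increment of \<open>F x $ i\<close> itself.\<close>

lemma component_energy_lower:
  fixes F :: "real^'n \<Rightarrow> real^('n::finite)"
  assumes F: "torus_map F" and Fc: "continuous_on UNIV F"
    and ph: "\<And>y. phase n y = r * y $ i" and \<delta>: "0 < \<delta>" "\<delta> \<le> 1 / 2"
    and small: "\<And>x. \<bar>r * (F (x + a) $ i - F x $ i)\<bar> \<le> \<delta>"
    and int: "integrable torus_cell (\<lambda>x. (F (x + a) $ i - F x $ i)\<^sup>2)"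
  shows "(hartley_const TYPE('n))\<^sup>2 * (2 * (r\<^sup>2 * (1 - \<delta>)) * (LINT x|torus_cell. (F (x + a) $ i - F x $ i)\<^sup>2)) \<le>
    (norm (pullback (\<lambda>x. x + a) (pullback F (hartley n)) - pullback F (hartley n)))\<^sup>2 +
    (norm (pullback (\<lambda>x. x + a) (pullback F (hartley (- n))) - pullback F (hartley (- n))))\<^sup>2"
proof -
  let ?c = "hartley_const TYPE('n)"
  let ?A = "\<lambda>k x. ?c\<^sup>2 * (cas (phase k (F (x + a))) - cas (phase k (F x)))\<^sup>2"
  let ?D = "\<lambda>x. F (x + a) $ i - F x $ i"
  have Fc': "continuous_on UNIV (\<lambda>x. phase k (F (f x)))" if "continuous_on UNIV f" for f :: "real^'n \<Rightarrow> real^'n" and k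
    by (rule continuous_on_compose2[OF continuous_on_phase continuous_on_compose2[OF Fc that]]) auto
  have iA: "integrable torus_cell (?A k)" for k
  proof (rule integrable_torus_cell_bounded[of _ "?c\<^sup>2 * 4\<^sup>2"])
    show "?A k \<in> borel_measurable borel"
      by (intro borel_measurable_continuous_onI continuous_intros Fc')
    fix x
    have "\<bar>cas (phase k (F (x + a))) - cas (phase k (F x))\<bar> \<le> 4"
      using abs_cas_le[of "phase k (F (x + a))"] abs_cas_le[of "phase k (F x)"] by linarith
    then have "\<bar>cas (phase k (F (x + a))) - cas (phase k (F x))\<bar>\<^sup>2 \<le> 4\<^sup>2" by (rule power_mono) simp
    then show "\<bar>?A k x\<bar> \<le> ?c\<^sup>2 * 4\<^sup>2"
      unfolding abs_mult power2_abs by (intro mult_mono) auto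
  qed
  have "?c\<^sup>2 * (2 * (r\<^sup>2 * (1 - \<delta>)) * (LINT x|torus_cell. (?D x)\<^sup>2)) =
     (LINT x|torus_cell. ?c\<^sup>2 * (2 * (r\<^sup>2 * (1 - \<delta>)) * (?D x)\<^sup>2))"
    using int by simp
  also have "\<dots> \<le> (LINT x|torus_cell. ?A n x + ?A (- n) x)"
  proof (rule integral_mono)
    show "integrable torus_cell (\<lambda>x. ?c\<^sup>2 * (2 * (r\<^sup>2 * (1 - \<delta>)) * (?D x)\<^sup>2))"
      by (intro integrable_mult_right int)
    show "integrable torus_cell (\<lambda>x. ?A n x + ?A (- n) x)" by (intro Bochner_Integration.integrable_add iA)
    fix x
    have "?A n x + ?A (- n) x = ?c\<^sup>2 * ((cas (phase n (F (x + a))) - cas (phase n (F x)))\<^sup>2 +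
       (cas (- phase n (F (x + a))) - cas (- phase n (F x)))\<^sup>2)"
      by (simp only: phase_minus_left distrib_left)
    also have "\<dots> = ?c\<^sup>2 * (2 * (2 - 2 * cos (r * ?D x)))"
      unfolding cas_difference_pair by (simp only: ph right_diff_distrib)
    finally have A: "?A n x + ?A (- n) x = ?c\<^sup>2 * (2 * (2 - 2 * cos (r * ?D x)))" .
    have "(1 - \<delta>) * (r * ?D x)\<^sup>2 \<le> (1 - \<delta>\<^sup>2) * (r * ?D x)\<^sup>2"
    proof (rule mult_right_mono)
      have "\<delta> * \<delta> \<le> \<delta> * 1" using \<delta> by (intro mult_left_mono) auto
      then show "1 - \<delta> \<le> 1 - \<delta>\<^sup>2" by (simp add: power2_eq_square)
    qed simp
    also have "\<dots> \<le> 2 - 2 * cos (r * ?D x)"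
      using one_minus_cos_ge[OF small, of x] \<delta> by (simp add: mult.commute[of "1 - \<delta>\<^sup>2"])
    finally have "2 * ((1 - \<delta>) * (r * ?D x)\<^sup>2) \<le> 2 * (2 - 2 * cos (r * ?D x))" by simp
    then have "?c\<^sup>2 * (2 * ((1 - \<delta>) * (r * ?D x)\<^sup>2)) \<le> ?c\<^sup>2 * (2 * (2 - 2 * cos (r * ?D x)))"
      by (rule mult_left_mono) simp
    moreover have "?c\<^sup>2 * (2 * (r\<^sup>2 * (1 - \<delta>)) * (?D x)\<^sup>2) = ?c\<^sup>2 * (2 * ((1 - \<delta>) * (r * ?D x)\<^sup>2))"
      unfolding power_mult_distrib by (simp only: mult_ac)
    ultimately show "?c\<^sup>2 * (2 * (r\<^sup>2 * (1 - \<delta>)) * (?D x)\<^sup>2) \<le> ?A n x + ?A (- n) x"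
      unfolding A by (rule ord_eq_le_trans[rotated])
  qed
  also have "\<dots> = (LINT x|torus_cell. ?A n x) + (LINT x|torus_cell. ?A (- n) x)"
    by (intro Bochner_Integration.integral_add iA)
  finally show ?thesis by (simp only: norm_pullback_translate_diff[OF F])
qed

text \<open>The upper bound \<open>translation_energy\<close> meets the lower bound
  \<open>component_energy_lower\<close> at the frequency \<open>K\<close> in direction
  \<open>i\<close>. The order of choices matters: \<delta> from \<rho>, then \<open>K\<close> from
  \<delta>, and last the range of \<tau>, small compared with \<open>1 / K\<close>.\<close>

lemma gradient_bound:
  fixes F :: "real^'n \<Rightarrow> real^('n::finite)" and i :: 'n
  assumes F: "torus_map F" and \<Lambda>: "\<Lambda> \<ge> 1" "\<And>x y. norm (F x - F y) \<le> \<Lambda> * norm (x - y)"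
    and Fc: "continuous_on UNIV F"
    and energy: "\<And>\<epsilon>. \<epsilon> > 0 \<Longrightarrow> \<exists>R. \<forall>n J. finite J \<longrightarrow> R \<le> (japanese_bracket n)\<^sup>2 \<longrightarrow>
      (\<Sum>m\<in>J. (japanese_bracket m)\<^sup>2 * (pullback F (hartley n) \<bullet> hartley m)\<^sup>2) \<le> (1 + \<epsilon>) * (japanese_bracket n)\<^sup>2"
    and "\<rho> > 0"
  defines "D \<equiv> \<lambda>\<tau> j x. F (x + \<tau> *\<^sub>R axis j 1) $ i - F x $ i"
  shows "\<exists>\<tau>0>0. \<forall>\<tau>. 0 < \<tau> \<longrightarrow> \<tau> \<le> \<tau>0 \<longrightarrow>
    (hartley_const TYPE('n))\<^sup>2 * (\<Sum>j\<in>UNIV. LINT x|torus_cell. (D \<tau> j x)\<^sup>2) \<le> (1 + \<rho>) * \<tau>\<^sup>2"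
proof -
  let ?c = "hartley_const TYPE('n)"
  let ?e = "\<lambda>j. axis j (1::real) :: real^'n"
  have Db: "\<bar>D \<tau> j x\<bar> \<le> \<Lambda> * \<bar>\<tau>\<bar>" for \<tau> j x
  proof -
    have "\<bar>D \<tau> j x\<bar> \<le> norm (F (x + \<tau> *\<^sub>R ?e j) - F x)"
      using component_le_norm_cart[of "F (x + \<tau> *\<^sub>R ?e j) - F x" i] by (simp add: D_def)
    then show ?thesis using \<Lambda>(2)[of "x + \<tau> *\<^sub>R ?e j" x] by (simp add: norm_axis_1)
  qed
  have D2i: "integrable torus_cell (\<lambda>x. (D \<tau> j x)\<^sup>2)" for \<tau> j
  proof (rule integrable_torus_cell_bounded)
    show "(\<lambda>x. (D \<tau> j x)\<^sup>2) \<in> borel_measurable borel"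
      unfolding D_def by (intro borel_measurable_continuous_onI continuous_intros continuous_on_compose2[OF Fc]) auto
    show "\<bar>(D \<tau> j x)\<^sup>2\<bar> \<le> (\<Lambda> * \<bar>\<tau>\<bar>)\<^sup>2" for x
      using power_mono[OF Db, of \<tau> j x 2] by simp
  qed
  \<comment> \<open>Small enough for \<open>(1 + \<delta>) * (1 + \<delta>) \<le> (1 + \<rho>) * (1
    - \<delta>)\<close>: two factors \<open>1 + \<delta>\<close> arise from the energy bound and
    from \<open>1 + K\<^sup>2\<close>, the factor \<open>1 - \<delta>\<close> from the
    cosine.\<close>
  define \<delta> where "\<delta> = min (1/2) (\<rho> / 8)"
  have \<delta>: "0 < \<delta>" "\<delta> \<le> 1/2" "\<delta> \<le> \<rho> / 8" using \<open>\<rho> > 0\<close> by (auto simp: \<delta>_def)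
  obtain R where R: "\<And>n J. finite J \<Longrightarrow> R \<le> (japanese_bracket n)\<^sup>2 \<Longrightarrow>
      (\<Sum>m\<in>J. (japanese_bracket m)\<^sup>2 * (pullback F (hartley n) \<bullet> hartley m)\<^sup>2) \<le> (1 + \<delta>) * (japanese_bracket n)\<^sup>2"
    using energy[OF \<delta>(1)] by blast
  \<comment> \<open>\<open>K\<close> passes the threshold \<open>R\<close> of the energy bound and
    makes the 1 in \<open>1 + K\<^sup>2\<close> at most \<open>\<delta> * K\<^sup>2\<close>.\<close>
  obtain K :: nat where K: "real K \<ge> max R (max 1 (1 / \<delta>))" using real_arch_simple by blast
  have K1: "real K \<ge> 1" and KR: "R \<le> real K" and KD: "1 / \<delta> \<le> real K" using K by simp_all
  have KK: "real K \<le> (real K)\<^sup>2" using mult_right_mono[OF K1, of "real K"] by (simp add: power2_eq_square)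
  have Kd: "1 \<le> \<delta> * (real K)\<^sup>2"
  proof -
    have "1 / \<delta> \<le> (real K)\<^sup>2" using KD KK by linarith
    then show ?thesis using \<delta>(1) by (simp add: field_simps)
  qed
  define n :: "int^'n" where "n = (\<chi> l. if l = i then int K else 0)"
  have jn: "(japanese_bracket n)\<^sup>2 = 1 + (real K)\<^sup>2"
    unfolding japanese_bracket_square by (simp add: n_def if_distrib[of "\<lambda>z. (real_of_int z)\<^sup>2"] cong: if_cong)
  have ph: "phase n y = real K * y $ i" for y
    by (simp add: phase_def n_def if_distrib[of real_of_int] if_distrib[of "\<lambda>z. z * _"] cong: if_cong)
  have RK: "R \<le> (japanese_bracket n)\<^sup>2" unfolding jn using KR KK by linarith
  have E: "(\<Sum>j\<in>UNIV. (norm (pullback (\<lambda>x. x + \<tau> *\<^sub>R ?e j) (pullback F (hartley k)) - pullback F (hartley k)))\<^sup>2)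
      \<le> \<tau>\<^sup>2 * ((1 + \<delta>) * (1 + (real K)\<^sup>2))" if "k = n \<or> k = - n" for k \<tau>
  proof (rule translation_energy)
    fix J :: "(int^'n) set" assume "finite J"
    have "(japanese_bracket k)\<^sup>2 = 1 + (real K)\<^sup>2" using that jn by auto
    then show "(\<Sum>m\<in>J. (japanese_bracket m)\<^sup>2 * (pullback F (hartley k) \<bullet> hartley m)\<^sup>2) \<le> (1 + \<delta>) * (1 + (real K)\<^sup>2)"
      using R[OF \<open>finite J\<close>, of k] RK jn by simp
  qed
  \<comment> \<open>Increments of \<open>F\<close> are at most \<open>\<Lambda> * \<tau>\<close>, so
    the phases change by at most \<delta>, as the lower bound requires.\<close>
  define \<tau>0 where "\<tau>0 = \<delta> / (real K * \<Lambda>)"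
  have "\<tau>0 > 0" using \<delta> K1 \<Lambda>(1) by (simp add: \<tau>0_def)
  moreover have "?c\<^sup>2 * (\<Sum>j\<in>UNIV. LINT x|torus_cell. (D \<tau> j x)\<^sup>2) \<le> (1 + \<rho>) * \<tau>\<^sup>2"
    if \<tau>: "0 < \<tau>" "\<tau> \<le> \<tau>0" for \<tau>
  proof -
    have KD: "\<bar>real K * D \<tau> j x\<bar> \<le> \<delta>" for j x
    proof -
      have "\<bar>real K * D \<tau> j x\<bar> \<le> real K * (\<Lambda> * \<tau>)"
        unfolding abs_mult using Db[of \<tau> j x] \<tau> by (intro mult_mono) auto
      also have "\<dots> \<le> \<delta>" using \<tau>(2) K1 \<Lambda>(1) by (simp add: \<tau>0_def field_simps)
      finally show ?thesis .
    qed
    have lower: "?c\<^sup>2 * (2 * ((real K)\<^sup>2 * (1 - \<delta>)) * (LINT x|torus_cell. (D \<tau> j x)\<^sup>2)) \<le>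
      (norm (pullback (\<lambda>x. x + \<tau> *\<^sub>R ?e j) (pullback F (hartley n)) - pullback F (hartley n)))\<^sup>2 +
      (norm (pullback (\<lambda>x. x + \<tau> *\<^sub>R ?e j) (pullback F (hartley (- n))) - pullback F (hartley (- n))))\<^sup>2" for j
      using component_energy_lower[OF F Fc ph \<delta>(1,2) KD[unfolded D_def] D2i[unfolded D_def]] by (simp only: D_def)
    let ?S = "\<Sum>j\<in>UNIV. LINT x|torus_cell. (D \<tau> j x)\<^sup>2"
    have "2 * ((real K)\<^sup>2 * (1 - \<delta>)) * (?c\<^sup>2 * ?S) =
       (\<Sum>j\<in>UNIV. ?c\<^sup>2 * (2 * ((real K)\<^sup>2 * (1 - \<delta>)) * (LINT x|torus_cell. (D \<tau> j x)\<^sup>2)))"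
      by (simp only: sum_distrib_left mult_ac)
    also have "\<dots> \<le> 2 * (\<tau>\<^sup>2 * ((1 + \<delta>) * (1 + (real K)\<^sup>2)))"
      by (rule order_trans[OF sum_mono[OF lower]])
         (use E[of n \<tau>] E[of "- n" \<tau>] in \<open>simp add: sum.distrib\<close>)
    also have "\<dots> \<le> 2 * (\<tau>\<^sup>2 * ((1 + \<delta>) * ((1 + \<delta>) * (real K)\<^sup>2)))"
    proof -
      have "1 + (real K)\<^sup>2 \<le> (1 + \<delta>) * (real K)\<^sup>2" using Kd by (simp add: distrib_right)
      then show ?thesis using \<delta> by (intro mult_left_mono) auto
    qed
    also have "\<dots> = 2 * (real K)\<^sup>2 * (\<tau>\<^sup>2 * ((1 + \<delta>) * (1 + \<delta>)))" by (simp only: mult_ac)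
    also have "\<dots> \<le> 2 * (real K)\<^sup>2 * (\<tau>\<^sup>2 * ((1 + \<rho>) * (1 - \<delta>)))"
    proof -
      have "\<delta> * \<delta> \<le> 1/2 * \<delta>" using \<delta> by (intro mult_right_mono) auto
      have "\<rho> * \<delta> \<le> \<rho> * (1/2)" using \<delta> \<open>\<rho> > 0\<close> by (intro mult_left_mono) auto
      have "(1 + \<delta>) * (1 + \<delta>) \<le> (1 + \<rho>) * (1 - \<delta>)"
      proof -
        have "(1 + \<delta>) * (1 + \<delta>) = 1 + 2 * \<delta> + \<delta> * \<delta>" "(1 + \<rho>) * (1 - \<delta>) = 1 + \<rho> - \<delta> - \<rho> * \<delta>"
          by algebra+
        then show ?thesis
          using \<delta> \<open>\<delta> * \<delta> \<le> 1/2 * \<delta>\<close> \<open>\<rho> * \<delta> \<le> \<rho> * (1/2)\<close> by linarith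
      qed
      then show ?thesis by (intro mult_left_mono) auto
    qed
    also have "\<dots> = (2 * ((real K)\<^sup>2 * (1 - \<delta>))) * ((1 + \<rho>) * \<tau>\<^sup>2)" by (simp only: mult_ac)
    finally have "(2 * ((real K)\<^sup>2 * (1 - \<delta>))) * (?c\<^sup>2 * ?S) \<le> (2 * ((real K)\<^sup>2 * (1 - \<delta>))) * ((1 + \<rho>) * \<tau>\<^sup>2)" .
    moreover have "2 * ((real K)\<^sup>2 * (1 - \<delta>)) > 0" using K1 \<delta> by simp
    ultimately show ?thesis by (rule mult_left_le_imp_le)
  qed
  ultimately show ?thesis by blast
qed

lemma exists_lattice_translate: "\<exists>k. x + lattice_vector k \<in> half_open_cell"
proof (rule ccontr)
  assume "\<nexists>k. x + lattice_vector k \<in> half_open_cell"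
  then have "(\<integral>\<^sup>+k. indicator half_open_cell (x + lattice_vector k) \<partial>count_space UNIV) = (0::ennreal)"
    by simp
  then show False using nn_integral_cell_translates[of x] by simp
qed

lemma continuous_periodic_bounded:
  fixes P :: "real^'n \<Rightarrow> real"
  assumes "torus_periodic P" "continuous_on UNIV P"
  obtains B where "\<And>x. \<bar>P x\<bar> \<le> B"
proof -
  have "compact (P ` cbox 0 (\<chi> i. 2 * pi))"
    by (intro compact_continuous_image continuous_on_subset[OF assms(2)] compact_cbox) auto
  then have "bounded (P ` cbox 0 (\<chi> i. 2 * pi))" by (rule compact_imp_bounded)
  then obtain B where B: "\<forall>y\<in>P ` cbox 0 (\<chi> i. 2 * pi). norm y \<le> B" unfolding bounded_iff by blast
  have "\<bar>P x\<bar> \<le> B" for x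
  proof -
    obtain k where "x + lattice_vector k \<in> half_open_cell" using exists_lattice_translate by blast
    then have "x + lattice_vector k \<in> cbox 0 (\<chi> i. 2 * pi)"
      by (auto simp: half_open_cell_def mem_box_cart less_imp_le)
    then have "norm (P (x + lattice_vector k)) \<le> B" using B by blast
    then show ?thesis by (simp add: torus_periodic_lattice[OF assms(1)])
  qed
  then show ?thesis by (rule that)
qed

text \<open>\<open>P\<close> is not known to be differentiable. A translation by \<tau> along an
  axis with \<open>m $ j \<noteq> 0\<close> acts at the frequency \<open>m\<close> as a rotation
  through \<open>\<tau> * m $ j\<close>; differences that are small compared with \<tau> in the mean
  therefore force the coefficient at \<open>m\<close> to vanish. Only the frequency 0
  survives.\<close>

lemma periodic_constant:
  fixes P :: "real^'n \<Rightarrow> real"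
  assumes Pp: "torus_periodic P" and Pc: "continuous_on UNIV P"
    and small: "\<And>\<rho>. \<rho> > 0 \<Longrightarrow> \<exists>\<tau>0>0. \<forall>\<tau> j. 0 < \<tau> \<longrightarrow> \<tau> \<le> \<tau>0 \<longrightarrow>
        (LINT x|torus_cell. (P (x + \<tau> *\<^sub>R axis j 1) - P x)\<^sup>2) \<le> \<rho> * \<tau>\<^sup>2"
  shows "P x = P 0"
proof -
  let ?e = "\<lambda>j. axis j (1::real) :: real^'n"
  have Pm: "P \<in> borel_measurable borel" by (intro borel_measurable_continuous_onI Pc)
  obtain B where B: "\<And>x. \<bar>P x\<bar> \<le> B" by (rule continuous_periodic_bounded[OF Pp Pc]) (rule that)
  have Psq: "torus_square_integrable P"
    by (rule torus_square_integrable_bounded[OF Pp Pm B])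
  define p where "p = abs_torus_L2 P"
  have Psq': "torus_square_integrable (\<lambda>x. P (x + a))" for a
    using torus_square_integrable_comp[OF torus_map_translation Psq] by (simp add: comp_def)
  have Np: "(norm (pullback (\<lambda>x. x + a) p - p))\<^sup>2 = (LINT x|torus_cell. (P (x + a) - P x)\<^sup>2)" for a
  proof -
    have "pullback (\<lambda>x. x + a) p - p = abs_torus_L2 (\<lambda>x. P (x + a) - P x)"
      unfolding p_def pullback_abs[OF torus_map_translation Psq] comp_def
      by (rule minus_abs_torus_L2[OF Psq' Psq])
    then show ?thesis by (simp only: norm_abs_torus_L2[OF torus_square_integrable_diff[OF Psq' Psq]])
  qed
  have zero: "p \<bullet> hartley m = 0" if "m \<noteq> 0" for m
  proof -
    obtain j where j: "m $ j \<noteq> 0" using \<open>m \<noteq> 0\<close> by (auto simp: vec_eq_iff)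
    define M where "M = real_of_int (m $ j)"
    have M: "M \<noteq> 0" using j by (simp add: M_def)
    have "3/4 * M\<^sup>2 * (p \<bullet> hartley m)\<^sup>2 \<le> \<rho>" if "\<rho> > 0" for \<rho>
    proof -
      obtain \<tau>0 where \<tau>0: "\<tau>0 > 0" "\<And>\<tau> j. 0 < \<tau> \<Longrightarrow> \<tau> \<le> \<tau>0 \<Longrightarrow>
          (LINT x|torus_cell. (P (x + \<tau> *\<^sub>R ?e j) - P x)\<^sup>2) \<le> \<rho> * \<tau>\<^sup>2"
        using small[OF \<open>\<rho> > 0\<close>] by blast
      \<comment> \<open>Keeps \<open>\<tau> * M\<close> within 1/2, where the cosine bound has the
        factor 3/4 = 1 - (1/2)^2.\<close>
      define \<tau> where "\<tau> = min \<tau>0 (1 / (2 * \<bar>M\<bar>))"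
      have \<tau>: "0 < \<tau>" "\<tau> \<le> \<tau>0" using M \<tau>0(1) by (auto simp: \<tau>_def)
      have "\<bar>\<tau> * M\<bar> \<le> 1 / (2 * \<bar>M\<bar>) * \<bar>M\<bar>"
        unfolding abs_mult using \<tau>(1) by (intro mult_right_mono) (auto simp: \<tau>_def)
      then have \<tau>M: "\<bar>\<tau> * M\<bar> \<le> 1/2" using M by simp
      have "(\<tau> * M)\<^sup>2 * (1 - (1/2)\<^sup>2) * (p \<bullet> hartley m)\<^sup>2 \<le> (2 - 2 * cos (phase m (\<tau> *\<^sub>R ?e j))) * (p \<bullet> hartley m)\<^sup>2"
        unfolding phase_scaleR phase_axis M_def[symmetric]
        by (intro mult_right_mono one_minus_cos_ge[OF \<tau>M]) auto
      also have "\<dots> \<le> (norm (pullback (\<lambda>x. x + \<tau> *\<^sub>R ?e j) p - p))\<^sup>2"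
        by (rule inner_hartley_pair_le[OF \<open>m \<noteq> 0\<close>])
      also have "\<dots> \<le> \<rho> * \<tau>\<^sup>2" unfolding Np by (rule \<tau>0(2)[OF \<tau>])
      finally have "\<tau>\<^sup>2 * (3/4 * M\<^sup>2 * (p \<bullet> hartley m)\<^sup>2) \<le> \<tau>\<^sup>2 * \<rho>"
        by (simp add: power_mult_distrib power_divide mult_ac)
      moreover have "\<tau>\<^sup>2 > 0" using \<tau> by simp
      ultimately show ?thesis by (rule mult_left_le_imp_le)
    qed
    then have "3/4 * M\<^sup>2 * (p \<bullet> hartley m)\<^sup>2 \<le> 0 + \<epsilon>" if "\<epsilon> > 0" for \<epsilon> using that by simp
    then have "3/4 * M\<^sup>2 * (p \<bullet> hartley m)\<^sup>2 \<le> 0" by (rule field_le_epsilon)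
    moreover have "3/4 * M\<^sup>2 > 0" using M by simp
    ultimately show ?thesis by (simp add: mult_le_0_iff)
  qed
  let ?k = "\<lambda>x::real^'n. (p \<bullet> hartley 0) * (hartley_const TYPE('n) * cas (phase 0 x))"
  have "p = (p \<bullet> hartley 0) *\<^sub>R hartley 0"
  proof (rule hartley.basis_eqI)
    show "p \<bullet> hartley m = ((p \<bullet> hartley 0) *\<^sub>R hartley 0) \<bullet> hartley m" for m
      using zero[of m] by (cases "m = 0") (simp_all add: inner_hartley)
  qed
  also have "\<dots> = abs_torus_L2 ?k"
    unfolding hartley_def by (intro scaleR_abs_torus_L2 torus_square_integrable_scale torus_square_integrable_cas)
  finally have eq: "abs_torus_L2 P = abs_torus_L2 ?k" by (simp only: p_def)
  have sq0: "torus_square_integrable ?k"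
    by (intro torus_square_integrable_scale torus_square_integrable_cas)
  have "torus_L2_rel P P \<and> torus_L2_rel ?k ?k \<and> abs_torus_L2 P = abs_torus_L2 ?k"
    using Psq sq0 eq by (simp only: torus_L2_rel_refl simp_thms)
  then have "torus_L2_rel P ?k" by (rule iffD1[OF Quotient3_rel[OF Quotient3_torus_L2]])
  then have ae: "AE x in torus_cell. P x = (p \<bullet> hartley 0) * (hartley_const TYPE('n) * cas 0)"
    by (simp add: torus_L2_rel_def)
  have "P z = (p \<bullet> hartley 0) * (hartley_const TYPE('n) * cas 0)" for z
    by (rule constant_if_AE_constant[OF Pc Pp ae])
  from this[of x] this[of 0] show ?thesis by (simp only:)
qed

text \<open>Test functions depending on a single component \<open>F x $ i\<close> suffice: on one hand, their
  energies control the mean square of the gradient of \<open>F x $ i\<close>; on the other hand, the mean of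
  this gradient is a unit vector, as \<open>F x $ i - x $ i\<close> is periodic.\<close>

lemma energy_rigidity:
  fixes F :: "real^'n \<Rightarrow> real^('n::finite)"
  assumes F: "torus_map F" and \<Lambda>: "\<Lambda> \<ge> 1" "\<And>x y. norm (F x - F y) \<le> \<Lambda> * norm (x - y)"
    and energy: "\<And>\<epsilon>. \<epsilon> > 0 \<Longrightarrow> \<exists>R. \<forall>n J. finite J \<longrightarrow> R \<le> (japanese_bracket n)\<^sup>2 \<longrightarrow>
      (\<Sum>m\<in>J. (japanese_bracket m)\<^sup>2 * (pullback F (hartley n) \<bullet> hartley m)\<^sup>2) \<le> (1 + \<epsilon>) * (japanese_bracket n)\<^sup>2"
  shows "F x = x + F 0"
proof -
  let ?c = "hartley_const TYPE('n)"
  let ?e = "\<lambda>j. axis j (1::real) :: real^'n"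
  have Fc: "continuous_on UNIV F"
  proof -
    have "\<Lambda>-lipschitz_on UNIV F" using \<Lambda> by (intro lipschitz_onI) (auto simp: dist_norm)
    then show ?thesis by (rule lipschitz_on_continuous_on)
  qed
  have comp: "F x $ i = x $ i + F 0 $ i" for x i
  proof -
    define P where "P x = F x $ i - x $ i" for x
    have Pp: "torus_periodic P"
      unfolding torus_periodic_def P_def by (simp add: torus_map_axis[OF F])
    have Pc: "continuous_on UNIV P" unfolding P_def by (intro continuous_intros Fc)
    have Pm: "P \<in> borel_measurable borel" by (intro borel_measurable_continuous_onI Pc)
    obtain B where B: "\<And>x. \<bar>P x\<bar> \<le> B" by (rule continuous_periodic_bounded[OF Pp Pc]) (rule that)
    have Pi: "integrable torus_cell P" by (rule integrable_torus_cell_bounded[OF Pm B])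
    have Psq: "torus_square_integrable P" by (rule torus_square_integrable_bounded[OF Pp Pm B])
    have Psq': "torus_square_integrable (\<lambda>x. P (x + a))" for a
      using torus_square_integrable_comp[OF torus_map_translation Psq] by (simp add: comp_def)
    have "P x = P 0" for x
    proof (rule periodic_constant[OF Pp Pc])
      fix \<rho> :: real assume "\<rho> > 0"
      \<comment> \<open>\<open>gradient_bound\<close> is normalised to the mean, the goal to the
        integral; the factor between them is \<open>?c\<^sup>2\<close>, the inverse volume.\<close>
      define \<rho>' where "\<rho>' = ?c\<^sup>2 * \<rho>"
      have "\<rho>' > 0" using \<open>\<rho> > 0\<close> hartley_const_pos[where 'n = 'n] by (simp add: \<rho>'_def)
      obtain \<tau>0 where "\<tau>0 > 0" and \<tau>0: "\<And>\<tau>. 0 < \<tau> \<Longrightarrow> \<tau> \<le> \<tau>0 \<Longrightarrow>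
          ?c\<^sup>2 * (\<Sum>j\<in>UNIV. LINT x|torus_cell. (F (x + \<tau> *\<^sub>R ?e j) $ i - F x $ i)\<^sup>2) \<le> (1 + \<rho>') * \<tau>\<^sup>2"
        using gradient_bound[OF F \<Lambda> Fc energy \<open>\<rho>' > 0\<close>, of i] by blast
      have "(LINT x|torus_cell. (P (x + \<tau> *\<^sub>R ?e j) - P x)\<^sup>2) \<le> \<rho> * \<tau>\<^sup>2"
        if \<tau>: "0 < \<tau>" "\<tau> \<le> \<tau>0" for \<tau> j
      proof -
        define t where "t j = (if j = i then \<tau> else 0)" for j
        define V where "V j = (LINT x|torus_cell. (P (x + \<tau> *\<^sub>R ?e j) - P x)\<^sup>2)" for j
        have V0: "V j \<ge> 0" for j by (simp add: V_def)
        have Pi': "integrable torus_cell (\<lambda>x. P (x + a))" "(LINT x|torus_cell. P (x + a)) = (LINT x|torus_cell. P x)" for a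
          by (rule torus_map_integral[OF torus_map_translation Pp Pi Pm])+
        have i2: "integrable torus_cell (\<lambda>x. (P (x + a) - P x)\<^sup>2)" for a
          using torus_square_integrable_diff[OF Psq' Psq] by (simp add: torus_square_integrable_def)
        have i1: "integrable torus_cell (\<lambda>x. 2 * s * (P (x + a) - P x))" for a s
          by (intro integrable_mult_right Bochner_Integration.integrable_diff Pi Pi')
        have ic: "integrable (torus_cell :: (real^'n) measure) (\<lambda>x. s :: real)" for s
          by (rule integrable_torus_cell_bounded[of _ "\<bar>s\<bar>"]) auto
        \<comment> \<open>Pythagoras: the cross term vanishes because \<open>P\<close> and its
          translate have the same integral. The contribution of the identity map sums over
          \<open>j\<close> to exactly \<open>\<tau>\<^sup>2\<close> in the mean, which uses up the 1
          in \<open>1 + \<rho>'\<close>.\<close>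
        have DD: "(LINT x|torus_cell. (F (x + \<tau> *\<^sub>R ?e j) $ i - F x $ i)\<^sup>2) = V j + (t j)\<^sup>2 * (2 * pi) ^ CARD('n)" for j
        proof -
          have "(LINT x|torus_cell. (F (x + \<tau> *\<^sub>R ?e j) $ i - F x $ i)\<^sup>2) =
            (LINT x|torus_cell. ((P (x + \<tau> *\<^sub>R ?e j) - P x)\<^sup>2 + 2 * t j * (P (x + \<tau> *\<^sub>R ?e j) - P x)) + (t j)\<^sup>2)"
          proof (rule Bochner_Integration.integral_cong[OF refl])
            fix x
            have "F (x + \<tau> *\<^sub>R ?e j) $ i - F x $ i = (P (x + \<tau> *\<^sub>R ?e j) - P x) + t j"
              by (simp add: P_def t_def axis_def)
            then show "(F (x + \<tau> *\<^sub>R ?e j) $ i - F x $ i)\<^sup>2 =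
                ((P (x + \<tau> *\<^sub>R ?e j) - P x)\<^sup>2 + 2 * t j * (P (x + \<tau> *\<^sub>R ?e j) - P x)) + (t j)\<^sup>2"
              by (simp only: power2_sum) (simp only: add_ac mult_ac)
          qed
          also have "\<dots> = (V j + 2 * t j * ((LINT x|torus_cell. P (x + \<tau> *\<^sub>R ?e j)) - (LINT x|torus_cell. P x))) +
              (LINT x|(torus_cell :: (real^'n) measure). (t j)\<^sup>2)"
            unfolding V_def using i1[of "t j" "\<tau> *\<^sub>R ?e j"] i2[of "\<tau> *\<^sub>R ?e j"] ic[of "(t j)\<^sup>2"] Pi Pi'(1)[of "\<tau> *\<^sub>R ?e j"]
            by (simp only: Bochner_Integration.integral_add Bochner_Integration.integrable_add
                integral_mult_right_zero Bochner_Integration.integral_diff)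
          also have "(LINT x|(torus_cell :: (real^'n) measure). (t j)\<^sup>2) = (t j)\<^sup>2 * (2 * pi) ^ CARD('n)"
            by (simp add: measure_torus_cell del: power_mult_distrib)
          finally show ?thesis by (simp add: Pi'(2) del: power_mult_distrib)
        qed
        have tsum: "(\<Sum>j\<in>UNIV. (t j)\<^sup>2) = \<tau>\<^sup>2" by (simp add: t_def if_distrib[of "\<lambda>z. z\<^sup>2"] cong: if_cong)
        have "?c\<^sup>2 * (\<Sum>j\<in>UNIV. LINT x|torus_cell. (F (x + \<tau> *\<^sub>R ?e j) $ i - F x $ i)\<^sup>2) =
            ?c\<^sup>2 * (\<Sum>j\<in>UNIV. V j) + (?c\<^sup>2 * (2 * pi) ^ CARD('n)) * \<tau>\<^sup>2"
          unfolding DD sum.distrib sum_distrib_right[symmetric] tsum distrib_left by (simp only: mult_ac)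
        then have "?c\<^sup>2 * (\<Sum>j\<in>UNIV. V j) \<le> \<rho>' * \<tau>\<^sup>2"
          using \<tau>0[OF \<tau>] unfolding hartley_const_square by (simp add: distrib_right)
        then have "?c\<^sup>2 * (\<Sum>j\<in>UNIV. V j) \<le> ?c\<^sup>2 * (\<rho> * \<tau>\<^sup>2)" by (simp add: \<rho>'_def mult.assoc)
        moreover have "?c\<^sup>2 > 0" using hartley_const_pos[where 'n = 'n] by simp
        ultimately have "(\<Sum>j\<in>UNIV. V j) \<le> \<rho> * \<tau>\<^sup>2" by (rule mult_left_le_imp_le)
        moreover have "V j \<le> (\<Sum>j\<in>UNIV. V j)" by (rule member_le_sum) (auto simp: V0)
        ultimately show ?thesis unfolding V_def by linarith
      qed
      with \<open>\<tau>0 > 0\<close> show "\<exists>\<tau>0>0. \<forall>\<tau> j. 0 < \<tau> \<longrightarrow> \<tau> \<le> \<tau>0 \<longrightarrow>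
        (LINT x|torus_cell. (P (x + \<tau> *\<^sub>R axis j 1) - P x)\<^sup>2) \<le> \<rho> * \<tau>\<^sup>2" by blast
    qed
    then have "P x = P 0" .
    then show ?thesis by (simp add: P_def)
  qed
  then show ?thesis unfolding vec_eq_iff vector_add_component by blast
qed

section \<open>Equivalence of invariance and spatial constancy\<close>

text \<open>Lebesgue differentiation: almost everywhere \<open>f x\<close> is the limit of averages
  over intervals to the right of \<open>x\<close>, all of which are 0.\<close>

lemma negligible_nonzero_if_integrals_zero:
  fixes f :: "real \<Rightarrow> 'b::euclidean_space"
  assumes int: "\<And>a b. f integrable_on {a..b}" and zero: "\<And>a b. a \<le> b \<Longrightarrow> integral {a..b} f = 0"
  shows "negligible {t. f t \<noteq> 0}"
proof -
  have "f integrable_on cbox a b" for a b using int by (simp add: cbox_interval)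
  from integrable_ccontinuous_explicit[OF this] obtain Z where Z: "negligible Z"
    "\<And>x e. x \<notin> Z \<Longrightarrow> 0 < e \<Longrightarrow> \<exists>d>0. \<forall>h. 0 < h \<and> h < d \<longrightarrow>
      norm (integral (cbox x (x + h *\<^sub>R One)) f /\<^sub>R h ^ DIM(real) - f x) < e" by blast
  have "f x = 0" if x: "x \<notin> Z" for x
  proof (rule ccontr)
    assume "f x \<noteq> 0"
    then obtain d where d: "d > 0" "\<And>h. 0 < h \<Longrightarrow> h < d \<Longrightarrow>
        norm (integral (cbox x (x + h *\<^sub>R One)) f /\<^sub>R h ^ DIM(real) - f x) < norm (f x)"
      using Z(2)[OF x, of "norm (f x)"] by auto
    show False using d(2)[of "d / 2"] zero[of x "x + d / 2"] \<open>d > 0\<close> by simp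
  qed
  then have "{t. f t \<noteq> 0} \<subseteq> Z" by blast
  with Z(1) show ?thesis by (rule negligible_subset)
qed

section \<open>Translations and spatially constant fields\<close>

context torus_flow
begin

text \<open>All trajectories have equal increments, so for fixed \<open>x\<close> the field agrees
  along the trajectories of \<open>x\<close> and 0 at almost every time. The null set depends on
  \<open>x\<close>; a countable dense set of starting points gives a common one, and continuity
  extends the equality to all points.\<close>

lemma spatially_constant_if_translation:
  assumes X: "\<And>t x. X t x = x + X t 0"
  shows "spatially_constant u"
proof -
  obtain D :: "(real^'n) set" where D: "countable D" "\<And>U. open U \<Longrightarrow> U \<noteq> {} \<Longrightarrow> \<exists>d\<in>D. d \<in> U"
    by (erule countable_dense_setE)
  have neg: "negligible {s. u s (X s x) - u s (X s 0) \<noteq> 0}" for x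
  proof (rule negligible_nonzero_if_integrals_zero)
    have i: "(\<lambda>s. u s (X s y)) integrable_on {a..b}" for a b y
      using solution_X[of y] by (cases "a \<le> b") (auto simp: solution_def)
    then show "(\<lambda>s. u s (X s x) - u s (X s 0)) integrable_on {a..b}" for a b
      by (intro Henstock_Kurzweil_Integration.integrable_diff)
    fix a b :: real assume "a \<le> b"
    then have "integral {a..b} (\<lambda>s. u s (X s x) - u s (X s 0)) = (X b x - X a x) - (X b 0 - X a 0)"
      using solution_X by (simp add: Henstock_Kurzweil_Integration.integral_diff i solution_def)
    then show "integral {a..b} (\<lambda>s. u s (X s x) - u s (X s 0)) = 0"
      using X[of a x] X[of b x] by simp
  qed
  have "AE s in lebesgue. \<forall>x\<in>D. u s (X s x) - u s (X s 0) = 0"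
  proof (rule AE_ball_countable'[OF _ D(1)])
    show "AE s in lebesgue. u s (X s x) - u s (X s 0) = 0" for x
      by (rule AE_I'[of "{s. u s (X s x) - u s (X s 0) \<noteq> 0}"])
        (use neg[of x] in \<open>auto simp: negligible_iff_null_sets\<close>)
  qed
  then have "AE s in lebesgue. \<forall>x. u s x = u s 0"
  proof eventually_elim
    case (elim s)
    \<comment> \<open>The trajectories are at \<open>x + X s 0\<close> at time \<open>s\<close>, and
      these positions fill the whole space as \<open>x\<close> varies.\<close>
    define g where "g x = u s (x + X s 0) - u s (X s 0)" for x
    have gc: "continuous_on UNIV g" unfolding g_def
      by (intro continuous_on_diff continuous_on_const continuous_on_compose2[OF u_continuous[of UNIV s]] continuous_intros) auto
    have "g x = 0" for x
    proof (rule ccontr)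
      assume "g x \<noteq> 0"
      moreover have "open {x. g x \<noteq> 0}"
        using open_Collect_neq[OF gc continuous_on_const[of UNIV 0]] .
      ultimately obtain d where "d \<in> D" "g d \<noteq> 0" using D(2)[of "{x. g x \<noteq> 0}"] by auto
      then show False using bspec[OF elim \<open>d \<in> D\<close>] by (simp add: g_def flip: X)
    qed
    then have "u s (x + X s 0) = u s (X s 0)" for x by (simp add: g_def)
    from this[of "_ - X s 0"] have "u s x = u s (X s 0)" for x by simp
    then show ?case by metis
  qed
  moreover have "(\<lambda>s. u s 0) absolutely_integrable_on {-T..T}" for T
  proof (rule measurable_bounded_by_integrable_imp_absolutely_integrable)
    show "(\<lambda>s. u s 0) \<in> borel_measurable (lebesgue_on {-T..T})"
      using meas by (rule measurable_restrict_space1)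
  qed (auto intro: N_integrable u_bound)
  ultimately show ?thesis unfolding spatially_constant_def by (intro exI[of _ "\<lambda>s. u s 0"]) auto
qed

lemma translation_if_spatially_constant:
  assumes "spatially_constant u"
  shows "X t x = x + X t 0"
proof -
  obtain c :: "real \<Rightarrow> real^'n" where "AE t in lebesgue. \<forall>x. u t x = c t"
    using assms unfolding spatially_constant_def by blast
  then obtain Z where Z: "Z \<in> null_sets lebesgue" "\<And>t. t \<notin> Z \<Longrightarrow> (\<forall>x. u t x = c t)"
    unfolding eventually_ae_filter by auto
  then have "negligible Z" by (simp add: negligible_iff_null_sets)
  have "X b x - X a x = X b 0 - X a 0" if "a \<le> b" for a b
  proof -
    have "integral {a..b} (\<lambda>s. u s (X s x)) = integral {a..b} (\<lambda>s. u s (X s 0))"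
      by (rule integral_spike[OF \<open>negligible Z\<close>]) (use Z(2) in auto)
    then show ?thesis using solution_X[of x] solution_X[of 0] that by (simp add: solution_def)
  qed
  from this[of 0 t] this[of t 0] show ?thesis by (cases "0 \<le> t") (auto simp: algebra_simps)
qed

end


section \<open>The Gaussian measure with Bessel covariance\<close>

lemma diagonal_gaussian_bessel:
  fixes \<mu> :: "('n::finite) torus_L2 measure"
  assumes "centered_gaussian \<mu>" and C: "has_covariance_operator \<mu> (bessel_potential \<alpha>)"
  shows "diagonal_gaussian \<mu> hartley (\<lambda>n. (japanese_bracket n)\<^sup>2 powr (- \<alpha>))"
proof -
  interpret gaussian_measure \<mu> by unfold_locales fact
  show ?thesis
  proof unfold_locales
    show "0 < (japanese_bracket i)\<^sup>2 powr - \<alpha>" for i :: "int^'n"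
      using japanese_bracket_ge_1[of i] by simp
    show "cov f (hartley i) = (japanese_bracket i)\<^sup>2 powr - \<alpha> * (f \<bullet> hartley i)" for f i
    proof -
      have "cov f (hartley i) = f \<bullet> bessel_potential \<alpha> (hartley i)"
        using C unfolding has_covariance_operator_def cov_def by (simp only: inner_commute[of "hartley i"])
      then show ?thesis by (simp add: bessel_potential_hartley)
    qed
  qed
qed

lemma countable_lattice: "countable (UNIV :: (int^'n) set)"
proof -
  have "inj (vec_nth :: int^'n \<Rightarrow> 'n \<Rightarrow> int)" by (simp add: vec_nth_inject inj_def)
  then show ?thesis using countableI_type by (rule countable_image_inj_on[rotated])
qed

text \<open>A translation rotates each plane of \<open>hartley n\<close> and
  \<open>hartley (- n)\<close>, on which the covariance is a multiple of the identity since
  \<open>w\<close> is even. So the characteristic functional is unchanged, and it determines the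
  measure.\<close>

lemma translation_invariant_gaussian:
  fixes \<mu> :: "('n::finite) torus_L2 measure"
  assumes "diagonal_gaussian \<mu> hartley w" and even: "\<And>n. w (- n) = w n"
  shows "distr \<mu> borel (pullback (\<lambda>x. x + a)) = \<mu>"
proof -
  interpret diagonal_gaussian \<mu> hartley w by fact
  let ?S = "pullback (\<lambda>x. x + a) :: 'n torus_L2 \<Rightarrow> 'n torus_L2"
  define S' where "S' = (pullback (\<lambda>x. x + - a) :: 'n torus_L2 \<Rightarrow> 'n torus_L2)"
  have tm: "torus_map (\<lambda>x. x + b)" for b :: "real^'n" by (rule torus_map_translation)
  have adj: "f \<bullet> ?S g = S' f \<bullet> g" for f g
    unfolding S'_def by (rule inner_pullback_adjoint[OF tm tm, symmetric]) simp
  have "?S \<in> borel_measurable borel" by (rule pullback_borel[OF tm])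
  then have S [measurable]: "?S \<in> measurable \<mu> borel" by (simp cong: measurable_cong_sets)
  have lin: "linear S'" unfolding S'_def using bounded_linear_pullback[OF tm] by (rule bounded_linear.linear)
  have basis: "cov (S' f) (S' (hartley n)) = cov f (hartley n)" for f n
  proof -
    have h: "S' (hartley n) = cos (phase n (- a)) *\<^sub>R hartley n + sin (phase n (- a)) *\<^sub>R hartley (- n)"
      unfolding S'_def by (rule pullback_translation_hartley)
    have "cov (S' f) (S' (hartley n)) =
        cos (phase n (- a)) * (w n * (S' f \<bullet> hartley n)) + sin (phase n (- a)) * (w n * (S' f \<bullet> hartley (- n)))"
      unfolding h cov_add_right cov_scaleR_right cov_basis even ..
    also have "\<dots> = w n * (S' f \<bullet> S' (hartley n))"
      unfolding h inner_add_right inner_scaleR_right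
      by (simp only: distrib_left mult_ac)
    also have "S' f \<bullet> S' (hartley n) = f \<bullet> hartley n" unfolding S'_def by (rule inner_pullback[OF tm])
    finally show ?thesis by (simp add: cov_basis)
  qed
  have cov_eq: "cov (S' f) (S' h) = cov f h" if "h \<in> span (range hartley)" for f h
    using that
  proof (induction h rule: span_induct_alt)
    case base then show ?case by (simp add: linear_0[OF lin])
  next
    case (step c x y)
    then show ?case
      by (auto simp: linear_add[OF lin] linear_scale[OF lin] cov_add_right cov_scaleR_right basis)
  qed
  have m: "(\<lambda>\<phi>. cos (h \<bullet> \<phi>)) \<in> borel_measurable borel" "(\<lambda>\<phi>. sin (h \<bullet> \<phi>)) \<in> borel_measurable borel"
    for h :: "'n torus_L2"
    by (intro borel_measurable_continuous_onI continuous_intros)+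
  show ?thesis
  proof (rule hartley.measure_eqI_char[OF countable_lattice])
    show "prob_space (distr \<mu> borel ?S)" by (rule prob_space_distr) (rule S)
    fix h :: "'n torus_L2" assume h: "h \<in> span (range hartley)"
    show "(LINT \<phi>|distr \<mu> borel ?S. cos (h \<bullet> \<phi>)) = (LINT \<phi>|\<mu>. cos (h \<bullet> \<phi>))"
      by (subst integral_distr[OF S m(1)]) (simp add: adj expectation_cos cov_eq[OF h])
    show "(LINT \<phi>|distr \<mu> borel ?S. sin (h \<bullet> \<phi>)) = (LINT \<phi>|\<mu>. sin (h \<bullet> \<phi>))"
      by (subst integral_distr[OF S m(2)]) (simp add: adj expectation_sin)
  qed (simp_all add: sets_gaussian prob_space_axioms)
qed

context torus_flow
begin

text \<open>The roles: \<open>S\<close> is composition with \<open>inv (X t)\<close>, its adjoint is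
  composition with \<open>X t\<close>, and \<open>v\<close> is the squared bracket, so that the
  weights \<open>v\<close> and \<open>v powr \<alpha>\<close> are those of orders 1 and
  \<alpha>.\<close>

lemma inv_X_translation_if_absolutely_continuous:
  fixes \<mu> :: "'n torus_L2 measure"
  assumes "diagonal_gaussian \<mu> hartley (\<lambda>n. (japanese_bracket n)\<^sup>2 powr (- \<alpha>))" and "\<alpha> > 1"
    and ac: "absolutely_continuous \<mu> (transported_measure X \<mu> t)"
  shows "inv (X t) x = x + inv (X t) 0"
proof -
  interpret G: diagonal_gaussian \<mu> hartley "\<lambda>n. (japanese_bracket n)\<^sup>2 powr (- \<alpha>)" by fact
  let ?S = "pullback (inv (X t)) :: 'n torus_L2 \<Rightarrow> 'n torus_L2"
  let ?S' = "pullback (X t) :: 'n torus_L2 \<Rightarrow> 'n torus_L2"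
  have ab: "min 0 t \<le> max 0 t" by simp
  obtain K where K: "K \<ge> 1" "\<And>a b x y. min 0 t \<le> a \<Longrightarrow> a \<le> max 0 t \<Longrightarrow> min 0 t \<le> b \<Longrightarrow> b \<le> max 0 t \<Longrightarrow>
     norm (transition a b x - transition a b y) \<le> K * norm (x - y)"
    by (rule transition_lipschitz[OF ab]) (rule that)
  show ?thesis
  proof (rule energy_rigidity[OF torus_map_inv_X K(1)])
    show "norm (inv (X t) x - inv (X t) y) \<le> K * norm (x - y)" for x y
      using K(2)[of t 0 x y] by (simp add: transition_to_0)
    fix \<epsilon> :: real assume "\<epsilon> > 0"
    have adj: "f \<bullet> ?S g = ?S' f \<bullet> g" for f g
      by (rule inner_pullback_adjoint[OF torus_map_X torus_map_inv_X, symmetric]) simp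
    have ac': "absolutely_continuous \<mu> (distr \<mu> borel ?S)"
      using ac by (simp add: transported_measure_def transport_eq_pullback[abs_def])
    have iso: "norm (?S (hartley k)) \<le> 1" for k
      by (simp add: norm_eq_sqrt_inner inner_pullback[OF torus_map_inv_X] hartley.orthonormal)
    have jb: "(japanese_bracket i)\<^sup>2 \<ge> 1" for i :: "int^'n"
      using japanese_bracket_ge_1[of i] by simp
    obtain R where "\<And>k J. finite J \<Longrightarrow> (japanese_bracket k)\<^sup>2 \<ge> R \<Longrightarrow>
        (\<Sum>m\<in>J. (japanese_bracket m)\<^sup>2 * (?S (hartley k) \<bullet> hartley m)\<^sup>2) \<le> (1 + \<epsilon>) * (japanese_bracket k)\<^sup>2"
      by (rule G.energy_bound[OF pullback_borel[OF torus_map_inv_X] adj ac' iso refl jb \<open>\<alpha> > 1\<close> \<open>\<epsilon> > 0\<close>]) (rule that)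
    then show "\<exists>R. \<forall>n J. finite J \<longrightarrow> R \<le> (japanese_bracket n)\<^sup>2 \<longrightarrow>
      (\<Sum>m\<in>J. (japanese_bracket m)\<^sup>2 * (?S (hartley n) \<bullet> hartley m)\<^sup>2) \<le> (1 + \<epsilon>) * (japanese_bracket n)\<^sup>2"
      by blast
  qed
qed

lemma invariance_equivalence:
  fixes \<mu> :: "'n torus_L2 measure"
  assumes G: "diagonal_gaussian \<mu> hartley (\<lambda>n. (japanese_bracket n)\<^sup>2 powr (- \<alpha>))" and "\<alpha> > 1"
  shows "(quasi_invariant_under_transport X \<mu> \<longleftrightarrow> invariant_under_transport X \<mu>) \<and>
         (invariant_under_transport X \<mu> \<longleftrightarrow> spatially_constant u)"
proof -
  have "spatially_constant u" if q: "quasi_invariant_under_transport X \<mu>"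
  proof (rule spatially_constant_if_translation)
    fix t x
    have inv: "inv (X t) y = y + inv (X t) 0" for y
      by (rule inv_X_translation_if_absolutely_continuous[OF G \<open>\<alpha> > 1\<close>])
        (use q in \<open>simp add: quasi_invariant_under_transport_def\<close>)
    have "X t y = y - inv (X t) 0" for y
      unfolding eq_diff_eq using inv[of "X t y"] by (simp only: X_inv)
    from this[of x] this[of 0] show "X t x = x + X t 0" by (simp only: add_0 diff_conv_add_uminus)
  qed
  moreover have "invariant_under_transport X \<mu>" if "spatially_constant u"
    unfolding invariant_under_transport_def
  proof
    fix t
    have "inv (X t) = (\<lambda>x. x + - X t 0)"
    proof
      fix x
      have "inv (X t) x = x - X t 0"
        unfolding eq_diff_eq using translation_if_spatially_constant[OF that, of t "inv (X t) x"] by (simp only: X_inv)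
      then show "inv (X t) x = x + - X t 0" by (simp only: diff_conv_add_uminus)
    qed
    then show "transported_measure X \<mu> t = \<mu>"
      using translation_invariant_gaussian[OF G, of "- X t 0"]
      by (simp add: transported_measure_def transport_eq_pullback[abs_def])
  qed
  moreover have "quasi_invariant_under_transport X \<mu>" if "invariant_under_transport X \<mu>"
    using that by (simp add: invariant_under_transport_def quasi_invariant_under_transport_def absolutely_continuous_def)
  ultimately show ?thesis by blast
qed

end

lemma spatially_constant_cong:
  assumes "AE t in lebesgue. v t = u t"
  shows "spatially_constant v \<longleftrightarrow> spatially_constant u"
proof -
  have "(AE t in lebesgue. \<forall>x. v t x = c t) \<longleftrightarrow> (AE t in lebesgue. \<forall>x. u t x = c t)" for c
    using assms by (rule eventually_subst[OF eventually_mono]) simp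
  then show ?thesis by (simp add: spatially_constant_def)
qed

text \<open>The integrated flow equation does not see null sets of times.\<close>

lemma is_flow_of_cong:
  assumes "AE t in lebesgue. v t = u t" "is_flow_of u X"
  shows "is_flow_of v X"
proof -
  obtain Z where Z: "Z \<in> null_sets lebesgue" "\<And>t. t \<notin> Z \<Longrightarrow> v t = u t"
    using assms(1) unfolding eventually_ae_filter by auto
  then have "negligible Z" by (simp add: negligible_iff_null_sets)
  have "(\<lambda>s. v s (X s x)) absolutely_integrable_on {a..b} \<and> X b x - X a x = integral {a..b} (\<lambda>s. v s (X s x))"
    if "a \<le> b" for a b x
  proof -
    have "(\<lambda>s. u s (X s x)) absolutely_integrable_on {a..b}" "X b x - X a x = integral {a..b} (\<lambda>s. u s (X s x))"
      using assms(2) that by (auto simp: is_flow_of_def)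
    moreover have "integral {a..b} (\<lambda>s. v s (X s x)) = integral {a..b} (\<lambda>s. u s (X s x))"
      by (rule integral_spike[OF \<open>negligible Z\<close>]) (use Z(2) in auto)
    ultimately show ?thesis
      using absolutely_integrable_spike[OF _ \<open>negligible Z\<close>, where f = "\<lambda>s. u s (X s x)" and T = "{a..b}" and g = "\<lambda>s. v s (X s x)"]
        Z(2) by auto
  qed
  then show ?thesis using assms(2) by (simp add: is_flow_of_def)
qed

theorem corollary1p9:
  fixes \<alpha> \<epsilon> :: real
    and u :: "real \<Rightarrow> real^'n \<Rightarrow> real^'n"
    and X :: "real \<Rightarrow> real^'n \<Rightarrow> real^'n"
    and \<mu> :: "('n::finite) torus_L2 measure"
  assumes "CARD('n) \<ge> 2"
    and "\<alpha> > real CARD('n) / 2"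
    and "u \<in> L1_loc_C \<alpha>"
    and "\<epsilon> > 0" and "u \<in> L1_loc_holder 1 \<epsilon>"
    and "AE t in lebesgue. \<forall>x. divergence (u t) x = 0"
    and "is_flow_of u X"
    and "centered_gaussian \<mu>"
    and "has_covariance_operator \<mu> (bessel_potential \<alpha>)"
  shows "(quasi_invariant_under_transport X \<mu> \<longleftrightarrow> invariant_under_transport X \<mu>) \<and>
         (invariant_under_transport X \<mu> \<longleftrightarrow> spatially_constant u)"
proof -
  \<comment> \<open>\<open>v\<close> differs from \<open>u\<close> only at a null set of times, so
    \<open>X\<close> is a flow of both, and the two invariance conditions mention only
    \<open>X\<close>.\<close>
  obtain v N where v: "AE t in lebesgue. v t = u t" "\<And>t. regular_field (v t) (N t)"
    "\<And>x. (\<lambda>t. v t x) \<in> borel_measurable lebesgue"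
    "\<And>i x. (\<lambda>t. partial_deriv i (v t) x) \<in> borel_measurable lebesgue"
    "\<And>a b. N integrable_on {a..b}"
    by (rule L1_loc_holder_regular[OF assms(5,6)]) (rule that)
  have "is_flow_of v X" using v(1) assms(7) by (rule is_flow_of_cong)
  then interpret torus_flow v N X using v by unfold_locales
  \<comment> \<open>The dimension enters here: being at least 2, it makes the exponent in Jensen's
    argument exceed 1.\<close>
  have "\<alpha> > 1" using assms(1,2) by linarith
  with diagonal_gaussian_bessel[OF assms(8,9)] show ?thesis
    using spatially_constant_cong[OF v(1)] invariance_equivalence by simp
qed

end
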